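(* Let $n\ge1$. For every $\lambda>2n-1$, the von Neumann algebras of intertwining operators $\mathrm{End}_{\mathrm{U}(n)_L}(\mathcal{A}^2_\lambda(\mathrm{D}^{\mathrm{I}}_{n\times n}))$ and $\mathrm{End}_{\mathrm{U}(n)_R}(\mathcal{A}^2_\lambda(\mathrm{D}^{\mathrm{I}}_{n\times n}))$ are the commutant of each other.
   Context: $\mathrm{D}^{\mathrm{I}}_{n\times n}=\{Z\in M_{n\times n}(\mathbb{C}): Z^*Z<I_n\}$. For $\lambda>2n-1$, $dv_\lambda(Z)=c_\lambda\det(I_n-ZZ^* )^{\lambda-2n}dv(Z)$, with $dv$ Lebesgue measure and $c_\lambda>0$ such that $v_\lambda(\mathrm{D}^{\mathrm{I}}_{n\times n})=1$. $\mathcal{A}^2_\lambda(\mathrm{D}^{\mathrm{I}}_{n\times n})$ is the weighted Bergman space of holomorphic functions in $L^2(\mathrm{D}^{\mathrm{I}}_{n\times n},v_\lambda)$. $\mathrm{U}(n)\times\mathrm{U}(n)$ acts unitarily on it by $(\pi_\lambda(A,B)f)(Z)=f(A^{-1}ZB)$; $\mathrm{U}(n)_L=\mathrm{U}(n)\times\{I_n\}$ and $\mathrm{U}(n)_R=\{I_n\}\times\mathrm{U}(n)$. For a subgroup $H$, $\mathrm{End}_H(\mathcal{A}^2_\lambda(\mathrm{D}^{\mathrm{I}}_{n\times n}))$ is the algebra of bounded operators on $\mathcal{A}^2_\lambda(\mathrm{D}^{\mathrm{I}}_{n\times n})$ that commute with $\pi_\lambda(h)$ for every $h\in H$. *)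

theory Defs
  imports "HOL-Analysis.Analysis"
begin

type_synonym 'n cmatrix = "complex^'n^'n"

definition conj_transpose :: "'n::finite cmatrix \<Rightarrow> 'n cmatrix"
  where "conj_transpose Z = (\<chi> i j. cnj (Z $ j $ i))"

definition pos_def :: "'n::finite cmatrix \<Rightarrow> bool"
  where "pos_def M \<longleftrightarrow> conj_transpose M = M \<and>
    (\<forall>v. v \<noteq> 0 \<longrightarrow> 0 < Re (\<Sum>i\<in>UNIV. cnj (v $ i) * (M *v v) $ i))"

definition cartan_domain :: "'n::finite cmatrix set"
  where "cartan_domain = {Z. pos_def (mat 1 - conj_transpose Z ** Z)}"

text \<open>The matrix \<open>mat 1 - Z ** conj_transpose Z\<close> is Hermitian, so its determinant is real,
  and it is positive on the domain; \<^term>\<open>Re\<close> only changes the type.\<close>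

definition bergman_weight :: "real \<Rightarrow> 'n::finite cmatrix \<Rightarrow> real"
  where "bergman_weight lam Z =
    Re (det (mat 1 - Z ** conj_transpose Z)) powr (lam - 2 * real CARD('n))"

text \<open>The constant making the weighted measure of the domain equal to 1. The type argument
  selects the matrix size.\<close>

definition bergman_const :: "'n::finite itself \<Rightarrow> real \<Rightarrow> real"
  where "bergman_const (_ :: 'n itself) lam =
    1 / (LINT Z:(cartan_domain :: 'n cmatrix set)|lborel. bergman_weight lam Z)"

definition bergman_measure :: "real \<Rightarrow> 'n::finite cmatrix measure"
  where "bergman_measure lam = density lborel
    (\<lambda>Z. ennreal (bergman_const TYPE('n) lam * indicator cartan_domain Z * bergman_weight lam Z))"

text \<open>Holomorphy in several variables on an open set: the Frechet derivative exists at every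
  point and is complex linear.\<close>

definition holomorphic_mat_on :: "('n::finite cmatrix \<Rightarrow> complex) \<Rightarrow> 'n cmatrix set \<Rightarrow> bool"
  where "holomorphic_mat_on f D \<longleftrightarrow> (\<forall>Z\<in>D. \<exists>f'. (f has_derivative f') (at Z) \<and>
    (\<forall>c W. f' (\<chi> i j. c * W $ i $ j) = c * f' W))"

definition square_integrable :: "'a measure \<Rightarrow> ('a \<Rightarrow> complex) set"
  where "square_integrable M =
    {f \<in> borel_measurable M. integrable M (\<lambda>x. (cmod (f x))\<^sup>2)}"

text \<open>A function on the domain is represented by its extension by zero to all matrices, so that
  equality in HOL is equality of functions on the domain.\<close>

definition bergman_space :: "real \<Rightarrow> ('n::finite cmatrix \<Rightarrow> complex) set"
  where "bergman_space lam = {f \<in> square_integrable (bergman_measure lam).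
    holomorphic_mat_on f cartan_domain \<and> (\<forall>Z. Z \<notin> cartan_domain \<longrightarrow> f Z = 0)}"

definition bergman_norm :: "real \<Rightarrow> ('n::finite cmatrix \<Rightarrow> complex) \<Rightarrow> real"
  where "bergman_norm lam f = sqrt (LINT Z|bergman_measure lam. (cmod (f Z))\<^sup>2)"

text \<open>An operator on the Bergman space is a HOL function that is \<^term>\<open>undefined\<close> off that space,
  so that equality in HOL is equality of operators.\<close>

definition bounded_ops ::
  "real \<Rightarrow> (('n::finite cmatrix \<Rightarrow> complex) \<Rightarrow> ('n cmatrix \<Rightarrow> complex)) set"
  where "bounded_ops lam = {T \<in> bergman_space lam \<rightarrow>\<^sub>E bergman_space lam.
    (\<forall>f\<in>bergman_space lam. \<forall>g\<in>bergman_space lam. T (\<lambda>Z. f Z + g Z) = (\<lambda>Z. T f Z + T g Z)) \<and>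
    (\<forall>c. \<forall>f\<in>bergman_space lam. T (\<lambda>Z. c * f Z) = (\<lambda>Z. c * T f Z)) \<and>
    (\<exists>K. \<forall>f\<in>bergman_space lam. bergman_norm lam (T f) \<le> K * bergman_norm lam f)}"

definition unitary_group :: "'n::finite cmatrix set"
  where "unitary_group = {A. conj_transpose A ** A = mat 1 \<and> A ** conj_transpose A = mat 1}"

definition unitary_left :: "('n::finite cmatrix \<times> 'n cmatrix) set"
  where "unitary_left = unitary_group \<times> {mat 1}"

definition unitary_right :: "('n::finite cmatrix \<times> 'n cmatrix) set"
  where "unitary_right = {mat 1} \<times> unitary_group"

definition bergman_rep ::
  "'n::finite cmatrix \<times> 'n cmatrix \<Rightarrow> ('n cmatrix \<Rightarrow> complex) \<Rightarrow> ('n cmatrix \<Rightarrow> complex)"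
  where "bergman_rep h f = (\<lambda>Z. f (matrix_inv (fst h) ** Z ** snd h))"

definition intertwiners ::
  "real \<Rightarrow> ('n::finite cmatrix \<times> 'n cmatrix) set \<Rightarrow>
    (('n cmatrix \<Rightarrow> complex) \<Rightarrow> ('n cmatrix \<Rightarrow> complex)) set"
  where "intertwiners lam H = {T \<in> bounded_ops lam.
    \<forall>h\<in>H. \<forall>f\<in>bergman_space lam. T (bergman_rep h f) = bergman_rep h (T f)}"

definition commutant ::
  "real \<Rightarrow> (('n::finite cmatrix \<Rightarrow> complex) \<Rightarrow> ('n cmatrix \<Rightarrow> complex)) set \<Rightarrow>
    (('n cmatrix \<Rightarrow> complex) \<Rightarrow> ('n cmatrix \<Rightarrow> complex)) set"
  where "commutant lam M = {T \<in> bounded_ops lam.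
    \<forall>S\<in>M. \<forall>f\<in>bergman_space lam. T (S f) = S (T f)}"

end

theory Submission
  imports Defs "HOL-Complex_Analysis.Complex_Analysis"
begin

text \<open>Write \<open>L\<close> and \<open>R\<close> for the actions of the two unitary groups. Left and right translations commute,
so each right translation belongs to the algebra of \<open>L\<close>-intertwiners; hence an operator commuting
with all \<open>L\<close>-intertwiners commutes with \<open>R\<close>, and symmetrically. What has to be proved is that every
\<open>L\<close>-intertwiner \<open>S\<close> commutes with every \<open>R\<close>-intertwiner \<open>T\<close>
(\<open>left_right_intertwiners_commute\<close>); this single statement gives both remaining inclusions.

The scalars of modulus one act through both groups. So \<open>S\<close> and \<open>T\<close> commute with rotations and
preserve each space \<open>P_k\<close> of homogeneous polynomials of degree \<open>k\<close>
(\<open>eigenfunction_eq_taylor_part\<close>, \<open>poly_action_represents\<close>). On \<open>P_k\<close> the claim is pure algebra. The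
unitary group is a uniqueness set for polynomials (\<open>hpoly_zero_if_zero_on_unitary_group\<close>): one
differentiates along unitary curves, whose tangent vectors span all matrices over the complex
numbers, and argues by induction on the degree. Therefore \<open>S\<close> commutes with \<open>p \<mapsto> p (A ** \<cdot>)\<close>
for every matrix \<open>A\<close>, and \<open>T\<close> with \<open>p \<mapsto> p (\<cdot> ** B)\<close> for every matrix \<open>B\<close>. Evaluating at the
identity gives \<open>(S p)(A) = S (Z \<mapsto> p (A ** Z)) (1)\<close> and \<open>(T p)(B) = T (W \<mapsto> p (W ** B)) (1)\<close>. Both
\<open>(S (T p))(A)\<close> and \<open>(T (S p))(A)\<close> thus arise from the function \<open>p (W ** A ** Z)\<close> by applying \<open>S\<close> in the variable
\<open>Z\<close> and \<open>T\<close> in the variable \<open>W\<close>, in the two possible orders. This function is a finite sum of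
products of polynomials in \<open>W\<close> and polynomials in \<open>Z\<close>, so the order does not matter
(\<open>hkernel_swap\<close>, \<open>left_right_commute_on_hpoly\<close>).

Since \<open>S\<close> and \<open>T\<close> are bounded, it remains to see that a function of the Bergman space is the
norm limit of its Taylor polynomials. The homogeneous parts of a holomorphic function are polynomials
(\<open>hpoly_taylor_part\<close>), which rests on the holomorphy of partial derivatives
(\<open>holomorphic_mat_on_partial\<close>). Rotation invariance of the measure and Parseval's identity for
roots of unity give orthogonality of the homogeneous parts and a Bessel inequality, and Fatou's
lemma then bounds the tails (\<open>taylor_tail_tendsto_0\<close>).

Two facts about the measure enter. Unitary translations preserve Lebesgue measure because they are
isometries (\<open>nn_integral_lborel_isometry\<close>). And the weight is integrable, so that polynomials
lie in the space and the normalising constant is positive (\<open>bergman_weight_integrable\<close>). For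
\<open>lam < 2 * n\<close> the weight is unbounded. Its integral is estimated by removing one row and the
corresponding column at a time: as a function of a diagonal entry, \<open>det (1 - Z Z*)\<close> is a constant times
\<open>\<rho> - \<bar>t - t0\<bar>\<^sup>2\<close>, the constant being the same determinant for the smaller matrix, and the integral over
\<open>t\<close> is elementary (\<open>hdet_along_diagonal_entry\<close>, \<open>masked_weight_slice\<close>).\<close>

section \<open>Homogeneous polynomials in the matrix entries\<close>

definition cscale :: "complex \<Rightarrow> 'n::finite cmatrix \<Rightarrow> 'n cmatrix"
  where "cscale c Z = (\<chi> i j. c * Z $ i $ j)"

lemma cscale_nth [simp]: "cscale c Z $ i $ j = c * Z $ i $ j"
  by (simp add: cscale_def)

lemma cscale_cscale [simp]: "cscale a (cscale b Z) = cscale (a * b) Z"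
  by (simp add: cscale_def vec_eq_iff)

lemma cscale_one [simp]: "cscale 1 Z = Z"
  by (simp add: cscale_def vec_eq_iff)

lemma cscale_mult_right [simp]: "A ** cscale c Z = cscale c (A ** Z)"
  by (simp add: vec_eq_iff matrix_matrix_mult_def sum_distrib_left mult_ac)

lemma cscale_mult_left [simp]: "cscale c A ** Z = cscale c (A ** Z)"
  by (simp add: vec_eq_iff matrix_matrix_mult_def sum_distrib_left mult_ac)

lemma cscale_zero [simp]: "cscale 0 Z = 0"
  by (simp add: vec_eq_iff)

lemma bounded_linear_cscale_left: "bounded_linear (\<lambda>c. cscale c W)"
  by (intro linear_conv_bounded_linear[THEN iffD1] linearI) (simp_all add: vec_eq_iff algebra_simps)

text \<open>Homogeneous polynomials are generated inductively instead of being given by coefficients: all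
the facts about them that are needed follow by rule induction, without any basis of monomials.\<close>

inductive hpoly :: "nat \<Rightarrow> ('n::finite cmatrix \<Rightarrow> complex) \<Rightarrow> bool" where
  const: "hpoly 0 (\<lambda>_. c)"
| coord: "hpoly k p \<Longrightarrow> hpoly (Suc k) (\<lambda>Z. Z $ i $ j * p Z)"
| add: "hpoly k p \<Longrightarrow> hpoly k q \<Longrightarrow> hpoly k (\<lambda>Z. p Z + q Z)"

lemma hpoly_zero: "hpoly k (\<lambda>_. 0)"
proof (induction k)
  case (Suc k)
  from hpoly.coord[OF this] show ?case by simp
qed (rule hpoly.const)

lemma hpoly_smult: "hpoly k p \<Longrightarrow> hpoly k (\<lambda>Z. c * p Z)"
proof (induction rule: hpoly.induct)
  case (const d)
  show ?case by (rule hpoly.const)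
next
  case (coord k p i j)
  from hpoly.coord[OF coord.IH, of i j] show ?case by (simp add: mult.left_commute)
next
  case (add k p q)
  from hpoly.add[OF add.IH] show ?case by (simp add: distrib_left)
qed

lemma hpoly_sum: "(\<And>a. a \<in> A \<Longrightarrow> hpoly k (p a)) \<Longrightarrow> hpoly k (\<lambda>Z. \<Sum>a\<in>A. p a Z)"
  by (induction A rule: infinite_finite_induct) (auto intro: hpoly_zero hpoly.add)

lemma hpoly_diff: "hpoly k p \<Longrightarrow> hpoly k q \<Longrightarrow> hpoly k (\<lambda>Z. p Z - q Z)"
  using hpoly.add[OF _ hpoly_smult[of k q "-1"]] by simp

lemma hpoly_homogeneous: "hpoly k p \<Longrightarrow> p (cscale c Z) = c ^ k * p Z"
  by (induction rule: hpoly.induct) (auto simp: algebra_simps)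

lemma hpoly_translate: "hpoly k p \<Longrightarrow> hpoly k (\<lambda>Z. p (A ** Z ** B))"
proof (induction rule: hpoly.induct)
  case (const d)
  show ?case by (rule hpoly.const)
next
  case (coord k p i j)
  have "hpoly (Suc k) (\<lambda>Z. \<Sum>m\<in>UNIV. \<Sum>l\<in>UNIV. A $ i $ l * B $ m $ j * (Z $ l $ m * p (A ** Z ** B)))"
    by (intro hpoly_sum hpoly_smult hpoly.coord coord.IH)
  also have "(\<lambda>Z. \<Sum>m\<in>UNIV. \<Sum>l\<in>UNIV. A $ i $ l * B $ m $ j * (Z $ l $ m * p (A ** Z ** B)))
      = (\<lambda>Z. (A ** Z ** B) $ i $ j * p (A ** Z ** B))"
    by (simp add: matrix_matrix_mult_def sum_distrib_left sum_distrib_right mult_ac)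
  finally show ?case .
next
  case (add k p q)
  from hpoly.add[OF add.IH] show ?case .
qed

lemma hpoly_has_derivative:
  assumes "hpoly k p"
  obtains D where "\<And>Z. (p has_derivative D Z) (at Z)"
    and "\<And>Z c W. D Z (cscale c W) = c * D Z W"
    and "\<And>j W. k = Suc j \<Longrightarrow> hpoly j (\<lambda>Z. D Z W)"
proof -
  have "\<exists>D. (\<forall>Z. (p has_derivative D Z) (at Z)) \<and> (\<forall>Z c W. D Z (cscale c W) = c * D Z W)
      \<and> (k = 0 \<longrightarrow> (\<forall>Z W. D Z W = 0)) \<and> (\<forall>j W. k = Suc j \<longrightarrow> hpoly j (\<lambda>Z. D Z W))"
    using assms
  proof (induction rule: hpoly.induct)
    case (const c)
    show ?case by (intro exI[of _ "\<lambda>_ _. 0"]) auto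
  next
    case (coord k p i j)
    then obtain D where D: "\<And>Z. (p has_derivative D Z) (at Z)"
      "\<And>Z c W. D Z (cscale c W) = c * D Z W"
      "k = 0 \<Longrightarrow> (\<forall>Z W. D Z W = 0)" "\<And>j W. k = Suc j \<Longrightarrow> hpoly j (\<lambda>Z. D Z W)" by blast
    have "hpoly k (\<lambda>Z. Z $ i $ j * D Z W + W $ i $ j * p Z)" for W
    proof (cases k)
      case 0
      with D(3) hpoly_smult[OF coord.hyps] show ?thesis by simp
    next
      case (Suc l)
      show ?thesis
        using hpoly.add[OF hpoly.coord[OF D(4)[OF Suc]] hpoly_smult[OF coord.hyps, unfolded Suc]]
        by (simp add: Suc)
    qed
    moreover have "((\<lambda>Z. Z $ i $ j * p Z) has_derivative (\<lambda>W. Z $ i $ j * D Z W + W $ i $ j * p Z)) (at Z)" for Z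
      by (rule has_derivative_eq_rhs, rule has_derivative_mult[OF _ D(1)])
         (auto intro!: bounded_linear.has_derivative[OF bounded_linear_vec_nth] derivative_eq_intros)
    ultimately show ?case
      by (intro exI[of _ "\<lambda>Z W. Z $ i $ j * D Z W + W $ i $ j * p Z"]) (auto simp: D(2) algebra_simps)
  next
    case (add k p q)
    then obtain D E where "\<And>Z. (p has_derivative D Z) (at Z)"
      "\<And>Z c W. D Z (cscale c W) = c * D Z W"
      "k = 0 \<Longrightarrow> (\<forall>Z W. D Z W = 0)" "\<And>j W. k = Suc j \<Longrightarrow> hpoly j (\<lambda>Z. D Z W)"
      "\<And>Z. (q has_derivative E Z) (at Z)"
      "\<And>Z c W. E Z (cscale c W) = c * E Z W"
      "k = 0 \<Longrightarrow> (\<forall>Z W. E Z W = 0)" "\<And>j W. k = Suc j \<Longrightarrow> hpoly j (\<lambda>Z. E Z W)" by blast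
    then show ?case
      by (intro exI[of _ "\<lambda>Z W. D Z W + E Z W"])
         (auto intro!: has_derivative_add hpoly.add simp: algebra_simps)
  qed
  with that show ?thesis by blast
qed

section \<open>The unitary group is a uniqueness set for polynomials\<close>

lemma matrix_add_rdistrib: "(A + B) ** C = A ** C + B ** C" for C :: "'a::semiring_1^'k^'m"
  by (simp add: vec_eq_iff matrix_matrix_mult_def distrib_right sum.distrib)

lemma conj_transpose_mult: "conj_transpose (A ** B) = conj_transpose B ** conj_transpose A"
  by (simp add: conj_transpose_def vec_eq_iff matrix_matrix_mult_def mult.commute)

lemma conj_transpose_involution [simp]: "conj_transpose (conj_transpose A) = A"
  by (simp add: conj_transpose_def vec_eq_iff)

lemma conj_transpose_mat1 [simp]: "conj_transpose (mat 1) = mat 1"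
  by (simp add: conj_transpose_def vec_eq_iff mat_def)

lemma unitary_group_mult: "A \<in> unitary_group \<Longrightarrow> B \<in> unitary_group \<Longrightarrow> A ** B \<in> unitary_group"
  by (simp add: unitary_group_def conj_transpose_mult)
     (metis matrix_mul_assoc matrix_mul_lid)

lemma unitary_group_mat1 [simp]: "mat 1 \<in> unitary_group"
  by (simp add: unitary_group_def)

definition dyad :: "complex^'n::finite \<Rightarrow> complex^'n \<Rightarrow> 'n cmatrix"
  where "dyad u v = (\<chi> a b. u $ a * cnj (v $ b))"

text \<open>The rotation by the angle \<open>t\<close> in the direction of \<open>v\<close>, a curve of unitary matrices whose velocity at
\<open>t = 0\<close> is a multiple of the rank-one matrix \<open>dyad v v\<close>.\<close>

lemma unitary_dyad_rotation:
  fixes v :: "complex^'n::finite"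
  assumes "v \<noteq> 0"
  shows "mat 1 + cscale ((cis t - 1) / of_real ((norm v)\<^sup>2)) (dyad v v) \<in> unitary_group"
proof -
  define r where "r = (norm v)\<^sup>2"
  define c where "c = (cis t - 1) / of_real r"
  have r: "r \<noteq> 0" using assms by (simp add: r_def)
  have rv: "(\<Sum>a\<in>UNIV. cnj (v $ a) * v $ a) = of_real r"
    by (simp add: r_def norm_vec_def L2_set_def sum_nonneg mult.commute complex_norm_square
        del: of_real_power)
  have PP: "dyad v v ** dyad v v = cscale (of_real r) (dyad v v)"
    by (simp add: vec_eq_iff matrix_matrix_mult_def dyad_def flip: rv)
       (simp add: sum_distrib_left sum_distrib_right mult_ac)
  have adj: "conj_transpose (mat 1 + cscale d (dyad v v)) = mat 1 + cscale (cnj d) (dyad v v)" for d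
    by (simp add: vec_eq_iff conj_transpose_def dyad_def mat_def)
  have prod: "(mat 1 + cscale d (dyad v v)) ** (mat 1 + cscale e (dyad v v))
      = mat 1 + cscale (d + e + d * e * of_real r) (dyad v v)" for d e
    by (simp add: matrix_add_ldistrib matrix_add_rdistrib PP) (simp add: vec_eq_iff algebra_simps)
  have "(cis t - 1) * (cis (-t) - 1) = 2 - cis t - cis (-t)"
    by (simp add: algebra_simps cis_mult)
  then have "c + cnj c + c * cnj c * of_real r = 0"
    using r by (simp add: c_def cis_cnj field_simps power2_eq_square)
  then show ?thesis
    unfolding unitary_group_def r_def[symmetric] c_def[symmetric]
    by (simp add: adj prod mult_ac add_ac)
qed

text \<open>At a unitary \<open>U\<close> the derivative vanishes on the velocities \<open>\<i> * U ** dyad v v\<close> of the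
curves above. It is complex linear, and by polarization the matrices \<open>dyad v v\<close> span all
matrices over the complex numbers, so it vanishes on everything.\<close>

lemma derivative_vanishes_along_unitary_group:
  fixes p :: "'n::finite cmatrix \<Rightarrow> complex"
  assumes der: "(p has_derivative D) (at U)" and lin: "\<And>c W. D (cscale c W) = c * D W"
    and van: "\<And>V. V \<in> unitary_group \<Longrightarrow> p V = 0" and U: "U \<in> unitary_group"
  shows "D W = 0"
proof -
  interpret D: bounded_linear D using der by (rule has_derivative_bounded_linear)
  define L where "L X = D (U ** X)" for X
  have L_add: "L (X + Y) = L X + L Y" for X Y
    by (simp add: L_def matrix_add_ldistrib D.add)
  have L_scale: "L (cscale c X) = c * L X" for c X
    by (simp add: L_def lin)
  have L_sum: "L (\<Sum>a\<in>A. X a) = (\<Sum>a\<in>A. L (X a))" if "finite A" for A :: "'b set" and X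
    using that by induction (simp_all add: L_add, simp add: L_def D.zero)
  have dd: "L (dyad v v) = 0" for v
  proof (cases "v = 0")
    case True
    then have "dyad v v = 0" by (simp add: dyad_def vec_eq_iff)
    then show ?thesis by (simp add: L_def D.zero)
  next
    case False
    define r where "r = (norm v)\<^sup>2"
    have r: "r \<noteq> 0" using False by (simp add: r_def)
    define \<gamma> where "\<gamma> t = U ** (mat 1 + cscale ((cis t - 1) / of_real r) (dyad v v))" for t
    have \<gamma>: "\<gamma> t = U + cscale ((cis t - 1) / of_real r) (U ** dyad v v)" for t
      by (simp add: \<gamma>_def matrix_add_ldistrib)
    have "((\<lambda>t. (cis t - 1) / of_real r) has_derivative (\<lambda>t. \<i> * of_real t / of_real r)) (at 0)"
      using r by (auto simp: divide_inverse scaleR_conv_of_real mult_ac intro!: derivative_eq_intros)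
    then have "(\<gamma> has_derivative (\<lambda>t. cscale (\<i> * of_real t / of_real r) (U ** dyad v v))) (at 0)"
      unfolding \<gamma>[abs_def]
      by (intro has_derivative_eq_rhs[OF has_derivative_add[OF has_derivative_const
            bounded_linear.has_derivative[OF bounded_linear_cscale_left]]]) auto
    moreover have "\<gamma> 0 = U" by (simp add: \<gamma> vec_eq_iff)
    ultimately have "((\<lambda>t. p (\<gamma> t)) has_derivative
        (\<lambda>t. D (cscale (\<i> * of_real t / of_real r) (U ** dyad v v)))) (at 0)"
      using has_derivative_compose[of \<gamma> _ 0 UNIV p D] der by simp
    moreover have "p (\<gamma> t) = 0" for t
      unfolding \<gamma>_def r_def by (intro van unitary_group_mult U unitary_dyad_rotation False)
    ultimately have "((\<lambda>t::real. 0::complex) has_derivative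
        (\<lambda>t. D (cscale (\<i> * of_real t / of_real r) (U ** dyad v v)))) (at 0)" by simp
    from has_derivative_unique[OF this has_derivative_const]
    have "D (cscale (\<i> * of_real 1 / of_real r) (U ** dyad v v)) = 0" by (rule fun_cong)
    then show ?thesis using r by (simp add: lin L_def)
  qed
  define E where "E j k = dyad (axis j 1) (axis k 1 :: complex^'n)" for j k :: 'n
  have E0: "L (E j k) = 0" for j k
  proof -
    have 1: "dyad (axis j 1 + axis k 1) (axis j 1 + axis k 1) = E j j + E k k + E j k + E k j"
      by (simp add: E_def dyad_def vec_eq_iff algebra_simps)
    \<comment> \<open>Together with the previous identity this separates \<open>E j k\<close> from \<open>E k j\<close>.\<close>
    have 2: "dyad (axis j 1 + axis k \<i>) (axis j 1 + axis k \<i>)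
        = E j j + E k k + cscale (-\<i>) (E j k) + cscale \<i> (E k j)"
      by (auto simp add: E_def dyad_def vec_eq_iff algebra_simps axis_def)
    have 3: "L (E j j) = 0" for j unfolding E_def by (rule dd)
    have "L (E j k) + L (E k j) = 0"
      using dd[of "axis j 1 + axis k 1"] unfolding 1 by (simp add: L_add 3)
    moreover have "\<i> * (L (E k j) - L (E j k)) = 0"
      using dd[of "axis j 1 + axis k \<i>"] unfolding 2 by (simp add: L_add L_scale 3 algebra_simps)
    ultimately show ?thesis by (simp add: add_eq_0_iff)
  qed
  have L0: "L X = 0" for X
  proof -
    have "X = (\<Sum>j\<in>UNIV. \<Sum>k\<in>UNIV. cscale (X $ j $ k) (E j k))"
      by (simp add: vec_eq_iff E_def dyad_def axis_def if_distrib[of cnj] if_distrib[of "\<lambda>x. _ * x"]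
          sum.delta cong: if_cong)
    then have "L X = (\<Sum>j\<in>UNIV. \<Sum>k\<in>UNIV. L (cscale (X $ j $ k) (E j k)))"
      by (metis (no_types, lifting) L_sum finite sum.cong)
    then show ?thesis by (simp add: L_scale E0)
  qed
  have "U ** (conj_transpose U ** W) = W"
    using U by (simp add: unitary_group_def matrix_mul_assoc)
  with L0[of "conj_transpose U ** W"] show ?thesis by (simp add: L_def)
qed

text \<open>Induction on the degree: the partial derivatives of \<open>p\<close> have smaller degree and vanish on the unitary group
as well, so \<open>p\<close> is constant.\<close>

lemma hpoly_zero_if_zero_on_unitary_group:
  assumes "hpoly k p" "\<And>U. U \<in> unitary_group \<Longrightarrow> p U = 0"
  shows "p Z = 0"
  using assms
proof (induction k arbitrary: p Z)
  case 0
  show ?case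
    using hpoly_homogeneous[OF 0(1), of 0 Z] hpoly_homogeneous[OF 0(1), of 0 "mat 1"]
      0(2)[OF unitary_group_mat1] by simp
next
  case (Suc k)
  obtain D where D: "\<And>Z. (p has_derivative D Z) (at Z)"
    "\<And>Z c W. D Z (cscale c W) = c * D Z W" "\<And>W. hpoly k (\<lambda>Z. D Z W)"
    using hpoly_has_derivative[OF Suc.prems(1)] by metis
  have "D Z W = 0" for Z W
    using D(3) derivative_vanishes_along_unitary_group[OF D(1) D(2) Suc.prems(2)] by (rule Suc.IH)
  then have "D Z = (\<lambda>_. 0)" for Z by auto
  with D(1) have "\<exists>c. \<forall>x\<in>UNIV. p x = c"
    by (intro has_derivative_zero_constant) (auto)
  then show ?case using Suc.prems(2)[OF unitary_group_mat1] by auto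
qed

section \<open>Left and right multiplication on polynomials\<close>

text \<open>The algebraic tensor product of the polynomials of degree \<open>k\<close> with themselves, as functions of two matrices.
An operator on polynomials can be applied in either variable of such a function.\<close>

inductive hkernel :: "nat \<Rightarrow> ('n::finite cmatrix \<Rightarrow> 'n cmatrix \<Rightarrow> complex) \<Rightarrow> bool" where
  prod: "hpoly k a \<Longrightarrow> hpoly k b \<Longrightarrow> hkernel k (\<lambda>A Z. a A * b Z)"
| plus: "hkernel k K \<Longrightarrow> hkernel k L \<Longrightarrow> hkernel k (\<lambda>A Z. K A Z + L A Z)"

lemma hkernel_zero: "hkernel k (\<lambda>_ _. 0)"
  using hkernel.prod[OF hpoly_zero hpoly_zero] by simp

lemma hkernel_sum: "(\<And>a. a \<in> A \<Longrightarrow> hkernel k (K a)) \<Longrightarrow> hkernel k (\<lambda>W Z. \<Sum>a\<in>A. K a W Z)"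
  by (induction A rule: infinite_finite_induct) (auto intro: hkernel_zero hkernel.plus)

lemma hkernel_coord: "hkernel k K \<Longrightarrow> hkernel (Suc k) (\<lambda>A Z. A $ i $ l * Z $ m $ j * K A Z)"
proof (induction rule: hkernel.induct)
  case (prod k a b)
  from hkernel.prod[OF hpoly.coord[OF prod(1), of i l] hpoly.coord[OF prod(2), of m j]]
  show ?case by (simp add: mult_ac)
next
  case (plus k K L)
  from hkernel.plus[OF plus.IH] show ?case by (simp add: algebra_simps)
qed

lemma hkernel_translate: "hkernel k K \<Longrightarrow> hkernel k (\<lambda>W Z. K (W ** A) Z)"
proof (induction rule: hkernel.induct)
  case (prod k a b)
  from hkernel.prod[OF hpoly_translate[OF prod(1), of "mat 1" A] prod(2)] show ?case by simp
next
  case (plus k K L)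
  from hkernel.plus[OF plus.IH] show ?case .
qed

lemma hkernel_mult: "hpoly k p \<Longrightarrow> hkernel k (\<lambda>A Z. p (A ** Z))"
proof (induction rule: hpoly.induct)
  case (const c)
  from hkernel.prod[OF hpoly.const[of c] hpoly.const[of 1]] show ?case by simp
next
  case (coord k p i j)
  have "hkernel (Suc k) (\<lambda>A Z. \<Sum>l\<in>UNIV. A $ i $ l * Z $ l $ j * p (A ** Z))"
    by (intro hkernel_sum hkernel_coord coord.IH)
  then show ?case by (simp add: matrix_matrix_mult_def sum_distrib_right)
next
  case (add k p q)
  from hkernel.plus[OF add.IH] show ?case .
qed

definition linear_on_hpoly ::
  "nat \<Rightarrow> (('n::finite cmatrix \<Rightarrow> complex) \<Rightarrow> ('n cmatrix \<Rightarrow> complex)) \<Rightarrow> bool"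
  where "linear_on_hpoly k S \<longleftrightarrow> (\<forall>p. hpoly k p \<longrightarrow> hpoly k (S p)) \<and>
    (\<forall>p q. hpoly k p \<longrightarrow> hpoly k q \<longrightarrow> S (\<lambda>Z. p Z + q Z) = (\<lambda>Z. S p Z + S q Z)) \<and>
    (\<forall>c p. hpoly k p \<longrightarrow> S (\<lambda>Z. c * p Z) = (\<lambda>Z. c * S p Z))"

lemma linear_on_hpolyD:
  assumes "linear_on_hpoly k S" "hpoly k p"
  shows "hpoly k (S p)" "hpoly k q \<Longrightarrow> S (\<lambda>Z. p Z + q Z) = (\<lambda>Z. S p Z + S q Z)"
    "S (\<lambda>Z. c * p Z) = (\<lambda>Z. c * S p Z)" "S (\<lambda>Z. p Z * c) = (\<lambda>Z. S p Z * c)"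
  using assms by (auto simp: linear_on_hpoly_def mult.commute[of _ c])

lemma hkernel_sections:
  assumes "hkernel k K"
  shows "hpoly k (K A)" "hpoly k (\<lambda>A. K A Z)"
  using assms
  by (induction rule: hkernel.induct)
     (auto intro: hpoly.add hpoly_smult simp: mult.commute[of _ "_ Z"])

lemma hkernel_apply:
  assumes "hkernel k K" and S: "linear_on_hpoly k S"
  shows "hpoly k (\<lambda>A. S (K A) Z)" "hpoly k (\<lambda>B. S (\<lambda>A. K A B) Z)"
proof -
  have "hpoly k (\<lambda>A. S (K A) Z) \<and> hpoly k (\<lambda>B. S (\<lambda>A. K A B) Z)" using assms
  proof (induction rule: hkernel.induct)
    case (prod k a b)
    note S = linear_on_hpolyD[OF prod(3)]
    have "(\<lambda>A. S (\<lambda>Z. a A * b Z) Z) = (\<lambda>A. S b Z * a A)"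
      by (simp add: S(3)[OF prod(2)] mult.commute)
    moreover have "(\<lambda>B. S (\<lambda>A. a A * b B) Z) = (\<lambda>B. S a Z * b B)"
      by (simp add: S(4)[OF prod(1)])
    ultimately show ?case using prod(1,2) by (simp add: hpoly_smult)
  next
    case (plus k K L)
    note S = linear_on_hpolyD[OF plus(5)] and s = hkernel_sections[OF plus(1)] hkernel_sections[OF plus(2)]
    show ?case using plus by (simp add: S(2)[OF s(1) s(3)] S(2)[OF s(2) s(4)] hpoly.add)
  qed
  then show "hpoly k (\<lambda>A. S (K A) Z)" "hpoly k (\<lambda>B. S (\<lambda>A. K A B) Z)" by auto
qed

text \<open>Operators acting in different variables commute. On a product \<open>a A * b Z\<close> both sides
are \<open>T a X * S b Y\<close>.\<close>

lemma hkernel_swap: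
  assumes "hkernel k K" and "linear_on_hpoly k S" and "linear_on_hpoly k T"
  shows "S (\<lambda>B. T (\<lambda>A. K A B) X) Y = T (\<lambda>A. S (K A) Y) X"
  using assms
proof (induction rule: hkernel.induct)
  case (prod k a b)
  note S = linear_on_hpolyD[OF prod(3)] and T = linear_on_hpolyD[OF prod(4)]
  have "T (\<lambda>A. a A * b B) X = T a X * b B" for B by (simp add: T(4)[OF prod(1)])
  moreover have "S (\<lambda>B. a A * b B) Y = a A * S b Y" for A by (simp add: S(3)[OF prod(2)])
  ultimately show ?case by (simp add: S(3)[OF prod(2)] T(4)[OF prod(1)])
next
  case (plus k K L)
  note S = linear_on_hpolyD[OF plus(5)] and T = linear_on_hpolyD[OF plus(6)]
  note s = hkernel_sections[OF plus(1)] hkernel_sections[OF plus(2)]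
  note ap = hkernel_apply[OF plus(1,5)] hkernel_apply[OF plus(1,6)]
    hkernel_apply[OF plus(2,5)] hkernel_apply[OF plus(2,6)]
  have "T (\<lambda>A. K A B + L A B) X = T (\<lambda>A. K A B) X + T (\<lambda>A. L A B) X" for B
    by (simp add: T(2)[OF s(2,4)])
  moreover have "S (\<lambda>B. K A B + L A B) Y = S (K A) Y + S (L A) Y" for A
    by (simp add: S(2)[OF s(1,3)])
  ultimately show ?case
    using plus by (simp add: S(2)[OF ap(4) ap(8)] T(2)[OF ap(1) ap(5)])
qed

text \<open>The difference of the two sides at a point is a polynomial in the multiplier, and it vanishes
for unitary multipliers.\<close>

lemma commutes_with_left_multiplication:
  assumes S: "linear_on_hpoly k S"
    and inv: "\<And>U p. U \<in> unitary_group \<Longrightarrow> hpoly k p \<Longrightarrow> S (\<lambda>Z. p (U ** Z)) = (\<lambda>Z. S p (U ** Z))"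
    and p: "hpoly k p"
  shows "S (\<lambda>Z. p (A ** Z)) = (\<lambda>Z. S p (A ** Z))"
proof
  fix Z
  have "hpoly k (\<lambda>A. S (\<lambda>Z. p (A ** Z)) Z - S p (A ** Z))"
    using hkernel_apply(1)[OF hkernel_mult[OF p] S]
      hkernel_sections(2)[OF hkernel_mult[OF linear_on_hpolyD(1)[OF S p]]]
    by (rule hpoly_diff)
  then have "S (\<lambda>Z. p (A ** Z)) Z - S p (A ** Z) = 0"
    by (rule hpoly_zero_if_zero_on_unitary_group) (simp add: inv p)
  then show "S (\<lambda>Z. p (A ** Z)) Z = S p (A ** Z)" by simp
qed

lemma commutes_with_right_multiplication:
  assumes T: "linear_on_hpoly k T"
    and inv: "\<And>U p. U \<in> unitary_group \<Longrightarrow> hpoly k p \<Longrightarrow> T (\<lambda>Z. p (Z ** U)) = (\<lambda>Z. T p (Z ** U))"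
    and p: "hpoly k p"
  shows "T (\<lambda>Z. p (Z ** B)) = (\<lambda>Z. T p (Z ** B))"
proof
  fix Z
  have "hpoly k (\<lambda>B. T (\<lambda>Z. p (Z ** B)) Z - T p (Z ** B))"
    using hkernel_apply(2)[OF hkernel_mult[OF p] T]
      hkernel_sections(1)[OF hkernel_mult[OF linear_on_hpolyD(1)[OF T p]]]
    by (rule hpoly_diff)
  then have "T (\<lambda>Z. p (Z ** B)) Z - T p (Z ** B) = 0"
    by (rule hpoly_zero_if_zero_on_unitary_group) (simp add: inv p)
  then show "T (\<lambda>Z. p (Z ** B)) Z = T p (Z ** B)" by simp
qed

text \<open>Both sides at \<open>A\<close> are obtained from the kernel \<open>p (W ** (A ** Z))\<close> by applying one operator
in each variable and evaluating at the identity.\<close>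

lemma left_right_commute_on_hpoly:
  assumes S: "linear_on_hpoly k S" and T: "linear_on_hpoly k T"
    and S_inv: "\<And>U p. U \<in> unitary_group \<Longrightarrow> hpoly k p \<Longrightarrow> S (\<lambda>Z. p (U ** Z)) = (\<lambda>Z. S p (U ** Z))"
    and T_inv: "\<And>U p. U \<in> unitary_group \<Longrightarrow> hpoly k p \<Longrightarrow> T (\<lambda>Z. p (Z ** U)) = (\<lambda>Z. T p (Z ** U))"
    and p: "hpoly k p"
  shows "S (T p) = T (S p)"
proof
  fix A
  have left: "S (\<lambda>Z. q (A ** Z)) = (\<lambda>Z. S q (A ** Z))" if "hpoly k q" for q A
    using S S_inv that by (rule commutes_with_left_multiplication)
  have right: "T (\<lambda>Z. q (Z ** B)) = (\<lambda>Z. T q (Z ** B))" if "hpoly k q" for q B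
    using T T_inv that by (rule commutes_with_right_multiplication)
  have S_eval: "S q A = S (\<lambda>Z. q (A ** Z)) (mat 1)" if "hpoly k q" for q A
    using left[OF that, of A] by simp
  have T_eval: "T q B = T (\<lambda>W. q (W ** B)) (mat 1)" if "hpoly k q" for q B
    using right[OF that, of B] by simp
  have K: "hkernel k (\<lambda>W Z. p (W ** (A ** Z)))"
    using hkernel_translate[OF hkernel_mult[OF p], of A] by (simp add: matrix_mul_assoc)
  have "S (T p) A = S (\<lambda>Z. T p (A ** Z)) (mat 1)"
    by (rule S_eval) (rule linear_on_hpolyD(1)[OF T p])
  also have "\<dots> = S (\<lambda>Z. T (\<lambda>W. p (W ** (A ** Z))) (mat 1)) (mat 1)"
    by (subst T_eval[OF p]) (rule refl)
  also have "\<dots> = T (\<lambda>W. S (\<lambda>Z. p (W ** (A ** Z))) (mat 1)) (mat 1)"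
    by (rule hkernel_swap[OF K S T])
  also have "(\<lambda>W. S (\<lambda>Z. p (W ** (A ** Z))) (mat 1)) = (\<lambda>W. S p (W ** A))"
    by (subst S_eval[OF p]) (simp add: matrix_mul_assoc)
  also have "T \<dots> (mat 1) = T (S p) A"
    by (rule T_eval[symmetric]) (rule linear_on_hpolyD(1)[OF S p])
  finally show "S (T p) A = T (S p) A" .
qed

section \<open>The domain\<close>

definition cdot :: "complex^'n::finite \<Rightarrow> complex^'n \<Rightarrow> complex"
  where "cdot u v = (\<Sum>i\<in>UNIV. cnj (u $ i) * v $ i)"

lemma cdot_self: "cdot v v = of_real ((norm v)\<^sup>2)"
  by (simp add: cdot_def norm_vec_def L2_set_def sum_nonneg mult.commute complex_norm_square
        del: of_real_power)

lemma cdot_diff_right: "cdot u (v - w) = cdot u v - cdot u w"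
  by (simp add: cdot_def algebra_simps sum_subtractf)

lemma cdot_commute: "cdot v u = cnj (cdot u v)"
  by (simp add: cdot_def mult.commute)

lemma cdot_adjoint: "cdot u (A *v v) = cdot (conj_transpose A *v u) v"
proof -
  have "cdot u (A *v v) = (\<Sum>i\<in>UNIV. \<Sum>j\<in>UNIV. cnj (u $ i) * (A $ i $ j * v $ j))"
    by (simp add: cdot_def matrix_vector_mult_def sum_distrib_left)
  also have "\<dots> = (\<Sum>j\<in>UNIV. \<Sum>i\<in>UNIV. cnj (u $ i) * (A $ i $ j * v $ j))"
    by (rule sum.swap)
  also have "\<dots> = cdot (conj_transpose A *v u) v"
    by (simp add: cdot_def matrix_vector_mult_def conj_transpose_def sum_distrib_left sum_distrib_right mult_ac)
  finally show ?thesis .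
qed

lemma norm_sum_mult_le:
  fixes u v :: "complex^'n::finite"
  shows "cmod (\<Sum>i\<in>UNIV. u $ i * v $ i) \<le> norm u * norm v"
proof -
  have "cmod (\<Sum>i\<in>UNIV. u $ i * v $ i) \<le> (\<Sum>i\<in>UNIV. \<bar>cmod (u $ i)\<bar> * \<bar>cmod (v $ i)\<bar>)"
    by (rule order_trans[OF norm_sum]) (simp add: norm_mult)
  also have "\<dots> \<le> norm u * norm v" unfolding norm_vec_def by (rule L2_set_mult_ineq)
  finally show ?thesis .
qed

lemma norm_cdot_le: "cmod (cdot u v) \<le> norm u * norm v"
proof -
  have "norm (\<chi> i. cnj (u $ i)) = norm u" by (simp add: norm_vec_def)
  with norm_sum_mult_le[of "\<chi> i. cnj (u $ i)" v] show ?thesis by (simp add: cdot_def)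
qed

lemma norm_axis: "norm (axis i x :: complex^'n::finite) = cmod x"
proof -
  have "(\<Sum>j\<in>UNIV. (cmod ((axis i x :: complex^'n) $ j))\<^sup>2) = (\<Sum>j\<in>UNIV. if j = i then (cmod x)\<^sup>2 else 0)"
    by (rule sum.cong) (auto simp: axis_def)
  then show ?thesis by (simp add: norm_vec_def L2_set_def)
qed

lemma norm_matrix_vector_le: "norm (A *v x) \<le> norm A * norm x"
  for A :: "complex^'n::finite^'m::finite"
proof -
  have "norm (A *v x) \<le> L2_set (\<lambda>i. norm (A $ i) * norm x) UNIV"
    unfolding norm_vec_def[of "A *v x"]
    by (rule L2_set_mono) (simp_all add: matrix_vector_mult_def norm_sum_mult_le)
  also have "\<dots> = norm A * norm x"
    by (simp add: norm_vec_def[of A] L2_set_left_distrib)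
  finally show ?thesis .
qed

text \<open>The domain is the open unit ball of the operator norm.\<close>

lemma cartan_domain_iff: "Z \<in> cartan_domain \<longleftrightarrow> (\<forall>v. v \<noteq> 0 \<longrightarrow> norm (Z *v v) < norm v)"
proof -
  have herm: "conj_transpose (mat 1 - conj_transpose Z ** Z) = mat 1 - conj_transpose Z ** Z"
    by (simp add: vec_eq_iff conj_transpose_def mat_def matrix_matrix_mult_def mult.commute)
  have "(\<Sum>i\<in>UNIV. cnj (v $ i) * ((mat 1 - conj_transpose Z ** Z) *v v) $ i)
      = of_real ((norm v)\<^sup>2 - (norm (Z *v v))\<^sup>2)" for v
  proof -
    have "(\<Sum>i\<in>UNIV. cnj (v $ i) * ((mat 1 - conj_transpose Z ** Z) *v v) $ i)
      = cdot v (v - conj_transpose Z *v (Z *v v))"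
      by (simp add: cdot_def matrix_vector_mult_diff_rdistrib matrix_vector_mul_assoc)
    then show ?thesis by (simp add: cdot_diff_right cdot_adjoint cdot_self)
  qed
  then have "Re (\<Sum>i\<in>UNIV. cnj (v $ i) * ((mat 1 - conj_transpose Z ** Z) *v v) $ i) > 0
      \<longleftrightarrow> norm (Z *v v) < norm v" for v
    by (simp only: Re_complex_of_real) (simp flip: linorder_not_le)
  then show ?thesis
    unfolding cartan_domain_def pos_def_def by (simp only: herm mem_Collect_eq simp_thms)
qed

text \<open>Compactness of the unit sphere turns the pointwise inequality into a uniform one; openness
and dilation by factors larger than one follow from it.\<close>

lemma cartan_domain_gap:
  fixes Z :: "'n::finite cmatrix"
  assumes "Z \<in> cartan_domain"
  obtains q where "0 < q" "q < 1" "\<And>v. norm (Z *v v) \<le> q * norm v"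
proof -
  have "compact (sphere (0::complex^'n) 1)" by simp
  moreover have "axis undefined 1 \<in> sphere (0::complex^'n) 1" by simp
  then have "sphere (0::complex^'n) 1 \<noteq> {}" by blast
  moreover have "continuous_on (sphere (0::complex^'n) 1) (\<lambda>v. norm (Z *v v))"
    unfolding matrix_vector_mult_def
    by (intro continuous_on_norm continuous_on_vec_lambda continuous_intros)
  ultimately obtain v0 where v0: "norm v0 = 1" "\<And>v. norm v = 1 \<Longrightarrow> norm (Z *v v) \<le> norm (Z *v v0)"
    by (metis (no_types, lifting) continuous_attains_sup dist_0_norm mem_sphere)
  define q where "q = max (1/2) (norm (Z *v v0))"
  have "v0 \<noteq> 0" using v0 by auto
  then have "q < 1" using assms v0 by (auto simp: cartan_domain_iff q_def)
  moreover have "norm (Z *v v) \<le> q * norm v" for v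
  proof (cases "v = 0")
    case False
    have "Z *v ((1 / norm v) *\<^sub>R v) = (1 / norm v) *\<^sub>R (Z *v v)"
      by (simp add: vec_eq_iff matrix_vector_mult_def scaleR_sum_right)
    with v0(2)[of "(1 / norm v) *\<^sub>R v"] False have "norm (Z *v v) / norm v \<le> norm (Z *v v0)"
      by simp
    also have "\<dots> \<le> q" by (simp add: q_def)
    finally show ?thesis using False by (simp add: field_simps)
  qed simp
  ultimately show ?thesis using that[of q] by (auto simp: q_def)
qed

lemma cartan_domainI: "q < 1 \<Longrightarrow> (\<And>v. norm (Z *v v) \<le> q * norm v) \<Longrightarrow> Z \<in> cartan_domain"
  by (fastforce simp: cartan_domain_iff intro: le_less_trans)

lemma open_cartan_domain: "open (cartan_domain :: 'n::finite cmatrix set)"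
  unfolding open_dist
proof
  fix Z :: "'n cmatrix" assume "Z \<in> cartan_domain"
  then obtain q where q: "0 < q" "q < 1" "\<And>v. norm (Z *v v) \<le> q * norm v"
    by (rule cartan_domain_gap) blast
  have "Y \<in> cartan_domain" if "dist Y Z < (1 - q) / 2" for Y
  proof (rule cartan_domainI[of "(1 + q) / 2"])
    fix v
    have "norm (Y *v v) \<le> norm (Z *v v) + norm ((Y - Z) *v v)"
      using norm_triangle_ineq[of "Z *v v" "(Y - Z) *v v"]
      by (simp add: matrix_vector_mult_diff_rdistrib)
    also have "\<dots> \<le> q * norm v + (1 - q) / 2 * norm v"
      using that by (intro add_mono q(3) order_trans[OF norm_matrix_vector_le] mult_right_mono)
        (auto simp: dist_norm)
    finally show "norm (Y *v v) \<le> (1 + q) / 2 * norm v" by (simp add: field_simps)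
  qed (use q in simp)
  moreover have "0 < (1 - q) / 2" using q by simp
  ultimately show "\<exists>e>0. \<forall>Y. dist Y Z < e \<longrightarrow> Y \<in> cartan_domain" by blast
qed

lemma zero_in_cartan_domain [simp]: "0 \<in> cartan_domain"
  by (simp add: cartan_domain_iff)

lemma norm_cscale_mult_vec: "norm (cscale c Z *v v) = cmod c * norm (Z *v v)"
proof -
  have "cscale c Z *v v = c *s (Z *v v)"
    by (simp add: vec_eq_iff matrix_vector_mult_def sum_distrib_left mult_ac)
  moreover have "norm (c *s w) = cmod c * norm w" for w :: "complex^'n"
    by (simp add: norm_vec_def norm_mult L2_set_right_distrib)
  ultimately show ?thesis by simp
qed

lemma cscale_in_cartan_domain:
  assumes "Z \<in> cartan_domain" "cmod c \<le> 1"
  shows "cscale c Z \<in> cartan_domain"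
  unfolding cartan_domain_iff norm_cscale_mult_vec
proof safe
  fix v :: "complex^'a" assume "v \<noteq> 0"
  have "cmod c * norm (Z *v v) \<le> 1 * norm (Z *v v)"
    using assms(2) by (intro mult_right_mono) auto
  also have "\<dots> < norm v" using assms(1) \<open>v \<noteq> 0\<close> by (simp add: cartan_domain_iff)
  finally show "cmod c * norm (Z *v v) < norm v" .
qed

lemma cscale_in_cartan_domain_larger:
  assumes "Z \<in> cartan_domain"
  obtains r where "r > 1" "\<And>c. cmod c < r \<Longrightarrow> cscale c Z \<in> cartan_domain"
proof -
  obtain q where q: "0 < q" "q < 1" "\<And>v. norm (Z *v v) \<le> q * norm v"
    using assms by (rule cartan_domain_gap) blast
  have "cscale c Z \<in> cartan_domain" if "cmod c < 1 / q" for c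
  proof (rule cartan_domainI)
    show "cmod c * q < 1" using that q by (simp add: field_simps)
    show "norm (cscale c Z *v v) \<le> cmod c * q * norm v" for v
      using mult_left_mono[OF q(3), of "cmod c" v] by (simp add: norm_cscale_mult_vec)
  qed
  with that[of "1 / q"] q show ?thesis by simp
qed

lemma norm_unitary_mult:
  assumes "U \<in> unitary_group"
  shows "norm (U *v v) = norm v"
proof -
  have "cdot (U *v v) (U *v v) = cdot v v"
    using assms by (simp add: cdot_adjoint matrix_vector_mul_assoc unitary_group_def)
  then have "(norm (U *v v))\<^sup>2 = (norm v)\<^sup>2" by (simp only: cdot_self of_real_eq_iff)
  then show ?thesis by simp
qed

lemma conj_transpose_unitary: "A \<in> unitary_group \<Longrightarrow> conj_transpose A \<in> unitary_group"
  by (simp add: unitary_group_def)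

lemma unitary_translate_in_cartan_domain:
  assumes "Z \<in> cartan_domain" "A \<in> unitary_group" "B \<in> unitary_group"
  shows "A ** Z ** B \<in> cartan_domain"
  unfolding cartan_domain_iff
proof safe
  fix v :: "complex^'a" assume "v \<noteq> 0"
  then have "B *v v \<noteq> 0" using norm_unitary_mult[OF assms(3), of v] by auto
  then have "norm (Z *v (B *v v)) < norm (B *v v)" using assms(1) by (simp add: cartan_domain_iff)
  then show "norm (A ** Z ** B *v v) < norm v"
    by (simp add: norm_unitary_mult assms flip: matrix_vector_mul_assoc)
qed

lemma unitary_translate_in_cartan_domain_iff:
  assumes "A \<in> unitary_group" "B \<in> unitary_group"
  shows "A ** Z ** B \<in> cartan_domain \<longleftrightarrow> Z \<in> cartan_domain"
proof
  assume "A ** Z ** B \<in> cartan_domain"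
  from unitary_translate_in_cartan_domain[OF this assms[THEN conj_transpose_unitary]]
  have "(conj_transpose A ** A) ** Z ** (B ** conj_transpose B) \<in> cartan_domain"
    by (simp add: matrix_mul_assoc)
  then show "Z \<in> cartan_domain" using assms by (simp add: unitary_group_def)
qed (rule unitary_translate_in_cartan_domain[OF _ assms])

text \<open>The domain is defined through \<open>Z* Z\<close> while the weight involves \<open>Z Z*\<close>; this connects the two.\<close>

lemma conj_transpose_in_cartan_domain:
  assumes "Z \<in> cartan_domain"
  shows "conj_transpose Z \<in> cartan_domain"
proof -
  obtain q where q: "0 < q" "q < 1" "\<And>v. norm (Z *v v) \<le> q * norm v"
    using assms by (rule cartan_domain_gap) blast
  have "norm (conj_transpose Z *v v) \<le> q * norm v" for v
  proof (cases "conj_transpose Z *v v = 0")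
    case False
    let ?w = "conj_transpose Z *v v"
    have "cdot ?w ?w = cdot v (Z *v ?w)" by (simp add: cdot_adjoint)
    then have "(norm ?w)\<^sup>2 = cmod (cdot v (Z *v ?w))"
      by (metis cdot_self norm_of_real abs_power2)
    also have "\<dots> \<le> norm v * (q * norm ?w)"
      by (intro order_trans[OF norm_cdot_le] mult_left_mono q) auto
    finally show ?thesis using False by (simp add: power2_eq_square field_simps)
  qed (use q in simp)
  with q show ?thesis by (intro cartan_domainI)
qed

lemma cartan_domain_entry: "Z \<in> cartan_domain \<Longrightarrow> cmod (Z $ i $ j) < 1"
proof -
  assume "Z \<in> cartan_domain"
  then have "axis j (1::complex) \<noteq> 0 \<longrightarrow> norm (Z *v axis j 1) < norm (axis j (1::complex))"
    unfolding cartan_domain_iff by blast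
  then have "norm (Z *v axis j 1) < 1" by (simp add: axis_eq_0_iff norm_axis)
  moreover have "(Z *v axis j 1) $ i = Z $ i $ j"
    by (simp add: matrix_vector_mult_def axis_def if_distrib cong: if_cong)
  ultimately show ?thesis using Finite_Cartesian_Product.norm_nth_le[of "Z *v axis j 1" i] by simp
qed

lemma bounded_cartan_domain: "bounded (cartan_domain :: 'n::finite cmatrix set)"
proof (rule boundedI)
  fix Z :: "'n cmatrix" assume Z: "Z \<in> cartan_domain"
  have "norm Z \<le> (\<Sum>i\<in>UNIV. norm (Z $ i))" unfolding norm_vec_def[of Z] by (rule L2_set_le_sum) simp
  also have "\<dots> \<le> (\<Sum>i\<in>UNIV. \<Sum>j\<in>UNIV. cmod (Z $ i $ j))"
    unfolding norm_vec_def by (intro sum_mono L2_set_le_sum) simp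
  also have "\<dots> \<le> (\<Sum>i\<in>(UNIV::'n set). \<Sum>j\<in>(UNIV::'n set). 1)"
    by (intro sum_mono less_imp_le cartan_domain_entry Z)
  finally show "norm Z \<le> (\<Sum>i\<in>(UNIV::'n set). \<Sum>j\<in>(UNIV::'n set). 1)" .
qed

section \<open>Lebesgue measure and linear isometries\<close>

lemma nn_integral_lborel_translate:
  fixes f :: "'a::euclidean_space \<Rightarrow> ennreal"
  assumes [measurable]: "f \<in> borel_measurable borel"
  shows "(\<integral>\<^sup>+ x. f (x + c) \<partial>lborel) = (\<integral>\<^sup>+ x. f x \<partial>lborel)"
proof -
  have "(\<integral>\<^sup>+ x. f (x + c) \<partial>lborel) = (\<integral>\<^sup>+ x. f x \<partial>(distr lborel borel ((+) c)))"
    by (subst nn_integral_distr) (simp_all add: add.commute)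
  then show ?thesis by (simp add: lborel_distr_plus)
qed

text \<open>Uniqueness of translation-invariant measures, made concrete: multiply the left-hand side by the
volume of the unit ball, written as an integral of its indicator centred at \<open>T x\<close>, and exchange the two integrations.
Since \<open>T\<close> preserves norms, the ball is invariant under it.\<close>

lemma nn_integral_lborel_isometry:
  fixes T :: "'a::euclidean_space \<Rightarrow> 'a" and f :: "'a \<Rightarrow> ennreal"
  assumes T: "linear T" "\<And>x. norm (T x) = norm x"
    and f[measurable]: "f \<in> borel_measurable borel"
  shows "(\<integral>\<^sup>+ x. f (T x) \<partial>lborel) = (\<integral>\<^sup>+ x. f x \<partial>lborel)"
proof -
  have cont: "continuous_on UNIV T"
    using T(1) linear_continuous_on linear_conv_bounded_linear by blast
  then have T_m[measurable]: "T \<in> borel_measurable borel"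
    by (rule borel_measurable_continuous_onI)
  have "inj T"
    using T by (metis linear_injective_0 norm_eq_zero)
  then obtain S where S: "T (S y) = y" for y
    using linear_injective_imp_surjective[OF T(1)] by (metis surj_def)
  define b :: "'a \<Rightarrow> ennreal" where "b = indicator (ball 0 1)"
  have [measurable]: "b \<in> borel_measurable borel" unfolding b_def by (intro borel_measurable_indicator) simp
  have b_T: "b (- T x) = b x" for x by (simp add: b_def indicator_def T(2))
  have "(\<integral>\<^sup>+ x. b x \<partial>lborel) * (\<integral>\<^sup>+ x. f (T x) \<partial>lborel)
      = (\<integral>\<^sup>+ x. f (T x) * (\<integral>\<^sup>+ y. b (y + - T x) \<partial>lborel) \<partial>lborel)"
    by (subst nn_integral_lborel_translate) (simp_all add: nn_integral_cmult mult.commute)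
  also have "\<dots> = (\<integral>\<^sup>+ x. \<integral>\<^sup>+ y. f (T x) * b (y + - T x) \<partial>lborel \<partial>lborel)"
    by (subst nn_integral_cmult) simp_all
  also have "\<dots> = (\<integral>\<^sup>+ y. \<integral>\<^sup>+ x. f (T x) * b (y + - T x) \<partial>lborel \<partial>lborel)"
    by (rule lborel_pair.Fubini') measurable
  also have "\<dots> = (\<integral>\<^sup>+ y. \<integral>\<^sup>+ x. f (T (x + S y)) * b (y + - T (x + S y)) \<partial>lborel \<partial>lborel)"
    by (intro nn_integral_cong nn_integral_lborel_translate[symmetric]) measurable
  also have "\<dots> = (\<integral>\<^sup>+ y. \<integral>\<^sup>+ x. f (T x + y) * b x \<partial>lborel \<partial>lborel)"
    by (simp add: linear_add[OF T(1)] S b_T)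
  also have "\<dots> = (\<integral>\<^sup>+ x. \<integral>\<^sup>+ y. f (T x + y) * b x \<partial>lborel \<partial>lborel)"
    by (rule lborel_pair.Fubini') measurable
  also have "\<dots> = (\<integral>\<^sup>+ x. b x * (\<integral>\<^sup>+ y. f (y + T x) \<partial>lborel) \<partial>lborel)"
    by (subst nn_integral_cmult[symmetric]) (simp_all add: mult.commute add.commute)
  also have "\<dots> = (\<integral>\<^sup>+ x. b x \<partial>lborel) * (\<integral>\<^sup>+ x. f x \<partial>lborel)"
    by (subst nn_integral_lborel_translate) (simp_all add: nn_integral_multc)
  finally have "(\<integral>\<^sup>+ x. b x \<partial>lborel) * (\<integral>\<^sup>+ x. f (T x) \<partial>lborel)
      = (\<integral>\<^sup>+ x. b x \<partial>lborel) * (\<integral>\<^sup>+ x. f x \<partial>lborel)" .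
  moreover have "(\<integral>\<^sup>+ x. b x \<partial>lborel) = emeasure lborel (ball (0::'a) 1)" by (simp add: b_def)
  moreover have "emeasure lborel (ball (0::'a) 1) \<noteq> 0"
    using content_ball_gt_0_iff[of "0::'a" 1] by (auto simp: measure_def)
  moreover have "emeasure lborel (ball (0::'a) 1) \<noteq> \<infinity>"
    using emeasure_lborel_ball_finite[of "0::'a" 1] by simp
  ultimately show ?thesis by (simp add: ennreal_mult_cancel_left)
qed

section \<open>The determinant of the defect matrix\<close>

lemma det_row_replaced_mat1:
  fixes v :: "'a::field^'n::finite"
  shows "det (\<chi> i. if i = k then v else axis i 1) = v $ k"
proof -
  have "det (\<chi> i. if i = k then v else axis i 1) = det (transpose (\<chi> i. if i = k then v else axis i 1))"
    by (rule det_transpose[symmetric])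
  also have "transpose (\<chi> i. if i = k then v else axis i 1) =
      (\<chi> i j. if j = k then (mat 1 *v v) $ i else (mat 1 :: 'a^'n^'n) $ i $ j)"
    by (simp only: matrix_vector_mul_lid) (simp add: transpose_def vec_eq_iff mat_def axis_def)
  also have "det \<dots> = v $ k" by (subst cramer_lemma) simp
  finally show ?thesis .
qed

text \<open>Subtracting multiples of row \<open>k\<close> from other rows does not change a determinant.\<close>

lemma det_row_operations_mat1:
  fixes u v :: "'a::field^'n::finite"
  assumes "finite K" "k \<notin> K"
  shows "det (\<chi> i. if i = k then v else if i \<in> K then axis i 1 - u $ i *s v else axis i 1) = v $ k"
  using assms
proof (induction K rule: finite_induct)
  case empty
  show ?case by (simp only: empty_iff if_False det_row_replaced_mat1)
next
  case (insert l K)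
  let ?A = "\<chi> i. if i = k then v else if i \<in> K then axis i 1 - u $ i *s v else axis i 1"
  have eq: "(\<chi> i. if i = k then v else if i \<in> insert l K then axis i 1 - u $ i *s v else axis i 1)
      = (\<chi> i. if i = l then row l ?A + (- u $ l) *s row k ?A else row i ?A)"
    (is "?L = ?R")
  proof -
    have "l \<noteq> k" "k \<noteq> l" using insert.prems by auto
    then have "?L $ i $ j = ?R $ i $ j" for i j
      using insert.hyps(2) by (cases "i = l") (simp_all add: row_def)
    then show ?thesis unfolding vec_eq_iff by blast
  qed
  have "det ?R = det ?A" using insert.prems by (intro det_row_operation) auto
  moreover have "det ?A = v $ k" using insert.prems by (intro insert.IH) simp
  ultimately show ?case by (simp only: eq)
qed

text \<open>The rows \<open>axis i 1 - u $ i *s v\<close> are put in one after the other. By linearity in row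
\<open>k\<close>, each step contributes \<open>- u $ k\<close> times a determinant in which row \<open>k\<close> is \<open>v\<close>.\<close>

lemma det_rank_one_update:
  fixes u v :: "'a::field^'n::finite"
  shows "det (mat 1 - (\<chi> i j. u $ i * v $ j)) = 1 - (\<Sum>i\<in>UNIV. u $ i * v $ i)"
proof -
  have *: "det (\<chi> i. if i \<in> K then axis i 1 - u $ i *s v else axis i 1) = 1 - (\<Sum>i\<in>K. u $ i * v $ i)"
    if "finite K" for K
    using that
  proof (induction K rule: finite_induct)
    case empty
    have "(\<chi> i. axis i 1) = (mat 1 :: 'a^'n^'n)" by (simp add: vec_eq_iff mat_def axis_def)
    then show ?case by simp
  next
    case (insert k K)
    let ?r = "\<lambda>i. if i \<in> K then axis i 1 - u $ i *s v else axis i 1"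
    have eq: "(\<chi> i. if i \<in> insert k K then axis i 1 - u $ i *s v else axis i 1)
        = (\<chi> i. if i = k then axis k 1 + (- u $ k) *s v else ?r i)"
      by (simp add: vec_eq_iff)
    have "(\<chi> i. if i = k then axis k 1 else ?r i) = (\<chi> i. ?r i)"
      using insert.hyps by (simp add: vec_eq_iff)
    then have "det (\<chi> i. if i = k then axis k 1 + (- u $ k) *s v else ?r i)
        = det (\<chi> i. ?r i) + (- u $ k) * det (\<chi> i. if i = k then v else ?r i)"
      by (simp only: det_row_add det_row_mul)
    then show ?case
      unfolding eq using insert det_row_operations_mat1[of K k v u] by (simp add: algebra_simps)
  qed
  have "mat 1 - (\<chi> i j. u $ i * v $ j) = (\<chi> i. if i \<in> UNIV then axis i 1 - u $ i *s v else axis i 1)"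
    by (simp add: vec_eq_iff mat_def axis_def)
  then show ?thesis using *[of UNIV] by simp
qed

text \<open>By linearity in row \<open>i\<close>, the difference of the determinants is a determinant whose column \<open>i\<close> vanishes.\<close>

lemma det_unit_column:
  fixes A B :: "'a::{field,ring_char_0}^'n::finite^'n"
  assumes col: "\<And>k. A $ k $ i = (if k = i then 1 else 0)" "B $ i $ i = 1"
    and rows: "\<And>k. k \<noteq> i \<Longrightarrow> A $ k = B $ k"
  shows "det A = det B"
proof -
  let ?d = "A $ i - B $ i"
  let ?R = "\<chi> k. if k = i then ?d else B $ k"
  have "?R $ k $ i = 0" for k
  proof (cases "k = i")
    case True
    then show ?thesis using col(1)[of i] col(2) by simp
  next
    case False
    then show ?thesis using col(1)[of k] rows[of k] by simp
  qed
  then have "column i ?R = 0" by (simp add: column_def vec_eq_iff)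
  then have "det ?R = 0" by (rule det_zero_column(2))
  have "A $ k = (if k = i then ?d + B $ i else B $ k)" for k
    using rows[of k] by (cases "k = i") simp_all
  then have "A = (\<chi> k. if k = i then ?d + B $ i else B $ k)" unfolding vec_eq_iff[of A] by simp
  then have "det A = det ?R + det (\<chi> k. if k = i then B $ i else B $ k)"
    by (metis det_row_add[of i "\<lambda>_. ?d" "\<lambda>_. B $ i" "\<lambda>k. B $ k"])
  also have "(\<chi> k. if k = i then B $ i else B $ k) = B" by (simp add: vec_eq_iff)
  finally show ?thesis using \<open>det ?R = 0\<close> by simp
qed

definition hdet :: "'n::finite cmatrix \<Rightarrow> complex"
  where "hdet Z = det (mat 1 - Z ** conj_transpose Z)"

lemma det_conj_transpose: "det (conj_transpose A) = cnj (det A)"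
proof -
  have "det (conj_transpose A) = det (\<chi> i j. cnj (A $ i $ j))"
    by (subst det_transpose[symmetric]) (simp add: transpose_def conj_transpose_def)
  also have "\<dots> = cnj (det A)" by (simp add: det_def)
  finally show ?thesis .
qed

lemma hermitian_defect: "conj_transpose (mat 1 - Z ** conj_transpose Z) = mat 1 - Z ** conj_transpose Z"
  by (simp add: vec_eq_iff conj_transpose_def mat_def matrix_matrix_mult_def mult.commute)

lemma hdet_real: "hdet Z = of_real (Re (hdet Z))"
proof -
  have "cnj (hdet Z) = hdet Z" unfolding hdet_def by (simp only: hermitian_defect flip: det_conj_transpose)
  then show ?thesis by (simp add: complex_eq_iff)
qed

lemma continuous_on_hdet: "continuous_on UNIV (hdet :: 'n::finite cmatrix \<Rightarrow> complex)"
  unfolding hdet_def det_def matrix_matrix_mult_def conj_transpose_def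
    vector_minus_component vec_lambda_beta
  by (intro continuous_on_sum continuous_on_mult continuous_on_prod continuous_on_diff
      continuous_on_const continuous_on_cnj continuous_on_component continuous_on_id)

lemma cdot_defect: "cdot p ((mat 1 - Z ** conj_transpose Z) *v p)
    = of_real ((norm p)\<^sup>2 - (norm (conj_transpose Z *v p))\<^sup>2)"
proof -
  have "(mat 1 - Z ** conj_transpose Z) *v p = p - Z *v (conj_transpose Z *v p)"
    by (simp add: matrix_vector_mult_diff_rdistrib matrix_vector_mul_assoc)
  then show ?thesis by (simp add: cdot_diff_right cdot_adjoint cdot_self)
qed

lemma hdet_nonzero:
  assumes "Z \<in> cartan_domain" shows "hdet Z \<noteq> 0"
proof -
  let ?Q = "mat 1 - Z ** conj_transpose Z"
  have "p = 0" if "?Q *v p = 0" for p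
  proof (rule ccontr)
    assume "p \<noteq> 0"
    then have "norm (conj_transpose Z *v p) < norm p"
      using conj_transpose_in_cartan_domain[OF assms] by (simp add: cartan_domain_iff)
    then have "(norm (conj_transpose Z *v p))\<^sup>2 < (norm p)\<^sup>2" by (simp add: power_strict_mono)
    moreover have "cdot p (?Q *v p) = 0" unfolding that by (simp add: cdot_def)
    ultimately show False by (simp only: cdot_defect of_real_eq_0_iff)
  qed
  then have "\<exists>B. B ** ?Q = mat 1" by (subst matrix_left_invertible_ker) blast
  then show ?thesis unfolding hdet_def
    by (simp add: invertible_left_inverse flip: invertible_det_nz)
qed

lemma hdet_zero [simp]: "hdet 0 = 1"
  by (simp add: hdet_def conj_transpose_def)

text \<open>The determinant is real, equal to one at \<open>0\<close>, and does not vanish on the segment from \<open>0\<close> to \<open>Z\<close>.\<close>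

lemma hdet_pos:
  assumes Z: "Z \<in> cartan_domain" shows "0 < Re (hdet Z)"
proof (rule ccontr)
  assume *: "\<not> 0 < Re (hdet Z)"
  let ?f = "\<lambda>r::real. Re (hdet (cscale (of_real r) Z))"
  have "continuous_on {0..1} (\<lambda>r. cscale (of_real r) Z)"
    unfolding cscale_def by (intro continuous_on_vec_lambda continuous_on_mult continuous_on_of_real
        continuous_on_id continuous_on_const)
  then have "continuous_on {0..1} ?f"
    by (intro continuous_on_Re continuous_on_compose2[OF continuous_on_hdet]) auto
  moreover have "?f 0 = 1" by (simp add: cscale_def flip: zero_vec_def)
  ultimately have "\<exists>r\<ge>0. r \<le> 1 \<and> ?f r = 0"
    using * by (intro IVT2') auto
  then obtain r where r: "0 \<le> r" "r \<le> 1" "?f r = 0" by blast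
  then have "cscale (of_real r) Z \<in> cartan_domain" by (intro cscale_in_cartan_domain Z) simp
  from hdet_nonzero[OF this] r(3) hdet_real show False by (metis of_real_0)
qed

definition set_entry :: "'n::finite \<Rightarrow> complex \<Rightarrow> 'n cmatrix \<Rightarrow> 'n cmatrix"
  where "set_entry i t M = (\<chi> a b. if a = i \<and> b = i then t else M $ a $ b)"

definition drop_index :: "'n::finite \<Rightarrow> 'n cmatrix \<Rightarrow> 'n cmatrix"
  where "drop_index i M = (\<chi> a b. if a = i \<or> b = i then 0 else M $ a $ b)"

definition drop_column :: "'n::finite \<Rightarrow> 'n cmatrix \<Rightarrow> 'n cmatrix"
  where "drop_column i M = (\<chi> a b. if b = i then 0 else M $ a $ b)"

lemma norm_le_componentwise:
  fixes u v :: "complex^'n::finite"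
  shows "(\<And>i. cmod (u $ i) \<le> cmod (v $ i)) \<Longrightarrow> norm u \<le> norm v"
  by (simp add: norm_vec_def L2_set_mono)

text \<open>Replacing rows and columns by zero does not increase the operator norm.\<close>

lemma submatrix_in_cartan_domain:
  fixes Z W :: "'n::finite cmatrix"
  assumes Z: "Z \<in> cartan_domain" and W: "\<And>a b. W $ a $ b = (if P a \<and> R b then Z $ a $ b else 0)"
  shows "W \<in> cartan_domain"
proof -
  obtain q where q: "0 < q" "q < 1" "\<And>v. norm (Z *v v) \<le> q * norm v"
    using Z by (rule cartan_domain_gap) blast
  show ?thesis
  proof (rule cartan_domainI[OF q(2)])
    fix v :: "complex^'n"
    let ?v = "\<chi> b. if R b then v $ b else 0"
    have "norm (W *v v) \<le> norm (Z *v ?v)"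
    proof (rule norm_le_componentwise)
      fix i
      have "(W *v v) $ i = (if P i then (Z *v ?v) $ i else 0)"
        unfolding matrix_vector_mult_def vec_lambda_beta W
        by (cases "P i") (auto intro!: sum.cong)
      then show "cmod ((W *v v) $ i) \<le> cmod ((Z *v ?v) $ i)" by simp
    qed
    also have "\<dots> \<le> q * norm ?v" by (rule q)
    also have "\<dots> \<le> q * norm v"
      using q by (intro mult_left_mono norm_le_componentwise) auto
    finally show "norm (W *v v) \<le> q * norm v" .
  qed
qed

lemma cdot_axis: "cdot (axis i 1) p = p $ i"
proof -
  have "(\<Sum>j\<in>UNIV. cnj (axis i 1 $ j) * p $ j) = (\<Sum>j\<in>UNIV. if j = i then p $ j else 0)"
    by (rule sum.cong) (auto simp: axis_def)
  then show ?thesis by (simp add: cdot_def)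
qed

text \<open>With \<open>N\<close> the matrix without column \<open>i\<close>, with \<open>Q = 1 - N N*\<close> and \<open>P\<close> its inverse, and with
\<open>w = x + t *s e\<close> the column as a function of its diagonal entry \<open>t\<close>, the rank-one formula gives
\<open>det Q * (1 - cdot w (P w))\<close>, a real quadratic polynomial in \<open>t\<close> whose leading coefficient is found by Cramer's
rule. The bound \<open>\<rho> \<le> 1\<close> says that the maximum over \<open>t\<close> does not exceed the determinant for the smaller
matrix; it is what keeps the integral over \<open>t\<close> uniformly bounded.\<close>

lemma hdet_along_diagonal_entry:
  fixes M :: "'n::finite cmatrix"
  assumes "drop_column i M \<in> cartan_domain"
  obtains t0 \<rho> where "\<rho> \<le> 1"
    and "\<And>t. Re (hdet (set_entry i t M)) = Re (hdet (drop_index i M)) * (\<rho> - (cmod (t - t0))\<^sup>2)"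
proof -
  define N where "N = drop_column i M"
  define Q where "Q = mat 1 - N ** conj_transpose N"
  define e :: "complex^'n" where "e = axis i 1"
  define x where "x = (\<chi> a. if a = i then 0 else M $ a $ i)"
  have N: "N \<in> cartan_domain" using assms by (simp add: N_def)
  then have Nt: "conj_transpose N \<in> cartan_domain" by (rule conj_transpose_in_cartan_domain)
  have "det Q \<noteq> 0" using hdet_nonzero[OF N] by (simp add: Q_def hdet_def)
  then obtain P where P: "P ** Q = mat 1" "Q ** P = mat 1"
    unfolding invertible_det_nz[symmetric] invertible_def by blast
  have Q_herm: "conj_transpose Q = Q" unfolding Q_def by (rule hermitian_defect)
  have P_herm: "conj_transpose P = P"
    by (metis P Q_herm conj_transpose_mat1 conj_transpose_mult matrix_mul_assoc matrix_mul_lid matrix_mul_rid)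
  define d where "d = Re (det Q)"
  have d: "det Q = of_real d" "d > 0"
    using hdet_real[of N] hdet_pos[OF N] by (simp_all add: d_def Q_def hdet_def)
  define p where "p = P *v e"
  have Qp: "Q *v p = e" by (simp add: p_def matrix_vector_mul_assoc P)
  define c where "c = Re (hdet (drop_index i M))"
  \<comment> \<open>Cramer's rule: replacing column \<open>i\<close> of \<open>Q\<close> by \<open>Q *v p = e\<close> gives a matrix that
    differs from the defect matrix of \<open>drop_index i M\<close> in row \<open>i\<close> only.\<close>
  have c: "of_real c = p $ i * det Q"
  proof -
    have "p $ i * det Q = det (\<chi> a b. if b = i then (Q *v p) $ a else Q $ a $ b)"
      by (simp only: cramer_lemma)
    also have "\<dots> = det (mat 1 - drop_index i M ** conj_transpose (drop_index i M))"
    proof (rule det_unit_column[where i = i])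
      fix k assume k: "k \<noteq> i"
      have "(\<Sum>m\<in>UNIV. N $ k $ m * cnj (N $ b $ m))
          = (\<Sum>m\<in>UNIV. drop_index i M $ k $ m * cnj (drop_index i M $ b $ m))" if "b \<noteq> i" for b
        using k that by (intro sum.cong) (simp_all add: N_def drop_column_def drop_index_def)
      then show "(\<chi> a b. if b = i then (Q *v p) $ a else Q $ a $ b) $ k
          = (mat 1 - drop_index i M ** conj_transpose (drop_index i M)) $ k"
        unfolding Qp
        using k by (simp add: vec_eq_iff e_def axis_def Q_def matrix_matrix_mult_def conj_transpose_def)
           (simp add: mat_def drop_index_def)
    qed (simp_all add: Qp e_def axis_def matrix_matrix_mult_def conj_transpose_def mat_def drop_index_def)
    also have "\<dots> = of_real c" using hdet_real[of "drop_index i M"] by (simp add: c_def hdet_def)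
    finally show ?thesis by simp
  qed
  define g where "g = c / d"
  have pi: "p $ i = of_real g" using c d by (simp add: g_def field_simps)
  \<comment> \<open>\<open>Q = 1 - N N*\<close> lies between \<open>0\<close> and \<open>1\<close>, so its inverse is at least \<open>1\<close>; here this is used
    for one diagonal entry only, by comparing \<open>cdot p (Q p)\<close> with \<open>cdot (Q p) (Q p) = 1\<close>.\<close>
  have "g \<ge> 1"
  proof -
    have "of_real g = cdot e p" by (simp add: e_def cdot_axis pi)
    also have "\<dots> = cnj (cdot p (Q *v p))" by (simp add: Qp flip: cdot_commute)
    finally have g: "g = (norm p)\<^sup>2 - (norm (conj_transpose N *v p))\<^sup>2"
      unfolding Q_def cdot_defect by (metis complex_cnj_complex_of_real of_real_eq_iff)
    let ?w = "conj_transpose N *v p"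
    have "e = p - N *v ?w"
      using Qp by (simp add: Q_def matrix_vector_mult_diff_rdistrib matrix_vector_mul_assoc)
    then have "cdot e e = cdot (p - N *v ?w) (p - N *v ?w)"
      by (intro arg_cong2[of _ _ _ _ cdot])
    moreover have "cdot e e = of_real 1" by (simp add: cdot_self e_def norm_axis)
    ultimately have "of_real 1 = cdot (p - N *v ?w) (p - N *v ?w)" by (simp only:)
    also have "\<dots> = cdot p p - cdot p (N *v ?w) - cdot (N *v ?w) p + cdot (N *v ?w) (N *v ?w)"
      by (simp add: cdot_def algebra_simps sum_subtractf sum.distrib)
    also have "cdot p (N *v ?w) = cdot ?w ?w" by (simp add: cdot_adjoint)
    also have "cdot (N *v ?w) p = cnj (cdot p (N *v ?w))" by (rule cdot_commute)
    also have "cdot p (N *v ?w) = cdot ?w ?w" by (simp add: cdot_adjoint)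
    finally have "1 = (norm p)\<^sup>2 - 2 * (norm ?w)\<^sup>2 + (norm (N *v ?w))\<^sup>2"
      unfolding cdot_self complex_cnj_complex_of_real of_real_eq_iff
        of_real_add[symmetric] of_real_diff[symmetric] by simp
    moreover have "norm (N *v ?w) \<le> norm ?w"
      using N by (cases "?w = 0") (auto simp: cartan_domain_iff less_imp_le)
    then have "(norm (N *v ?w))\<^sup>2 \<le> (norm ?w)\<^sup>2" by (simp add: power_mono)
    ultimately show ?thesis unfolding g by linarith
  qed
  define \<beta> where "\<beta> = (P *v x) $ i"
  define \<alpha> where "\<alpha> = Re (cdot x (P *v x))"
  have \<alpha>: "cdot x (P *v x) = of_real \<alpha>"
    by (metis P_herm \<alpha>_def cdot_adjoint cdot_commute Reals_cnj_iff of_real_Re)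
  have det_t: "hdet (set_entry i t M) = det Q * (1 - cdot (x + t *s e) (P *v (x + t *s e)))" for t
  proof -
    let ?w = "x + t *s e"
    have "mat 1 - set_entry i t M ** conj_transpose (set_entry i t M) = Q - dyad ?w ?w"
    proof -
      have "(\<Sum>b\<in>UNIV. set_entry i t M $ a $ b * cnj (set_entry i t M $ k $ b))
          = ?w $ a * cnj (?w $ k) + (\<Sum>b\<in>UNIV. N $ a $ b * cnj (N $ k $ b))" for a k
      proof -
        have "(\<Sum>b\<in>UNIV. set_entry i t M $ a $ b * cnj (set_entry i t M $ k $ b))
          = (\<Sum>b\<in>UNIV. (if b = i then ?w $ a * cnj (?w $ k) else 0) + N $ a $ b * cnj (N $ k $ b))"
          by (rule sum.cong) (auto simp: set_entry_def N_def drop_column_def x_def e_def axis_def)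
        then show ?thesis by (simp add: sum.distrib)
      qed
      then show ?thesis
        by (simp add: Q_def vec_eq_iff matrix_matrix_mult_def conj_transpose_def dyad_def)
    qed
    also have "Q - dyad ?w ?w = Q ** (mat 1 - dyad (P *v ?w) ?w)"
    proof -
      have "Q ** dyad (P *v ?w) ?w = dyad (Q *v (P *v ?w)) ?w"
        by (simp add: vec_eq_iff matrix_matrix_mult_def matrix_vector_mult_def dyad_def
            sum_distrib_left sum_distrib_right mult_ac)
      also have "\<dots> = dyad ?w ?w" by (simp add: matrix_vector_mul_assoc P)
      finally show ?thesis
        by (simp add: vec_eq_iff matrix_matrix_mult_def algebra_simps sum_subtractf)
           (simp add: mat_def if_distrib cong: if_cong)
    qed
    also have "det \<dots> = det Q * (1 - cdot ?w (P *v ?w))"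
      using det_rank_one_update[of "P *v ?w" "\<chi> i. cnj (?w $ i)"]
      by (simp add: det_mul dyad_def cdot_def mult.commute)
    finally show ?thesis by (simp add: hdet_def)
  qed
  have "cdot e p = of_real g" "cdot e (P *v x) = \<beta>"
    by (simp_all add: e_def cdot_axis pi \<beta>_def)
  moreover from this have "cdot x p = cnj \<beta>"
    unfolding p_def by (metis P_herm cdot_adjoint cdot_commute)
  ultimately have entries: "cdot e p = of_real g" "cdot e (P *v x) = \<beta>" "cdot x p = cnj \<beta>" .
  have quad: "cdot (x + t *s e) (P *v (x + t *s e)) = of_real (\<alpha> - (cmod \<beta>)\<^sup>2 / g + g * (cmod (t + \<beta> / of_real g))\<^sup>2)" for t
  proof -
    have "P *v (x + t *s e) = P *v x + t *s p"
      by (simp add: p_def vec_eq_iff matrix_vector_mult_def sum_distrib_left algebra_simps sum.distrib)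
    then have "cdot (x + t *s e) (P *v (x + t *s e))
        = cdot x (P *v x) + t * cdot x p + cnj t * cdot e (P *v x) + cnj t * t * cdot e p"
      by (simp add: cdot_def algebra_simps sum.distrib sum_distrib_left)
    also have "\<dots> = cdot x (P *v x) + t * cnj \<beta> + cnj t * \<beta> + cnj t * t * of_real g"
      by (simp only: entries)
    also have "cdot x (P *v x) + t * cnj \<beta> + cnj t * \<beta> + cnj t * t * of_real g
        = of_real \<alpha> - \<beta> * cnj \<beta> / of_real g + of_real g * ((t + \<beta> / of_real g) * cnj (t + \<beta> / of_real g))"
      using \<open>g \<ge> 1\<close> by (simp add: \<alpha> field_simps)
    finally show ?thesis
      by (simp only: of_real_add of_real_diff of_real_mult of_real_divide complex_norm_square)
  qed
  define \<rho> where "\<rho> = (1 - (\<alpha> - (cmod \<beta>)\<^sup>2 / g)) / g"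
  have eq: "Re (hdet (set_entry i t M)) = c * (\<rho> - (cmod (t - (- \<beta> / of_real g)))\<^sup>2)" for t
  proof -
    define m where "m = \<alpha> - (cmod \<beta>)\<^sup>2 / g"
    define q where "q = (cmod (t + \<beta> / of_real g))\<^sup>2"
    have "hdet (set_entry i t M) = of_real (d * (1 - (m + g * q)))"
      unfolding det_t quad d(1) m_def q_def by simp
    then have "Re (hdet (set_entry i t M)) = d * (1 - (m + g * q))" by (simp only: Re_complex_of_real)
    moreover have "c = d * g" using d by (simp add: g_def)
    moreover have "g * \<rho> = 1 - m"
      using \<open>g \<ge> 1\<close> unfolding \<rho>_def m_def[symmetric] by simp
    then have "1 - (m + g * q) = g * (\<rho> - q)" by (simp add: right_diff_distrib)
    ultimately have "Re (hdet (set_entry i t M)) = c * (\<rho> - q)" by simp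
    then show ?thesis by (simp add: q_def)
  qed
  \<comment> \<open>The minimum over \<open>t\<close> of a nonnegative form, attained at \<open>t = - \<beta> / g\<close>.\<close>
  have "\<alpha> - (cmod \<beta>)\<^sup>2 / g \<ge> 0"
  proof -
    let ?y = "x + (- \<beta> / of_real g) *s e"
    have "cdot ?y (P *v ?y) = cnj (cdot (P *v ?y) (Q *v (P *v ?y)))"
      by (simp add: matrix_vector_mul_assoc[of Q] P flip: cdot_commute)
    also have "\<dots> = of_real ((norm (P *v ?y))\<^sup>2 - (norm (conj_transpose N *v (P *v ?y)))\<^sup>2)"
      unfolding Q_def cdot_defect by simp
    finally have "\<alpha> - (cmod \<beta>)\<^sup>2 / g = (norm (P *v ?y))\<^sup>2 - (norm (conj_transpose N *v (P *v ?y)))\<^sup>2"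
      unfolding quad of_real_eq_iff by simp
    moreover have "norm (conj_transpose N *v (P *v ?y)) \<le> norm (P *v ?y)"
      using Nt by (cases "P *v ?y = 0") (auto simp: cartan_domain_iff less_imp_le)
    then have "(norm (conj_transpose N *v (P *v ?y)))\<^sup>2 \<le> (norm (P *v ?y))\<^sup>2" by (simp add: power_mono)
    ultimately show ?thesis by linarith
  qed
  then have "1 - (\<alpha> - (cmod \<beta>)\<^sup>2 / g) \<le> g" using \<open>g \<ge> 1\<close> by linarith
  then have "\<rho> \<le> 1" using \<open>g \<ge> 1\<close> unfolding \<rho>_def by (subst divide_le_eq_1_pos) auto
  with eq that show ?thesis by (metis c_def)
qed

section \<open>Integrability of the weight\<close>

lemma ball_in_sets_borel [measurable]: "ball (a :: 'a::metric_space) r \<in> sets borel"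
  by simp

text \<open>Under the squared modulus, area on the unit disc becomes \<open>pi\<close> times length on the unit interval,
as the area of concentric discs shows. This replaces polar coordinates.\<close>

lemma nn_integral_cmod_square:
  fixes \<phi> :: "real \<Rightarrow> ennreal"
  assumes [measurable]: "\<phi> \<in> borel_measurable borel"
  shows "(\<integral>\<^sup>+ t. \<phi> ((cmod t)\<^sup>2) * indicator (ball 0 1) t \<partial>lborel)
    = pi * (\<integral>\<^sup>+ u. \<phi> u * indicator {0..<1} u \<partial>lborel)"
proof -
  have [measurable]: "ball (0::complex) 1 \<in> sets borel" by simp
  define M where "M = distr (density lborel (indicator (ball (0::complex) 1))) borel (\<lambda>t. (cmod t)\<^sup>2)"
  define N where "N = density lborel (\<lambda>u::real. ennreal pi * indicator {0..<1} u)"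
  have ball_area: "emeasure lborel (ball (0::complex) 1) = ennreal pi"
    using emeasure_ball[of 1 "0::complex"] by (simp add: unit_ball_vol_2)
  have M_eq: "emeasure M {x<..} = emeasure lborel (ball (0::complex) 1 \<inter> {t. x < (cmod t)\<^sup>2})" for x
  proof -
    have "emeasure M {x<..} = (\<integral>\<^sup>+ t. indicator (ball 0 1) t * indicator {t. x < (cmod t)\<^sup>2} t \<partial>lborel)"
      unfolding M_def by (subst emeasure_distr) (simp_all add: emeasure_density vimage_def greaterThan_def)
    also have "\<dots> = (\<integral>\<^sup>+ t. indicator (ball 0 1 \<inter> {t. x < (cmod t)\<^sup>2}) t \<partial>lborel)"
      by (intro nn_integral_cong) (auto simp: indicator_def)
    finally show ?thesis by simp
  qed
  have N_eq: "emeasure N {x<..} = ennreal pi * emeasure lborel ({0..<1} \<inter> {x<..})" for x :: real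
  proof -
    have "emeasure N {x<..} = (\<integral>\<^sup>+ u. ennreal pi * indicator ({0..<1} \<inter> {x<..}) u \<partial>lborel)"
      unfolding N_def by (subst emeasure_density) (auto intro!: nn_integral_cong simp: indicator_def)
    then show ?thesis by (simp add: nn_integral_cmult_indicator)
  qed
  have "M = N"
  proof (rule measure_eqI_lessThan)
    show "sets M = sets borel" "sets N = sets borel" by (simp_all add: M_def N_def)
    show "emeasure M {x<..} < \<infinity>" for x
    proof -
      have "emeasure M {x<..} \<le> emeasure lborel (ball (0::complex) 1)"
        unfolding M_eq by (rule emeasure_mono) auto
      then show ?thesis by (simp add: ball_area) (metis ennreal_less_top le_less_trans)
    qed
    show "emeasure M {x<..} = emeasure N {x<..}" for x
    proof -
      consider "x < 0" | "0 \<le> x" "x < 1" | "1 \<le> x" by linarith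
      then show ?thesis
      proof cases
        case 1
        then have "x < (cmod t)\<^sup>2" for t by (simp add: less_le_trans)
        moreover have "{0..<1} \<inter> {x<..} = {0..<1::real}" using 1 by auto
        ultimately show ?thesis by (simp add: M_eq N_eq ball_area)
      next
        case 2
        have "ball (0::complex) 1 \<inter> {t. x < (cmod t)\<^sup>2} = ball 0 1 - cball 0 (sqrt x)"
        proof -
          have "cmod t \<le> sqrt x \<longleftrightarrow> (cmod t)\<^sup>2 \<le> x" for t
            using real_sqrt_le_iff[of "(cmod t)\<^sup>2" x] by simp
          then have "t \<in> ball 0 1 \<inter> {t. x < (cmod t)\<^sup>2} \<longleftrightarrow> t \<in> ball 0 1 - cball 0 (sqrt x)" for t
            unfolding Int_iff Diff_iff mem_Collect_eq mem_cball dist_0_norm by (metis not_le)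
          then show ?thesis by (rule set_eqI)
        qed
        moreover have area: "emeasure lborel (cball (0::complex) (sqrt x)) = ennreal (pi * x)"
          using emeasure_cball[of "sqrt x" "0::complex"] 2 by (simp add: unit_ball_vol_2)
        have "sqrt x < 1" using 2 by simp
        then have "cball (0::complex) (sqrt x) \<subseteq> ball 0 1"
          unfolding subset_iff mem_cball mem_ball by (meson le_less_trans)
        then have "emeasure lborel (ball 0 1 - cball 0 (sqrt x) :: complex set)
            = emeasure lborel (ball (0::complex) 1) - emeasure lborel (cball (0::complex) (sqrt x))"
          by (intro emeasure_Diff) (auto simp: area)
        moreover note area
        moreover have "{0..<1} \<inter> {x<..} = {x<..<1::real}" using 2 by auto
        ultimately show ?thesis using 2
          by (simp add: M_eq N_eq ball_area ennreal_minus algebra_simps flip: ennreal_mult)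
      next
        case 3
        have "ball (0::complex) 1 \<inter> {t. x < (cmod t)\<^sup>2} = {}"
        proof -
          have "(cmod t)\<^sup>2 < x" if "cmod t < 1" for t
            using that 3 by (smt (verit) norm_ge_zero power_le_one abs_square_less_1 abs_of_nonneg)
          then show ?thesis by fastforce
        qed
        moreover have "{0..<1} \<inter> {x<..} = ({}::real set)" using 3 by auto
        ultimately show ?thesis by (simp add: M_eq N_eq)
      qed
    qed
  qed
  have "(\<integral>\<^sup>+ t. \<phi> ((cmod t)\<^sup>2) * indicator (ball 0 1) t \<partial>lborel) = (\<integral>\<^sup>+ u. \<phi> u \<partial>M)"
    unfolding M_def by (subst nn_integral_distr) (simp_all add: nn_integral_density mult.commute)
  also have "\<dots> = (\<integral>\<^sup>+ u. pi * (\<phi> u * indicator {0..<1} u) \<partial>lborel)"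
    unfolding \<open>M = N\<close> N_def by (subst nn_integral_density) (simp_all add: mult_ac)
  also have "\<dots> = pi * (\<integral>\<^sup>+ u. \<phi> u * indicator {0..<1} u \<partial>lborel)"
    by (rule nn_integral_cmult) simp
  finally show ?thesis .
qed

text \<open>For \<open>0 \<le> \<rho>\<close> the exact value is \<open>pi / (s + 1) * \<rho> powr (s + 1) * c powr s\<close>. The factor
\<open>\<rho> powr (s + 1)\<close> is at most one because \<open>s + 1 > 0\<close>; this is where the restriction on the exponent is needed.\<close>

lemma nn_integral_disc_powr_le:
  fixes t0 :: complex
  assumes s: "s > -1" and \<rho>: "\<rho> \<le> 1" and c: "0 \<le> c"
  shows "(\<integral>\<^sup>+ t. ennreal ((c * (\<rho> - (cmod (t - t0))\<^sup>2)) powr s) * indicator {t. (cmod (t - t0))\<^sup>2 < \<rho>} t \<partial>lborel)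
    \<le> ennreal (pi / (s + 1) * c powr s)"
proof -
  define \<phi> where "\<phi> u = ennreal ((\<rho> - u) powr s) * indicator {..<\<rho>} u" for u
  have [measurable]: "\<phi> \<in> borel_measurable borel" unfolding \<phi>_def by measurable
  have small: "cmod t < 1" if "(cmod t)\<^sup>2 < \<rho>" for t
    using that \<rho> by (metis abs_norm_cancel abs_square_less_1 order_less_le_trans)
  have "(\<integral>\<^sup>+ t. ennreal ((c * (\<rho> - (cmod (t - t0))\<^sup>2)) powr s) * indicator {t. (cmod (t - t0))\<^sup>2 < \<rho>} t \<partial>lborel)
      = (\<integral>\<^sup>+ t. ennreal (c powr s) * (\<phi> ((cmod (t + (- t0)))\<^sup>2) * indicator (ball 0 1) (t + (- t0))) \<partial>lborel)"
    using c small by (intro nn_integral_cong)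
      (auto simp: \<phi>_def powr_mult indicator_def simp flip: ennreal_mult)
  also have "\<dots> = ennreal (c powr s) * (\<integral>\<^sup>+ t. \<phi> ((cmod (t + (- t0)))\<^sup>2) * indicator (ball 0 1) (t + (- t0)) \<partial>lborel)"
    by (rule nn_integral_cmult) measurable
  also have "(\<integral>\<^sup>+ t. \<phi> ((cmod (t + (- t0)))\<^sup>2) * indicator (ball 0 1) (t + (- t0)) \<partial>lborel)
      = (\<integral>\<^sup>+ t. \<phi> ((cmod t)\<^sup>2) * indicator (ball 0 1) t \<partial>lborel)"
    by (rule nn_integral_lborel_translate[of "\<lambda>t. \<phi> ((cmod t)\<^sup>2) * indicator (ball 0 1) t"]) measurable
  also have "\<dots> = pi * (\<integral>\<^sup>+ u. \<phi> u * indicator {0..<1} u \<partial>lborel)"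
    by (rule nn_integral_cmod_square) measurable
  also have "(\<integral>\<^sup>+ u. \<phi> u * indicator {0..<1} u \<partial>lborel)
      = (\<integral>\<^sup>+ u. \<phi> (\<rho> + (-1) * u) * indicator {0..<1} (\<rho> + (-1) * u) \<partial>lborel)"
    using nn_integral_real_affine[of "\<lambda>u. \<phi> u * indicator {0..<1} u" "-1" \<rho>] by simp
  also have "(\<integral>\<^sup>+ u. \<phi> (\<rho> + (-1) * u) * indicator {0..<1} (\<rho> + (-1) * u) \<partial>lborel)
      \<le> (\<integral>\<^sup>+ u. ennreal (u powr s) * indicator {0..1} u \<partial>lborel)"
    using \<rho> by simp (intro nn_integral_mono, auto simp: \<phi>_def indicator_def)
  also have "\<dots> = ennreal (1 / (s + 1))"
    using has_integral_powr_from_0[OF s, of 1] by (intro nn_integral_has_integral_lebesgue') auto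
  finally show ?thesis using s
    by (simp add: mult_left_mono flip: ennreal_mult) (simp add: mult_ac)
qed

text \<open>Minors are encoded by filling up with zeros, so that all matrices keep the same index type: the defect
matrix of \<open>mask I Z\<close> is the identity outside \<open>I\<close>, and its determinant is the one belonging to the
submatrix of \<open>Z\<close> indexed by \<open>I\<close>.\<close>

definition mask :: "'n set \<Rightarrow> 'n::finite cmatrix \<Rightarrow> 'n cmatrix"
  where "mask I Z = (\<chi> a b. if a \<in> I \<and> b \<in> I then Z $ a $ b else 0)"

lemma continuous_on_mask: "continuous_on UNIV (mask I)"
proof -
  have "continuous_on UNIV (\<lambda>Z::'a cmatrix. if a \<in> I \<and> b \<in> I then Z $ a $ b else 0)" for a b
    by (cases "a \<in> I \<and> b \<in> I") (auto intro!: continuous_intros)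
  then show ?thesis unfolding mask_def by (intro continuous_on_vec_lambda)
qed

lemma borel_measurable_hdet [measurable]: "hdet \<in> borel_measurable borel"
  by (intro borel_measurable_continuous_onI continuous_on_hdet)

lemma borel_measurable_mask [measurable]: "mask I \<in> borel_measurable borel"
  by (intro borel_measurable_continuous_onI continuous_on_mask)

lemma cartan_domain_borel [measurable]: "cartan_domain \<in> sets borel"
  by (intro borel_open open_cartan_domain)

definition masked_weight :: "'n set \<Rightarrow> real \<Rightarrow> 'n::finite cmatrix \<Rightarrow> ennreal"
  where "masked_weight I s Z = ennreal (Re (hdet (mask I Z)) powr s) * indicator cartan_domain (mask I Z)"

lemma borel_measurable_masked_weight [measurable]: "masked_weight I s \<in> borel_measurable borel"
  unfolding masked_weight_def by measurable

definition entry :: "'n::finite \<Rightarrow> complex \<Rightarrow> 'n cmatrix"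
  where "entry i t = (\<chi> a b. if a = i \<and> b = i then t else 0)"

lemma norm_entry: "norm (entry i t) \<le> cmod t"
proof -
  have "entry i t $ a = (if a = i then axis i t else 0)" for a
    by (simp add: entry_def vec_eq_iff axis_def)
  then have "(norm (entry i t $ a))\<^sup>2 = (if a = i then (cmod t)\<^sup>2 else 0)" for a
    by (simp add: norm_axis)
  then show ?thesis unfolding norm_vec_def[of "entry i t"] L2_set_def by simp
qed

lemma continuous_on_entry: "continuous_on UNIV (entry i)"
proof -
  have "continuous_on UNIV (\<lambda>t. if a = i \<and> b = i then t else 0 :: complex)" for a b
    by (cases "a = i \<and> b = i") (auto intro!: continuous_intros)
  then show ?thesis unfolding entry_def by (intro continuous_on_vec_lambda)
qed

lemma borel_measurable_entry [measurable]: "entry i \<in> borel_measurable borel"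
  by (intro borel_measurable_continuous_onI continuous_on_entry)

text \<open>If no \<open>t\<close> brings the larger submatrix into the domain, the left-hand side vanishes. Otherwise the smaller submatrix
lies in the domain, and the integrand is a power of the quadratic polynomial found above.\<close>

lemma masked_weight_slice:
  fixes Z :: "'n::finite cmatrix"
  assumes s: "s > -1" and i: "i \<notin> I"
  shows "(\<integral>\<^sup>+ t. masked_weight (insert i I) s (Z + entry i t) \<partial>lborel)
    \<le> ennreal (pi / (s + 1)) * masked_weight I s Z"
proof (cases "\<exists>t. mask (insert i I) (Z + entry i t) \<in> cartan_domain")
  case False
  then have "masked_weight (insert i I) s (Z + entry i t) = 0" for t
    by (auto simp: masked_weight_def)
  then show ?thesis by simp
next
  case True
  define M where "M = mask (insert i I) Z"
  have set: "mask (insert i I) (Z + entry i t) = set_entry i (t + Z $ i $ i) M" for t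
    by (auto simp: M_def mask_def entry_def set_entry_def vec_eq_iff)
  have drop: "drop_index i M = mask I Z"
    using i by (auto simp: M_def mask_def drop_index_def vec_eq_iff)
  obtain t1 where t1: "set_entry i t1 M \<in> cartan_domain" using True set by metis
  have col: "drop_column i M \<in> cartan_domain"
    by (rule submatrix_in_cartan_domain[OF t1, where P = "\<lambda>_. True" and R = "\<lambda>b. b \<noteq> i"])
       (auto simp: drop_column_def set_entry_def)
  have ind: "mask I Z \<in> cartan_domain"
    unfolding drop[symmetric]
    by (rule submatrix_in_cartan_domain[OF t1, where P = "\<lambda>a. a \<noteq> i" and R = "\<lambda>b. b \<noteq> i"])
       (auto simp: drop_index_def set_entry_def)
  define c where "c = Re (hdet (mask I Z))"
  have c: "c > 0" unfolding c_def by (rule hdet_pos[OF ind])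
  obtain t0 \<rho> where \<rho>: "\<rho> \<le> 1"
    and h: "\<And>t. Re (hdet (set_entry i t M)) = c * (\<rho> - (cmod (t - t0))\<^sup>2)"
    using hdet_along_diagonal_entry[OF col] unfolding drop c_def by metis
  define t2 where "t2 = t0 - Z $ i $ i"
  have "masked_weight (insert i I) s (Z + entry i t)
      \<le> ennreal ((c * (\<rho> - (cmod (t - t2))\<^sup>2)) powr s) * indicator {t. (cmod (t - t2))\<^sup>2 < \<rho>} t" for t
  proof (cases "mask (insert i I) (Z + entry i t) \<in> cartan_domain")
    case True
    have eq: "Re (hdet (mask (insert i I) (Z + entry i t))) = c * (\<rho> - (cmod (t - t2))\<^sup>2)"
      unfolding set h t2_def by (simp add: algebra_simps)
    then have "(cmod (t - t2))\<^sup>2 < \<rho>" using hdet_pos[OF True] c by (simp add: zero_less_mult_iff)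
    then show ?thesis by (simp add: masked_weight_def eq indicator_def)
  qed (simp add: masked_weight_def)
  then have "(\<integral>\<^sup>+ t. masked_weight (insert i I) s (Z + entry i t) \<partial>lborel)
      \<le> (\<integral>\<^sup>+ t. ennreal ((c * (\<rho> - (cmod (t - t2))\<^sup>2)) powr s) * indicator {t. (cmod (t - t2))\<^sup>2 < \<rho>} t \<partial>lborel)"
    by (rule nn_integral_mono)
  also have "\<dots> \<le> ennreal (pi / (s + 1) * c powr s)"
    using c by (intro nn_integral_disc_powr_le s \<rho>) simp
  also have "\<dots> = ennreal (pi / (s + 1)) * masked_weight I s Z"
    using ind s by (simp add: masked_weight_def c_def flip: ennreal_mult)
  finally show ?thesis .
qed

text \<open>Averaging the integral over translations of the diagonal entry \<open>i\<close> allows one to integrate over that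
entry first without splitting the space of matrices as a product. The translations enlarge the
region of integration, hence the arbitrary radius.\<close>

lemma masked_weight_integrable:
  fixes R :: real
  assumes s: "s > -1" and "finite I"
  shows "(\<integral>\<^sup>+ Z. masked_weight I s Z * indicator (ball 0 R) Z \<partial>lborel) < \<infinity>"
  using assms(2)
proof (induction I arbitrary: R rule: finite_induct)
  case empty
  have "mask {} Z = 0" for Z :: "'a cmatrix" by (simp add: mask_def vec_eq_iff)
  then have "masked_weight {} s (Z :: 'a cmatrix) = 1" for Z by (simp add: masked_weight_def)
  then show ?case using emeasure_lborel_ball_finite[of "0 :: 'a cmatrix" R] by simp
next
  case (insert i I)
  define f :: "'a cmatrix \<Rightarrow> ennreal" where "f Z = masked_weight (insert i I) s Z * indicator (ball 0 R) Z" for Z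
  have [measurable]: "f \<in> borel_measurable borel" unfolding f_def by measurable
  define V where "V = emeasure lborel (ball (0::complex) 1)"
  have V: "V \<noteq> 0" "V \<noteq> \<infinity>"
    using emeasure_ball[of 1 "0::complex"] by (simp_all add: V_def unit_ball_vol_2)
  have "V * (\<integral>\<^sup>+ Z. f Z \<partial>lborel) = (\<integral>\<^sup>+ t. indicator (ball (0::complex) 1) t * (\<integral>\<^sup>+ Z. f Z \<partial>lborel) \<partial>lborel)"
    by (subst nn_integral_multc) (simp_all add: V_def)
  also have "\<dots> = (\<integral>\<^sup>+ t. \<integral>\<^sup>+ Z. indicator (ball (0::complex) 1) t * f (Z + entry i t) \<partial>lborel \<partial>lborel)"
    by (simp add: nn_integral_cmult nn_integral_lborel_translate[of f])
  also have "\<dots> = (\<integral>\<^sup>+ Z. \<integral>\<^sup>+ t. indicator (ball (0::complex) 1) t * f (Z + entry i t) \<partial>lborel \<partial>lborel)"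
    by (rule lborel_pair.Fubini') measurable
  also have "\<dots> \<le> (\<integral>\<^sup>+ Z. \<integral>\<^sup>+ t. masked_weight (insert i I) s (Z + entry i t) * indicator (ball 0 (R + 1)) Z \<partial>lborel \<partial>lborel)"
  proof (intro nn_integral_mono)
    fix Z :: "'a cmatrix" and t :: complex
    have "norm Z < R + 1" if "norm (Z + entry i t) < R" "cmod t < 1"
      using norm_triangle_ineq4[of "Z + entry i t" "entry i t"] norm_entry[of i t] that by simp
    then show "indicator (ball (0::complex) 1) t * f (Z + entry i t)
        \<le> masked_weight (insert i I) s (Z + entry i t) * indicator (ball 0 (R + 1)) Z"
      by (auto simp: f_def indicator_def)
  qed
  also have "\<dots> = (\<integral>\<^sup>+ Z. (\<integral>\<^sup>+ t. masked_weight (insert i I) s (Z + entry i t) \<partial>lborel) * indicator (ball 0 (R + 1)) Z \<partial>lborel)"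
    by (subst nn_integral_multc) simp_all
  also have "\<dots> \<le> (\<integral>\<^sup>+ Z. (ennreal (pi / (s + 1)) * masked_weight I s Z) * indicator (ball 0 (R + 1)) Z \<partial>lborel)"
    by (intro nn_integral_mono mult_right_mono masked_weight_slice s insert.hyps) simp
  also have "\<dots> = ennreal (pi / (s + 1)) * (\<integral>\<^sup>+ Z. masked_weight I s Z * indicator (ball 0 (R + 1)) Z \<partial>lborel)"
    by (subst nn_integral_cmult[symmetric]) (simp_all add: mult.assoc)
  also have "\<dots> < \<infinity>"
    using insert.IH[of "R + 1"] by (simp add: ennreal_mult_less_top)
  finally show ?case using V by (auto simp: f_def ennreal_mult_less_top)
qed

lemma bergman_weight_integrable:
  assumes "lam > 2 * real CARD('n::finite) - 1"
  shows "(\<integral>\<^sup>+ Z. ennreal (bergman_weight lam Z) * indicator (cartan_domain :: 'n cmatrix set) Z \<partial>lborel) < \<infinity>"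
proof -
  obtain R where R: "\<And>Z :: 'n cmatrix. Z \<in> cartan_domain \<Longrightarrow> norm Z < R"
    using bounded_cartan_domain[where 'n='n] unfolding bounded_iff by (metis gt_ex le_less_trans)
  have mask: "mask UNIV Z = Z" for Z :: "'n cmatrix" by (simp add: mask_def vec_eq_iff)
  have "(\<integral>\<^sup>+ Z. ennreal (bergman_weight lam Z) * indicator (cartan_domain :: 'n cmatrix set) Z \<partial>lborel)
      = (\<integral>\<^sup>+ Z. masked_weight UNIV (lam - 2 * real CARD('n)) (Z :: 'n cmatrix) * indicator (ball 0 R) Z \<partial>lborel)"
    using R by (intro nn_integral_cong) (auto simp: masked_weight_def mask bergman_weight_def hdet_def indicator_def)
  also have "\<dots> < \<infinity>" using assms by (intro masked_weight_integrable) auto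
  finally show ?thesis .
qed

section \<open>Taylor expansion in several variables\<close>

lemma holomorphic_mat_onD:
  assumes "holomorphic_mat_on f D" "Z \<in> D"
  shows "(f has_derivative frechet_derivative f (at Z)) (at Z)"
    and "frechet_derivative f (at Z) (cscale c W) = c * frechet_derivative f (at Z) W"
    and "bounded_linear (frechet_derivative f (at Z))"
proof -
  from assms obtain f' where f': "(f has_derivative f') (at Z)"
    "\<And>c W. f' (\<chi> i j. c * W $ i $ j) = c * f' W"
    by (auto simp: holomorphic_mat_on_def)
  then have "frechet_derivative f (at Z) = f'" using frechet_derivative_at by force
  with f' show "(f has_derivative frechet_derivative f (at Z)) (at Z)"
    and "frechet_derivative f (at Z) (cscale c W) = c * frechet_derivative f (at Z) W"
    and "bounded_linear (frechet_derivative f (at Z))"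
    by (auto simp: cscale_def intro: has_derivative_bounded_linear)
qed

lemma holomorphic_mat_onI:
  assumes "\<And>Z. Z \<in> D \<Longrightarrow> (f has_derivative f' Z) (at Z)"
    and "\<And>Z c W. Z \<in> D \<Longrightarrow> f' Z (cscale c W) = c * f' Z W"
  shows "holomorphic_mat_on f D"
  using assms unfolding holomorphic_mat_on_def cscale_def by blast

lemma holomorphic_mat_on_continuous: "holomorphic_mat_on f D \<Longrightarrow> continuous_on D f"
  by (intro continuous_at_imp_continuous_on ballI has_derivative_continuous[OF holomorphic_mat_onD(1)])

lemma norm_cscale: "norm (cscale c W) = cmod c * norm W"
proof -
  have "norm (cscale c W $ i) = cmod c * norm (W $ i)" for i
    by (simp add: norm_vec_def norm_mult L2_set_right_distrib)
  then show ?thesis by (simp add: norm_vec_def[of W] norm_vec_def[of "cscale c W"] L2_set_right_distrib)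
qed

lemma continuous_on_cscale [continuous_intros]:
  assumes "continuous_on S f"
  shows "continuous_on S (\<lambda>x. cscale (f x) W)"
  using bounded_linear.continuous_on[OF bounded_linear_cscale_left assms] .

lemma holomorphic_mat_on_line_deriv:
  assumes "holomorphic_mat_on f D" "Z + cscale z W \<in> D"
  shows "((\<lambda>z. f (Z + cscale z W)) has_field_derivative
    frechet_derivative f (at (Z + cscale z W)) W) (at z)"
proof -
  have "((\<lambda>z. Z + cscale z W) has_derivative (\<lambda>z. cscale z W)) (at z)"
    by (rule has_derivative_eq_rhs[OF has_derivative_add[OF has_derivative_const
          bounded_linear.has_derivative[OF bounded_linear_cscale_left has_derivative_ident]]]) simp
  from has_derivative_compose[OF this holomorphic_mat_onD(1)[OF assms]]
  have "((\<lambda>z. f (Z + cscale z W)) has_derivative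
      (\<lambda>c. frechet_derivative f (at (Z + cscale z W)) (cscale c W))) (at z)" .
  then show ?thesis
    unfolding has_field_derivative_def holomorphic_mat_onD(2)[OF assms] by (simp add: mult.commute[of _ "frechet_derivative _ _ _"])
qed

text \<open>Cauchy's formula for the derivative of \<open>z \<mapsto> f (Z + cscale z W)\<close> at \<open>0\<close>, as an integral over a fixed real
interval in which \<open>Z\<close> is a parameter.\<close>

lemma frechet_derivative_Cauchy:
  assumes f: "holomorphic_mat_on f D" and r: "r > 0"
    and D: "\<And>z. cmod z \<le> r \<Longrightarrow> Z + cscale z W \<in> D"
  shows "((\<lambda>x. 1 / (of_real r * exp (2 * of_real pi * \<i> * of_real x)) *
      f (Z + cscale (of_real r * exp (2 * of_real pi * \<i> * of_real x)) W))
    has_integral frechet_derivative f (at Z) W) {0..1}"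
proof -
  let ?g = "\<lambda>z. f (Z + cscale z W)"
  have der: "(?g has_field_derivative frechet_derivative f (at (Z + cscale z W)) W) (at z)" if "cmod z \<le> r" for z
    by (intro holomorphic_mat_on_line_deriv[OF f] D that)
  have "continuous_on (cball 0 r) ?g"
    using der by (intro continuous_at_imp_continuous_on ballI DERIV_isCont) auto
  moreover have "?g holomorphic_on ball 0 r"
    unfolding holomorphic_on_open[OF open_ball] using der by (metis less_imp_le mem_ball_0)
  moreover have "deriv ?g 0 = frechet_derivative f (at Z) W"
    by (intro DERIV_imp_deriv der[of 0, unfolded cscale_zero add_0_right norm_zero] less_imp_le r)
  ultimately have "((\<lambda>u. ?g u / (u - 0) ^ Suc 1) has_contour_integral
      (2 * pi * \<i>) / fact 1 * frechet_derivative f (at Z) W) (circlepath 0 r)"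
    using Cauchy_has_contour_integral_higher_derivative_circlepath[of 0 r ?g 0 1] r by simp
  then have "((\<lambda>x. 1 / (2 * pi * \<i>) * (?g (circlepath 0 r x) / (circlepath 0 r x - 0) ^ Suc 1 *
      vector_derivative (circlepath 0 r) (at x within {0..1})))
      has_integral (1 / (2 * pi * \<i>) * ((2 * pi * \<i>) / fact 1 * frechet_derivative f (at Z) W))) {0..1}"
    unfolding has_contour_integral_def by (rule has_integral_mult_right)
  then have "((\<lambda>x. 1 / (2 * pi * \<i>) * (?g (circlepath 0 r x) / (circlepath 0 r x - 0) ^ Suc 1 *
      vector_derivative (circlepath 0 r) (at x within {0..1})))
      has_integral frechet_derivative f (at Z) W) {0..1}" by simp
  then show ?thesis
  proof (rule has_integral_eq[rotated])
    fix x :: real assume x: "x \<in> {0..1}"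
    then have "vector_derivative (circlepath 0 r) (at x within {0..1}) = 2 * pi * \<i> * r * exp (2 * of_real pi * \<i> * x)"
      by (intro vector_derivative_circlepath01) auto
    then show "1 / (2 * pi * \<i>) * (?g (circlepath 0 r x) / (circlepath 0 r x - 0) ^ Suc 1 *
      vector_derivative (circlepath 0 r) (at x within {0..1})) = 1 / (of_real r * exp (2 * of_real pi * \<i> * of_real x)) *
      f (Z + cscale (of_real r * exp (2 * of_real pi * \<i> * of_real x)) W)"
      using r by (simp add: circlepath field_simps power2_eq_square)
  qed
qed

text \<open>Cauchy's formula expresses a partial derivative as an integral of values of \<open>f\<close>. It shows first that
partial derivatives are continuous, and then, by differentiation under the integral sign, that
they are differentiable; complex linearity passes to the integral.\<close>

lemma holomorphic_mat_on_partial: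
  fixes f :: "'n::finite cmatrix \<Rightarrow> complex"
  assumes "open D" and f: "holomorphic_mat_on f D"
  shows "holomorphic_mat_on (\<lambda>Z. frechet_derivative f (at Z) W) D"
proof -
  let ?e = "\<lambda>r x. of_real r * exp (2 * of_real pi * \<i> * of_real x) :: complex"
  have e: "cmod (?e r x) = r" if "r > 0" for r x using that by (simp add: norm_mult)
  note contf = holomorphic_mat_on_continuous[OF f]
  \<comment> \<open>One circle radius \<open>r\<close> serves all points near \<open>Z0\<close>, so Cauchy's formula represents the
    derivative on a whole ball by an integral over a fixed interval.\<close>
  have loc: "\<exists>\<delta>>0. \<exists>r>0. ball Z0 \<delta> \<subseteq> D \<and> (\<forall>Z\<in>ball Z0 \<delta>. \<forall>z. cmod z \<le> r \<longrightarrow> Z + cscale z W \<in> D)"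
    if "Z0 \<in> D" for Z0 W
  proof -
    obtain \<epsilon> where \<epsilon>: "\<epsilon> > 0" "ball Z0 \<epsilon> \<subseteq> D" using \<open>open D\<close> \<open>Z0 \<in> D\<close> open_contains_ball by blast
    define n where "n = norm W + 1"
    define r where "r = \<epsilon> / (2 * n)"
    have "n > 0" by (simp add: n_def add_nonneg_pos)
    then have "r > 0" "r * n = \<epsilon> / 2" using \<epsilon> by (simp_all add: r_def)
    then have r: "r > 0" "r * (norm W + 1) = \<epsilon> / 2" by (simp_all add: n_def)
    have "Z + cscale z W \<in> D" if "Z \<in> ball Z0 (\<epsilon> / 2)" "cmod z \<le> r" for Z z
    proof -
      have "norm (cscale z W) \<le> r * (norm W + 1)"
        unfolding norm_cscale using that r by (intro mult_mono) auto
      then have "dist Z0 (Z + cscale z W) < \<epsilon>"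
        using that r dist_triangle[of Z0 "Z + cscale z W" Z] by (simp add: dist_norm)
      then show ?thesis using \<epsilon> by auto
    qed
    moreover have "ball Z0 (\<epsilon> / 2) \<subseteq> D" using \<epsilon> subset_ball[of "\<epsilon> / 2" \<epsilon> Z0] by auto
    ultimately show ?thesis using \<epsilon> r by (intro exI[of _ "\<epsilon> / 2"]) auto
  qed
  have cont_arg: "continuous_on (U \<times> cbox 0 1) (\<lambda>(Z, x). Z + cscale (?e r x) W)" for U r W
    unfolding split_beta by (intro continuous_intros)
  have cont_inv: "continuous_on (U \<times> cbox 0 1) (\<lambda>(Z, x). 1 / ?e r x)" if "r > 0" for U :: "'n cmatrix set" and r
    unfolding split_beta using that by (intro continuous_intros) auto
  have contpart: "continuous_on D (\<lambda>Z. frechet_derivative f (at Z) W)" for W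
  proof (rule continuous_at_imp_continuous_on, rule ballI)
    fix Z0 assume "Z0 \<in> D"
    then obtain \<delta> r where \<delta>: "\<delta> > 0" "r > 0" "ball Z0 \<delta> \<subseteq> D"
      and D: "\<And>Z z. Z \<in> ball Z0 \<delta> \<Longrightarrow> cmod z \<le> r \<Longrightarrow> Z + cscale z W \<in> D"
      using loc[of Z0 W] by blast
    have "continuous_on (ball Z0 \<delta> \<times> cbox 0 1) (\<lambda>(Z, x). 1 / ?e r x * f (Z + cscale (?e r x) W))"
      unfolding split_beta
      using D \<delta>(2) e by (intro continuous_on_mult cont_inv[unfolded split_beta]
          continuous_on_compose2[OF contf cont_arg[unfolded split_beta]]) auto
    then have "continuous_on (ball Z0 \<delta>) (\<lambda>Z. integral (cbox 0 1) (\<lambda>x. 1 / ?e r x * f (Z + cscale (?e r x) W)))"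
      by (rule integral_continuous_on_param)
    then have "continuous_on (ball Z0 \<delta>) (\<lambda>Z. frechet_derivative f (at Z) W)"
    proof (rule continuous_on_eq)
      fix Z assume "Z \<in> ball Z0 \<delta>"
      then show "integral (cbox 0 1) (\<lambda>x. 1 / ?e r x * f (Z + cscale (?e r x) W)) = frechet_derivative f (at Z) W"
        using frechet_derivative_Cauchy[OF f \<delta>(2) D, of Z] by (intro integral_unique) simp
    qed
    then show "isCont (\<lambda>Z. frechet_derivative f (at Z) W) Z0"
      using \<delta> by (simp add: continuous_on_eq_continuous_at)
  qed
  define F where "F Z = Blinfun (frechet_derivative f (at Z))" for Z
  have F: "blinfun_apply (F Z) = frechet_derivative f (at Z)" if "Z \<in> D" for Z
    unfolding F_def by (rule bounded_linear_Blinfun_apply[OF holomorphic_mat_onD(3)[OF f that]])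
  have contF: "continuous_on D F"
  proof (rule continuous_on_blinfun_componentwise)
    fix i :: "'n cmatrix"
    from contpart[of i] show "continuous_on D (\<lambda>Z. blinfun_apply (F Z) i)"
      by (rule continuous_on_eq) (simp add: F)
  qed
  have "\<exists>G. ((\<lambda>Z. frechet_derivative f (at Z) W) has_derivative G) (at Z0) \<and> (\<forall>c V. G (cscale c V) = c * G V)"
    if "Z0 \<in> D" for Z0
  proof -
    obtain \<delta> r where \<delta>: "\<delta> > 0" "r > 0" "ball Z0 \<delta> \<subseteq> D"
      and D: "\<And>Z z. Z \<in> ball Z0 \<delta> \<Longrightarrow> cmod z \<le> r \<Longrightarrow> Z + cscale z W \<in> D"
      using loc[of Z0 W] \<open>Z0 \<in> D\<close> by blast
    define h where "h Z x = 1 / ?e r x * f (Z + cscale (?e r x) W)" for Z and x :: real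
    define h' where "h' Z x = blinfun_mult_right (1 / ?e r x) o\<^sub>L F (Z + cscale (?e r x) W)" for Z and x :: real
    have in_D: "Z + cscale (?e r x) W \<in> D" if "Z \<in> ball Z0 \<delta>" for Z x
      using D[OF that] e[OF \<delta>(2)] by simp
    have h_int: "(h Z has_integral frechet_derivative f (at Z) W) (cbox 0 1)" if "Z \<in> ball Z0 \<delta>" for Z
      using frechet_derivative_Cauchy[OF f \<delta>(2) D[OF that]] by (simp add: h_def[abs_def])
    have conth': "continuous_on (ball Z0 \<delta> \<times> cbox 0 1) (\<lambda>(Z, x). h' Z x)"
      unfolding h'_def split_beta
      by (intro bounded_bilinear.continuous_on[OF bounded_bilinear_blinfun_compose]
          bounded_linear.continuous_on[OF bounded_linear_blinfun_mult_right] cont_inv[unfolded split_beta]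
          continuous_on_compose2[OF contF cont_arg[unfolded split_beta]] \<delta>) (auto intro: in_D)
    have "((\<lambda>Z. integral (cbox 0 1) (h Z)) has_derivative integral (cbox 0 1) (h' Z0)) (at Z0 within ball Z0 \<delta>)"
    proof (rule leibniz_rule)
      fix Z x assume "Z \<in> ball Z0 \<delta>" 
      then have "Z + cscale (?e r x) W \<in> D" by (rule in_D)
      then have der: "(f has_derivative frechet_derivative f (at (Z + cscale (?e r x) W))) (at (Z + cscale (?e r x) W))"
        by (rule holomorphic_mat_onD(1)[OF f])
      have "((\<lambda>Z. Z + cscale (?e r x) W) has_derivative (\<lambda>V. V)) (at Z)"
        by (rule has_derivative_eq_rhs[OF has_derivative_add[OF has_derivative_ident has_derivative_const]]) simp
      from has_derivative_compose[OF this der] have "((\<lambda>Z. f (Z + cscale (?e r x) W)) has_derivative frechet_derivative f (at (Z + cscale (?e r x) W))) (at Z)" .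
      then have "((\<lambda>Z. h Z x) has_derivative (\<lambda>V. 1 / ?e r x * frechet_derivative f (at (Z + cscale (?e r x) W)) V)) (at Z)"
        unfolding h_def by (rule has_derivative_mult_right)
      moreover have "blinfun_apply (h' Z x) = (\<lambda>V. 1 / ?e r x * frechet_derivative f (at (Z + cscale (?e r x) W)) V)"
        using \<open>Z + cscale (?e r x) W \<in> D\<close> by (simp add: h'_def F fun_eq_iff)
      ultimately show "((\<lambda>Z. h Z x) has_derivative blinfun_apply (h' Z x)) (at Z within ball Z0 \<delta>)"
        by (simp add: has_derivative_at_withinI)
    next
      show "h Z integrable_on cbox 0 1" if "Z \<in> ball Z0 \<delta>" for Z using h_int[OF that] by blast
    qed (use conth' \<delta> in auto)
    then have "((\<lambda>Z. integral (cbox 0 1) (h Z)) has_derivative integral (cbox 0 1) (h' Z0)) (at Z0)"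
      using \<delta> by (simp add: at_within_open[of _ "ball _ _"])
    then have "((\<lambda>Z. frechet_derivative f (at Z) W) has_derivative integral (cbox 0 1) (h' Z0)) (at Z0)"
      by (rule has_derivative_transform_within_open[where s = "ball Z0 \<delta>"])
        (use \<delta> h_int in \<open>auto intro: integral_unique\<close>)
    have "h' Z0 integrable_on cbox 0 1"
      by (intro integrable_continuous continuous_on_compose2[OF conth', where f = "\<lambda>x. (Z0, x)", unfolded split_beta fst_conv snd_conv])
         (auto intro!: continuous_intros \<delta>)
    moreover have "h' Z0 x (cscale c V) = c * h' Z0 x V" for x c V
      using in_D[of Z0] \<delta> by (simp add: h'_def F holomorphic_mat_onD(2)[OF f])
    ultimately have "integral (cbox 0 1) (h' Z0) (cscale c V) = c * integral (cbox 0 1) (h' Z0) V" for c V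
      by (simp only: blinfun_apply_integral integral_mult_right)
    moreover note \<open>((\<lambda>Z. frechet_derivative f (at Z) W) has_derivative integral (cbox 0 1) (h' Z0)) (at Z0)\<close>
    ultimately show ?thesis by blast
  qed
  then show ?thesis unfolding holomorphic_mat_on_def cscale_def by blast
qed

text \<open>The component of degree \<open>k\<close>, that is, the \<open>k\<close>-th Taylor coefficient along the line through \<open>0\<close> and \<open>Z\<close>.
It makes sense for all \<open>Z\<close>, since \<open>cscale z Z\<close> is close to \<open>0\<close> for small \<open>z\<close>.\<close>

definition taylor_part :: "nat \<Rightarrow> ('n::finite cmatrix \<Rightarrow> complex) \<Rightarrow> 'n cmatrix \<Rightarrow> complex"
  where "taylor_part k f Z = (deriv ^^ k) (\<lambda>z. f (cscale z Z)) 0 / fact k"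

lemma matrix_eq_sum_entries:
  "W = (\<Sum>j\<in>UNIV. \<Sum>k\<in>UNIV. cscale (W $ j $ k) (dyad (axis j 1) (axis k 1)))"
  by (simp add: vec_eq_iff dyad_def axis_def if_distrib[of cnj] if_distrib[of "\<lambda>x. _ * x"] cong: if_cong)

lemma holomorphic_on_ray:
  assumes D: "open D" "cscale z Z \<in> D" and f: "holomorphic_mat_on f D"
  shows "((\<lambda>z. f (cscale z Z)) has_field_derivative frechet_derivative f (at (cscale z Z)) Z) (at z)"
  using holomorphic_mat_on_line_deriv[OF f, of 0 z Z] D by simp

lemma higher_deriv_sum:
  assumes "open S" "z \<in> S" "finite A" "\<And>a. a \<in> A \<Longrightarrow> g a holomorphic_on S"
  shows "(deriv ^^ n) (\<lambda>z. \<Sum>a\<in>A. c a * g a z) z = (\<Sum>a\<in>A. c a * (deriv ^^ n) (g a) z)"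
  using assms(3,4)
proof (induction A rule: finite_induct)
  case (insert a A)
  have "(deriv ^^ n) (\<lambda>z. c a * g a z + (\<Sum>a\<in>A. c a * g a z)) z
      = (deriv ^^ n) (\<lambda>z. c a * g a z) z + (deriv ^^ n) (\<lambda>z. \<Sum>a\<in>A. c a * g a z) z"
    using insert assms(1,2) by (intro higher_deriv_add[where S = S]) (auto intro!: holomorphic_intros)
  with insert assms(1,2) show ?case by (simp add: higher_deriv_cmult[where A = S])
qed simp

text \<open>Differentiating once along the line gives \<open>\<Sum> Z $ j $ l * \<partial>f / \<partial>Z $ j $ l\<close>, so the component of degree
\<open>Suc k\<close> is made from the components of degree \<open>k\<close> of the partial derivatives.\<close>

lemma hpoly_taylor_part:
  fixes f :: "'n::finite cmatrix \<Rightarrow> complex"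
  assumes D: "open D" "0 \<in> D" and f: "holomorphic_mat_on f D"
  shows "hpoly k (taylor_part k f)"
proof -
  have "hpoly k (\<lambda>Z. (deriv ^^ k) (\<lambda>z. f (cscale z Z)) 0)"
    using f
  proof (induction k arbitrary: f)
    case 0
    show ?case by (simp add: hpoly.const)
  next
    case (Suc k)
    let ?E = "\<lambda>j l. dyad (axis j 1) (axis l 1) :: 'n cmatrix"
    let ?p = "\<lambda>a Z. frechet_derivative f (at Z) (?E (fst a) (snd a))"
    have p: "holomorphic_mat_on (?p a) D" for a by (rule holomorphic_mat_on_partial[OF D(1) Suc.prems])
    have eq: "(deriv ^^ Suc k) (\<lambda>z. f (cscale z Z)) 0
        = (\<Sum>a\<in>UNIV. Z $ fst a $ snd a * (deriv ^^ k) (\<lambda>z. ?p a (cscale z Z)) 0)" for Z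
    proof -
      define S where "S = (\<lambda>z. cscale z Z) -` D"
      have "open S"
        unfolding S_def by (intro open_vimage D(1) continuous_on_cscale continuous_on_id)
      then have S: "open S" "0 \<in> S" using D(2) by (simp_all add: S_def)
      have ray: "((\<lambda>z. g (cscale z Z)) has_field_derivative frechet_derivative g (at (cscale z Z)) Z) (at z)"
        if "z \<in> S" "holomorphic_mat_on g D" for z g
        using that D by (intro holomorphic_on_ray[OF D(1)]) (auto simp: S_def)
      have hol: "(\<lambda>z. g (cscale z Z)) holomorphic_on S" if "holomorphic_mat_on g D" for g
        using ray[OF _ that] S(1) by (auto simp: holomorphic_on_open)
      have "(deriv ^^ Suc k) (\<lambda>z. f (cscale z Z)) 0 = (deriv ^^ k) (deriv (\<lambda>z. f (cscale z Z))) 0"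
        by (simp only: funpow_Suc_right o_apply)
      also have "\<dots> = (deriv ^^ k) (\<lambda>z. \<Sum>a\<in>UNIV. Z $ fst a $ snd a * ?p a (cscale z Z)) 0"
      proof (rule higher_deriv_transform_within_open[OF _ _ S])
        show "deriv (\<lambda>z. f (cscale z Z)) holomorphic_on S"
          by (rule holomorphic_deriv[OF hol[OF Suc.prems] S(1)])
        show "(\<lambda>z. \<Sum>a\<in>UNIV. Z $ fst a $ snd a * ?p a (cscale z Z)) holomorphic_on S"
          by (intro holomorphic_intros hol p)
        fix z assume z: "z \<in> S"
        then have zD: "cscale z Z \<in> D" by (simp add: S_def)
        interpret L: bounded_linear "frechet_derivative f (at (cscale z Z))"
          by (rule holomorphic_mat_onD(3)[OF Suc.prems zD])
        have "deriv (\<lambda>z. f (cscale z Z)) z = frechet_derivative f (at (cscale z Z)) Z"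
          by (rule DERIV_imp_deriv[OF ray[OF z Suc.prems]])
        also have "\<dots> = frechet_derivative f (at (cscale z Z)) (\<Sum>j\<in>UNIV. \<Sum>l\<in>UNIV. cscale (Z $ j $ l) (?E j l))"
          using matrix_eq_sum_entries[of Z] by simp
        also have "\<dots> = (\<Sum>j\<in>UNIV. \<Sum>l\<in>UNIV. Z $ j $ l * ?p (j, l) (cscale z Z))"
          by (simp add: L.sum holomorphic_mat_onD(2)[OF Suc.prems zD])
        also have "\<dots> = (\<Sum>a\<in>UNIV. Z $ fst a $ snd a * ?p a (cscale z Z))"
          by (simp add: sum.cartesian_product split_beta flip: UNIV_Times_UNIV)
        finally show "deriv (\<lambda>z. f (cscale z Z)) z = (\<Sum>a\<in>UNIV. Z $ fst a $ snd a * ?p a (cscale z Z))" .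
      qed
      also have "\<dots> = (\<Sum>a\<in>UNIV. Z $ fst a $ snd a * (deriv ^^ k) (\<lambda>z. ?p a (cscale z Z)) 0)"
        by (rule higher_deriv_sum[OF S]) (auto intro: hol p)
      finally show ?thesis .
    qed
    show ?case unfolding eq by (intro hpoly_sum hpoly.coord Suc.IH p)
  qed
  from hpoly_smult[OF this, of "1 / fact k"] show ?thesis by (simp add: taylor_part_def[abs_def])
qed

lemma taylor_part_sums:
  assumes f: "holomorphic_mat_on f cartan_domain" and Z: "Z \<in> cartan_domain" and c: "cmod c \<le> 1"
  shows "(\<lambda>k. taylor_part k f Z * c ^ k) sums f (cscale c Z)"
proof -
  obtain r where r: "r > 1" "\<And>c. cmod c < r \<Longrightarrow> cscale c Z \<in> cartan_domain"
    using cscale_in_cartan_domain_larger[OF Z] by blast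
  have "(\<lambda>z. f (cscale z Z)) holomorphic_on ball 0 r"
    unfolding holomorphic_on_open[OF open_ball]
    using holomorphic_on_ray[OF open_cartan_domain r(2) f] by (metis mem_ball_0)
  from holomorphic_power_series[OF this, of c] r(1) c show ?thesis by (simp add: taylor_part_def)
qed

section \<open>Averages over roots of unity\<close>

lemma sum_roots_of_unity_power:
  fixes d :: nat
  assumes "0 < d" "d < N"
  shows "(\<Sum>j<N. cis (2 * pi * real j * real d / real N)) = 0"
proof -
  define \<omega> where "\<omega> = cis (2 * pi * real d / real N)"
  have "\<omega> ^ N = 1" using assms by (simp only: \<omega>_def Complex.DeMoivre) (simp add: cis_multiple_2pi)
  moreover have "\<omega> \<noteq> 1"
  proof
    assume "\<omega> = 1"
    then have "cos (2 * pi * real d / real N) = 1" by (simp add: \<omega>_def complex_eq_iff)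
    then obtain n :: int where "2 * pi * real d / real N = of_int n * 2 * pi"
      unfolding cos_one_2pi_int by auto
    then have "real d = of_int n * real N" using assms by (simp add: field_simps)
    then have "int d = n * int N" by (metis of_int_eq_iff of_int_mult of_int_of_nat_eq)
    then show False using assms by (metis dvd_triv_right int_dvd_int_iff nat_dvd_not_less)
  qed
  moreover have "(\<Sum>j<N. cis (2 * pi * real j * real d / real N)) = (\<Sum>j<N. \<omega> ^ j)"
    by (rule sum.cong) (simp_all only: \<omega>_def Complex.DeMoivre, simp_all add: mult_ac)
  ultimately show ?thesis by (simp add: geometric_sum)
qed

text \<open>The characters of the cyclic group of order \<open>N\<close> are orthogonal. Finite averages serve here in place
of integrals over the circle, so that rotation invariance has to be used for finitely many rotations only.\<close>

lemma discrete_Parseval: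
  fixes b :: "nat \<Rightarrow> complex"
  assumes "N > 0"
  shows "(\<Sum>j<N. (cmod (\<Sum>m<N. b m * cis (2 * pi * real j / real N) ^ m))\<^sup>2) = real N * (\<Sum>m<N. (cmod (b m))\<^sup>2)"
proof -
  define e where "e j m = cis (2 * pi * real j / real N) ^ m" for j m :: nat
  have e: "e j m = cis (2 * pi * real j * real m / real N)" for j m
    by (simp only: e_def Complex.DeMoivre) (simp add: mult_ac)
  have orth: "(\<Sum>j<N. e j m * cnj (e j l)) = (if m = l then of_nat N else 0)" if "m < N" "l < N" for m l
  proof -
    have *: "(\<Sum>j<N. e j m * cnj (e j l)) = 0" if "l < m" "m < N" for l m
    proof -
      have "e j m * cnj (e j l) = cis (2 * pi * real j * real (m - l) / real N)" for j
        using that by (simp add: e cis_cnj cis_mult of_nat_diff algebra_simps diff_divide_distrib)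
      then show ?thesis using sum_roots_of_unity_power[of "m - l" N] that by simp
    qed
    consider "m = l" | "l < m" | "m < l" by linarith
    then show ?thesis
    proof cases
      case 1
      then show ?thesis by (simp add: e cis_cnj cis_mult)
    next
      case 2
      with * that show ?thesis by simp
    next
      case 3
      have "(\<Sum>j<N. e j m * cnj (e j l)) = cnj (\<Sum>j<N. e j l * cnj (e j m))"
        by (simp add: mult.commute)
      with *[OF 3 that(2)] 3 show ?thesis by simp
    qed
  qed
  have "complex_of_real (\<Sum>j<N. (cmod (\<Sum>m<N. b m * e j m))\<^sup>2)
      = (\<Sum>j<N. (\<Sum>m<N. b m * e j m) * cnj (\<Sum>l<N. b l * e j l))"
    by (simp add: complex_norm_square del: of_real_power)
  also have "\<dots> = (\<Sum>j<N. \<Sum>m<N. \<Sum>l<N. b m * cnj (b l) * (e j m * cnj (e j l)))"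
    by (simp add: sum_product mult_ac)
  also have "\<dots> = (\<Sum>m<N. \<Sum>j<N. \<Sum>l<N. b m * cnj (b l) * (e j m * cnj (e j l)))"
    by (rule sum.swap)
  also have "\<dots> = (\<Sum>m<N. \<Sum>l<N. \<Sum>j<N. b m * cnj (b l) * (e j m * cnj (e j l)))"
    by (intro sum.cong refl sum.swap)
  also have "\<dots> = (\<Sum>m<N. \<Sum>l<N. b m * cnj (b l) * (if m = l then of_nat N else 0))"
    by (intro sum.cong refl) (simp add: orth flip: sum_distrib_left)
  also have "\<dots> = (\<Sum>m<N. of_nat N * (b m * cnj (b m)))"
    by (intro sum.cong refl) (simp add: if_distrib mult_ac cong: if_cong)
  also have "\<dots> = complex_of_real (real N * (\<Sum>m<N. (cmod (b m))\<^sup>2))"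
    by (simp add: complex_norm_square sum_distrib_left del: of_real_power)
  finally show ?thesis unfolding of_real_eq_iff e_def .
qed

text \<open>A Bessel inequality for absolutely convergent power series on the unit circle. The sampled
values of \<open>F\<close> differ from those of the partial sum of length \<open>N\<close> by at most the tail \<open>r N\<close>, which tends to \<open>0\<close>. The
constant \<open>4\<close> absorbs this error.\<close>

lemma sum_squares_le_root_averages:
  fixes a :: "nat \<Rightarrow> complex"
  assumes a: "summable (\<lambda>m. cmod (a m))"
    and F: "\<And>c. cmod c = 1 \<Longrightarrow> (\<lambda>m. a m * c ^ m) sums F c"
  shows "\<forall>\<^sub>F N in sequentially. (\<Sum>m<K. (cmod (a m))\<^sup>2)
    \<le> 4 * ((\<Sum>j<N. (cmod (F (cis (2 * pi * real j / real N))))\<^sup>2) / real N)"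
proof (cases "(\<Sum>m<K. (cmod (a m))\<^sup>2) = 0")
  case True
  then show ?thesis by (simp add: sum_nonneg)
next
  case False
  define s where "s = (\<Sum>m<K. (cmod (a m))\<^sup>2)"
  have s: "s > 0" using False sum_nonneg[of "{..<K}" "\<lambda>m. (cmod (a m))\<^sup>2"] by (simp add: s_def less_le)
  define r where "r N = (\<Sum>m. cmod (a (m + N)))" for N
  have "r \<longlonglongrightarrow> 0"
    unfolding r_def using suminf_exist_split2[OF a] .
  then have "(\<lambda>N. 2 * (r N)\<^sup>2) \<longlonglongrightarrow> 2 * 0\<^sup>2" by (intro tendsto_intros)
  then have "\<forall>\<^sub>F N in sequentially. 2 * (r N)\<^sup>2 < s / 2"
    using s by (intro order_tendstoD(2)[of _ 0]) auto
  moreover have "\<forall>\<^sub>F N in sequentially. N > 0 \<and> K \<le> N" 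
    by (intro eventually_conj eventually_gt_at_top eventually_ge_at_top)
  ultimately show ?thesis
  proof eventually_elim
    case (elim N)
    define A where "A = (\<Sum>j<N. (cmod (F (cis (2 * pi * real j / real N))))\<^sup>2)"
    have "s \<le> (\<Sum>m<N. (cmod (a m))\<^sup>2)"
      unfolding s_def using elim by (intro sum_mono2) auto
    then have "real N * s \<le> (\<Sum>j<N. (cmod (\<Sum>m<N. a m * cis (2 * pi * real j / real N) ^ m))\<^sup>2)"
      using discrete_Parseval[of N a] elim by (simp add: mult_left_mono)
    also have "\<dots> \<le> (\<Sum>j<N. 2 * (cmod (F (cis (2 * pi * real j / real N))))\<^sup>2 + 2 * (r N)\<^sup>2)"
    proof (rule sum_mono)
      fix j
      define c where "c = cis (2 * pi * real j / real N)"
      define S where "S = (\<Sum>m<N. a m * c ^ m)"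
      have c: "cmod c = 1" by (simp add: c_def)
      have "(\<lambda>m. a (m + N) * c ^ (m + N)) sums (F c - S)"
        using F[OF c] unfolding S_def by (rule sums_split_initial_segment)
      then have "F c - S = (\<Sum>m. a (m + N) * c ^ (m + N))" by (rule sums_unique)
      moreover have "cmod (a (m + N) * c ^ (m + N)) = cmod (a (m + N))" for m
        by (simp add: norm_mult norm_power c)
      moreover have "summable (\<lambda>m. cmod (a (m + N)))" using a by (rule summable_ignore_initial_segment)
      ultimately have "cmod (F c - S) \<le> r N"
        unfolding r_def using summable_norm[of "\<lambda>m. a (m + N) * c ^ (m + N)"] by simp
      moreover have "cmod S \<le> cmod (F c) + cmod (F c - S)"
        using norm_triangle_sub[of S "F c"] by (simp add: norm_minus_commute)
      ultimately have "cmod S \<le> cmod (F c) + r N" by linarith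
      then have "(cmod S)\<^sup>2 \<le> (cmod (F c) + r N)\<^sup>2" by (intro power_mono) auto
      also have "\<dots> \<le> 2 * (cmod (F c))\<^sup>2 + 2 * (r N)\<^sup>2"
        using sum_squares_bound[of "cmod (F c)" "r N"] by (simp add: power2_sum)
      finally show "(cmod (\<Sum>m<N. a m * cis (2 * pi * real j / real N) ^ m))\<^sup>2
          \<le> 2 * (cmod (F (cis (2 * pi * real j / real N))))\<^sup>2 + 2 * (r N)\<^sup>2"
        by (simp add: S_def c_def)
    qed
    also have "\<dots> = 2 * A + real N * (2 * (r N)\<^sup>2)"
      by (simp add: A_def sum.distrib sum_distrib_left)
    also have "\<dots> \<le> 2 * A + real N * (s / 2)"
      using elim by (intro add_left_mono mult_left_mono) auto
    finally show ?case
      using elim unfolding s_def[symmetric] A_def[symmetric] by (simp add: field_simps)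
  qed
qed

section \<open>The Bergman measure\<close>

text \<open>The squared norm with values in the extended nonnegative reals, so that monotone and Fatou-type
arguments apply without integrability conditions.\<close>

definition bnorm2 :: "real \<Rightarrow> ('n::finite cmatrix \<Rightarrow> complex) \<Rightarrow> ennreal"
  where "bnorm2 lam f = (\<integral>\<^sup>+ Z. ennreal ((cmod (f Z))\<^sup>2) \<partial>bergman_measure lam)"

lemma sets_bergman_measure [measurable_cong, simp]: "sets (bergman_measure lam) = sets borel"
  by (simp add: bergman_measure_def)

lemma space_bergman_measure [simp]: "space (bergman_measure lam) = UNIV"
  by (simp add: bergman_measure_def)

lemma borel_measurable_bergman_weight [measurable]: "bergman_weight lam \<in> borel_measurable borel"
proof -
  have "bergman_weight lam = (\<lambda>Z::'a cmatrix. Re (hdet Z) powr (lam - 2 * real CARD('a)))"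
    by (simp add: bergman_weight_def[abs_def] hdet_def)
  then show ?thesis by simp
qed

lemma bergman_weight_pos: "Z \<in> cartan_domain \<Longrightarrow> 0 < bergman_weight lam Z"
  using hdet_pos[of Z] by (simp add: bergman_weight_def hdet_def)

lemma bergman_weight_nonneg: "0 \<le> bergman_weight lam Z"
  by (simp add: bergman_weight_def)

lemma emeasure_lborel_open_nonzero:
  fixes U :: "'a::euclidean_space set"
  assumes "open U" "U \<noteq> {}"
  shows "emeasure lborel U \<noteq> 0"
proof -
  obtain x e where xe: "e > 0" "ball x e \<subseteq> U" using assms open_contains_ball by blast
  have "emeasure lborel (ball x e) \<noteq> 0"
    using content_ball_gt_0_iff[of x e] xe by (auto simp: measure_def)
  moreover have "emeasure lborel (ball x e) \<le> emeasure lborel U"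
    using xe assms by (intro emeasure_mono) auto
  ultimately show ?thesis by auto
qed

text \<open>The constant is the reciprocal of a Bochner integral, whose value would be \<open>0\<close> by convention if
the weight were not integrable.\<close>

lemma bergman_const_pos:
  assumes lam: "lam > 2 * real CARD('n::finite) - 1"
  shows "0 < bergman_const TYPE('n) lam"
proof -
  let ?f = "\<lambda>Z::'n cmatrix. indicator cartan_domain Z * bergman_weight lam Z"
  have eq: "ennreal (?f Z) = ennreal (bergman_weight lam Z) * indicator cartan_domain Z" for Z
    by (simp add: indicator_def)
  have fin: "(\<integral>\<^sup>+ Z. ennreal (?f Z) \<partial>lborel) < \<infinity>"
    unfolding eq using bergman_weight_integrable[OF lam] .
  have nz: "(\<integral>\<^sup>+ Z. ennreal (?f Z) \<partial>lborel) \<noteq> 0"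
  proof
    assume "(\<integral>\<^sup>+ Z. ennreal (?f Z) \<partial>lborel) = 0"
    then have "emeasure lborel {Z \<in> space lborel. ennreal (?f Z) \<noteq> 0} = 0"
      by (subst (asm) nn_integral_0_iff) auto
    also have "{Z \<in> space lborel. ennreal (?f Z) \<noteq> 0} = cartan_domain"
      using bergman_weight_pos[of _ lam] by (force simp: indicator_def ennreal_eq_0_iff not_le)
    finally show False
      using emeasure_lborel_open_nonzero[OF open_cartan_domain] zero_in_cartan_domain by blast
  qed
  have "(LINT Z:(cartan_domain :: 'n cmatrix set)|lborel. bergman_weight lam Z) = enn2real (\<integral>\<^sup>+ Z. ennreal (?f Z) \<partial>lborel)"
    unfolding set_lebesgue_integral_def
    by (subst integral_eq_nn_integral) (auto simp: bergman_weight_nonneg)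
  moreover have "enn2real (\<integral>\<^sup>+ Z. ennreal (?f Z) \<partial>lborel) > 0"
    using fin nz by (simp add: enn2real_positive_iff zero_less_iff_neq_zero)
  ultimately show ?thesis by (simp add: bergman_const_def)
qed

lemma nn_integral_bergman_measure:
  fixes f :: "'n::finite cmatrix \<Rightarrow> ennreal"
  assumes [measurable]: "f \<in> borel_measurable borel"
  shows "(\<integral>\<^sup>+ Z. f Z \<partial>bergman_measure lam) = (\<integral>\<^sup>+ Z. ennreal (bergman_const TYPE('n) lam *
      indicator cartan_domain Z * bergman_weight lam Z) * f Z \<partial>lborel)"
  unfolding bergman_measure_def by (rule nn_integral_density) measurable

lemma AE_bergman_measure: "AE Z in bergman_measure lam. Z \<in> cartan_domain"
  unfolding bergman_measure_def by (subst AE_density) (auto simp: indicator_def)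

lemma bergman_measure_finite:
  assumes "lam > 2 * real CARD('n::finite) - 1"
  shows "emeasure (bergman_measure lam) (UNIV :: 'n cmatrix set) < \<infinity>"
proof -
  have "emeasure (bergman_measure lam) (UNIV :: 'n cmatrix set) = (\<integral>\<^sup>+ (Z::'n cmatrix). 1 \<partial>bergman_measure lam)"
    by simp
  also have "\<dots> = (\<integral>\<^sup>+ (Z::'n cmatrix). ennreal (bergman_const TYPE('n) lam) *
      (ennreal (bergman_weight lam Z) * indicator cartan_domain Z) \<partial>lborel)"
    using bergman_const_pos[OF assms]
    by (subst nn_integral_bergman_measure)
       (auto intro!: nn_integral_cong simp: indicator_def ennreal_mult bergman_weight_nonneg less_imp_le)
  also have "\<dots> = ennreal (bergman_const TYPE('n) lam) *
      (\<integral>\<^sup>+ (Z::'n cmatrix). (ennreal (bergman_weight lam Z) * indicator cartan_domain Z) \<partial>lborel)"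
    by (rule nn_integral_cmult) measurable
  also have "\<dots> < \<infinity>"
    using bergman_weight_integrable[OF assms] by (simp add: ennreal_mult_less_top)
  finally show ?thesis .
qed

lemma norm_unitary_translate:
  fixes Z :: "'n::finite cmatrix"
  assumes "A \<in> unitary_group" "B \<in> unitary_group"
  shows "norm (A ** Z ** B) = norm Z"
proof -
  have left: "norm (A ** Z) = norm Z" if "A \<in> unitary_group" for A Z :: "'n cmatrix"
  proof -
    have T: "(norm W)\<^sup>2 = (\<Sum>j\<in>UNIV. (norm (column j W))\<^sup>2)" for W :: "'n cmatrix"
    proof -
      have "(norm W)\<^sup>2 = (\<Sum>i\<in>UNIV. \<Sum>j\<in>UNIV. (cmod (W $ i $ j))\<^sup>2)"
        by (simp add: norm_vec_def L2_set_def sum_nonneg)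
      also have "\<dots> = (\<Sum>j\<in>UNIV. \<Sum>i\<in>UNIV. (cmod (W $ i $ j))\<^sup>2)" by (rule sum.swap)
      also have "\<dots> = (\<Sum>j\<in>UNIV. (norm (column j W))\<^sup>2)"
        by (simp add: norm_vec_def L2_set_def sum_nonneg column_def)
      finally show ?thesis .
    qed
    have "column j (A ** Z) = A *v column j Z" for j
      by (simp add: column_def vec_eq_iff matrix_matrix_mult_def matrix_vector_mult_def)
    then have "(norm (A ** Z))\<^sup>2 = (norm Z)\<^sup>2" by (simp add: T norm_unitary_mult[OF that])
    then show ?thesis by simp
  qed
  have adj: "norm (conj_transpose W) = norm W" for W :: "'n cmatrix"
  proof -
    have "(norm (conj_transpose W))\<^sup>2 = (\<Sum>j\<in>UNIV. \<Sum>i\<in>UNIV. (cmod (W $ i $ j))\<^sup>2)"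
      by (simp add: norm_vec_def L2_set_def sum_nonneg conj_transpose_def)
    also have "\<dots> = (\<Sum>i\<in>UNIV. \<Sum>j\<in>UNIV. (cmod (W $ i $ j))\<^sup>2)" by (rule sum.swap)
    also have "\<dots> = (norm W)\<^sup>2" by (simp add: norm_vec_def L2_set_def sum_nonneg)
    finally show ?thesis by simp
  qed
  have "norm (A ** Z ** B) = norm (conj_transpose B ** conj_transpose (A ** Z))"
    by (metis adj conj_transpose_mult)
  also have "\<dots> = norm Z" by (simp add: left assms conj_transpose_unitary adj)
  finally show ?thesis .
qed

lemma linear_translate: "linear (\<lambda>Z::'n::finite cmatrix. A ** Z ** B)"
proof (rule linearI)
  show "A ** (X + Y) ** B = A ** X ** B + A ** Y ** B" for X Y :: "'n cmatrix"
    by (simp add: matrix_add_ldistrib matrix_add_rdistrib)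
  show "A ** (c *\<^sub>R X) ** B = c *\<^sub>R (A ** X ** B)" for X :: "'n cmatrix" and c
    by (simp add: vec_eq_iff matrix_matrix_mult_def flip: scaleR_sum_right)
qed

lemma matrix_diff_ldistrib: "A ** (B - C) = A ** B - A ** C" for A :: "'a::ring_1^'k^'m"
  by (simp add: vec_eq_iff matrix_matrix_mult_def right_diff_distrib sum_subtractf)

lemma matrix_diff_rdistrib: "(A - B) ** C = A ** C - B ** C" for C :: "'a::ring_1^'k^'m"
  by (simp add: vec_eq_iff matrix_matrix_mult_def left_diff_distrib sum_subtractf)

lemma bergman_weight_translate:
  assumes "A \<in> unitary_group" "B \<in> unitary_group"
  shows "bergman_weight lam (A ** Z ** B) = bergman_weight lam Z"
proof -
  have "(A ** Z ** B) ** conj_transpose (A ** Z ** B) = A ** (Z ** (B ** conj_transpose B) ** conj_transpose Z) ** conj_transpose A"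
    by (simp add: conj_transpose_mult matrix_mul_assoc)
  also have "\<dots> = A ** (Z ** conj_transpose Z) ** conj_transpose A"
    using assms(2) by (simp add: unitary_group_def)
  finally have "mat 1 - (A ** Z ** B) ** conj_transpose (A ** Z ** B)
      = A ** (mat 1 - Z ** conj_transpose Z) ** conj_transpose A"
    using assms(1) by (simp add: unitary_group_def matrix_diff_ldistrib matrix_diff_rdistrib)
  then have "det (mat 1 - (A ** Z ** B) ** conj_transpose (A ** Z ** B)) = det (A ** conj_transpose A) * det (mat 1 - Z ** conj_transpose Z)"
    by (simp add: det_mul mult_ac)
  also have "\<dots> = det (mat 1 - Z ** conj_transpose Z)" using assms(1) by (simp add: unitary_group_def)
  finally show ?thesis by (simp add: bergman_weight_def)
qed

lemma nn_integral_bergman_translate: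
  fixes f :: "'n::finite cmatrix \<Rightarrow> ennreal"
  assumes [measurable]: "f \<in> borel_measurable borel" and AB: "A \<in> unitary_group" "B \<in> unitary_group"
  shows "(\<integral>\<^sup>+ Z. f (A ** Z ** B) \<partial>bergman_measure lam) = (\<integral>\<^sup>+ Z. f Z \<partial>bergman_measure lam)"
proof -
  let ?g = "\<lambda>Z::'n cmatrix. ennreal (bergman_const TYPE('n) lam * indicator cartan_domain Z * bergman_weight lam Z) * f Z"
  have [measurable]: "(\<lambda>Z::'n cmatrix. A ** Z ** B) \<in> borel_measurable borel"
    using linear_translate linear_continuous_on linear_conv_bounded_linear
    by (blast intro: borel_measurable_continuous_onI)
  have "(\<integral>\<^sup>+ Z. f (A ** Z ** B) \<partial>bergman_measure lam) = (\<integral>\<^sup>+ Z. ?g (A ** Z ** B) \<partial>lborel)"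
    by (subst nn_integral_bergman_measure)
       (simp_all add: bergman_weight_translate[OF AB] unitary_translate_in_cartan_domain_iff[OF AB] indicator_def)
  also have "\<dots> = (\<integral>\<^sup>+ Z. ?g Z \<partial>lborel)"
    by (rule nn_integral_lborel_isometry[OF linear_translate norm_unitary_translate[OF AB]]) measurable
  also have "\<dots> = (\<integral>\<^sup>+ Z. f Z \<partial>bergman_measure lam)"
    by (subst nn_integral_bergman_measure) simp_all
  finally show ?thesis .
qed

section \<open>The Bergman space\<close>

text \<open>Functions on the domain are represented by their extension by zero.\<close>

definition restrict_domain :: "('n::finite cmatrix \<Rightarrow> complex) \<Rightarrow> 'n cmatrix \<Rightarrow> complex"
  where "restrict_domain p Z = (if Z \<in> cartan_domain then p Z else 0)"

lemma holomorphic_mat_on_restrict_domain: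
  fixes p :: "'n::finite cmatrix \<Rightarrow> complex"
  assumes "holomorphic_mat_on p cartan_domain"
  shows "holomorphic_mat_on (restrict_domain p) cartan_domain"
proof (rule holomorphic_mat_onI)
  fix Z :: "'n cmatrix" assume Z: "Z \<in> cartan_domain"
  show "(restrict_domain p has_derivative frechet_derivative p (at Z)) (at Z)"
    using holomorphic_mat_onD(1)[OF assms Z]
    by (rule has_derivative_transform_within_open[OF _ open_cartan_domain Z]) (simp add: restrict_domain_def)
  show "frechet_derivative p (at Z) (cscale c W) = c * frechet_derivative p (at Z) W" for c W
    by (rule holomorphic_mat_onD(2)[OF assms Z])
qed

lemma holomorphic_mat_on_hpoly: "hpoly k p \<Longrightarrow> holomorphic_mat_on p D"
  by (metis hpoly_has_derivative holomorphic_mat_onI)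

lemma holomorphic_mat_on_add:
  assumes "holomorphic_mat_on f D" "holomorphic_mat_on g D"
  shows "holomorphic_mat_on (\<lambda>Z. f Z + g Z) D"
  by (rule holomorphic_mat_onI[where f' = "\<lambda>Z W. frechet_derivative f (at Z) W + frechet_derivative g (at Z) W"])
     (auto intro: has_derivative_add holomorphic_mat_onD assms
       simp: holomorphic_mat_onD(2)[OF assms(1)] holomorphic_mat_onD(2)[OF assms(2)] distrib_left)

lemma holomorphic_mat_on_cmult:
  assumes "holomorphic_mat_on f D"
  shows "holomorphic_mat_on (\<lambda>Z. c * f Z) D"
  by (rule holomorphic_mat_onI[where f' = "\<lambda>Z W. c * frechet_derivative f (at Z) W"])
     (auto intro: has_derivative_mult_right holomorphic_mat_onD assms
       simp: holomorphic_mat_onD(2)[OF assms] mult.left_commute)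

lemma holomorphic_mat_on_translate:
  fixes f :: "'n::finite cmatrix \<Rightarrow> complex"
  assumes f: "holomorphic_mat_on f cartan_domain" and AB: "A \<in> unitary_group" "B \<in> unitary_group"
  shows "holomorphic_mat_on (\<lambda>Z. f (A ** Z ** B)) cartan_domain"
proof (rule holomorphic_mat_onI)
  fix Z :: "'n cmatrix" assume Z: "Z \<in> cartan_domain"
  note ABZ = unitary_translate_in_cartan_domain[OF Z AB]
  have "((\<lambda>Z. A ** Z ** B) has_derivative (\<lambda>Z. A ** Z ** B)) (at Z)"
    using linear_translate linear_conv_bounded_linear bounded_linear_imp_has_derivative by blast
  from has_derivative_compose[OF this holomorphic_mat_onD(1)[OF f ABZ]]
  show "((\<lambda>Z. f (A ** Z ** B)) has_derivative (\<lambda>W. frechet_derivative f (at (A ** Z ** B)) (A ** W ** B))) (at Z)" .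
  show "frechet_derivative f (at (A ** Z ** B)) (A ** cscale c W ** B)
      = c * frechet_derivative f (at (A ** Z ** B)) (A ** W ** B)" for c W
    by (simp add: holomorphic_mat_onD(2)[OF f ABZ])
qed

lemma borel_measurable_holomorphic_off_zero:
  fixes f :: "'n::finite cmatrix \<Rightarrow> complex"
  assumes "holomorphic_mat_on f cartan_domain" "\<And>Z. Z \<notin> cartan_domain \<Longrightarrow> f Z = 0"
  shows "f \<in> borel_measurable borel"
proof -
  have "(\<lambda>Z. indicator cartan_domain Z *\<^sub>R f Z) \<in> borel_measurable borel"
    using assms(1) by (intro borel_measurable_continuous_on_indicator holomorphic_mat_on_continuous) auto
  moreover have "(\<lambda>Z. indicator cartan_domain Z *\<^sub>R f Z) = f"
    using assms(2) by (auto simp: indicator_def fun_eq_iff)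
  ultimately show ?thesis by simp
qed

lemma bergman_spaceI:
  fixes f :: "'n::finite cmatrix \<Rightarrow> complex"
  assumes "holomorphic_mat_on f cartan_domain" "\<And>Z. Z \<notin> cartan_domain \<Longrightarrow> f Z = 0" "bnorm2 lam f < \<infinity>"
  shows "f \<in> bergman_space lam"
proof -
  have [measurable]: "f \<in> borel_measurable borel"
    by (rule borel_measurable_holomorphic_off_zero[OF assms(1,2)])
  have "integrable (bergman_measure lam) (\<lambda>Z. (cmod (f Z))\<^sup>2)"
    using assms(3) by (intro integrableI_bounded) (auto simp: bnorm2_def)
  then show ?thesis using assms(1,2) by (simp add: bergman_space_def square_integrable_def)
qed

lemma bergman_spaceD:
  fixes f :: "'n::finite cmatrix \<Rightarrow> complex"
  assumes "f \<in> bergman_space lam"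
  shows "holomorphic_mat_on f cartan_domain" "\<And>Z. Z \<notin> cartan_domain \<Longrightarrow> f Z = 0"
    "bnorm2 lam f < \<infinity>" "f \<in> borel_measurable borel" "bnorm2 lam f = ennreal ((bergman_norm lam f)\<^sup>2)"
proof -
  show 1: "holomorphic_mat_on f cartan_domain" "\<And>Z. Z \<notin> cartan_domain \<Longrightarrow> f Z = 0"
    using assms by (auto simp: bergman_space_def)
  then show "f \<in> borel_measurable borel" by (rule borel_measurable_holomorphic_off_zero)
  have int: "integrable (bergman_measure lam) (\<lambda>Z. (cmod (f Z))\<^sup>2)"
    using assms by (simp add: bergman_space_def square_integrable_def)
  have eq: "bnorm2 lam f = ennreal (LINT Z|bergman_measure lam. (cmod (f Z))\<^sup>2)"
    unfolding bnorm2_def by (rule nn_integral_eq_integral[OF int]) simp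
  then show "bnorm2 lam f < \<infinity>" by simp
  show "bnorm2 lam f = ennreal ((bergman_norm lam f)\<^sup>2)"
    unfolding eq bergman_norm_def by (subst real_sqrt_pow2) (auto intro!: integral_nonneg_AE)
qed

lemma bnorm2_add_le:
  fixes f g :: "'n::finite cmatrix \<Rightarrow> complex"
  assumes [measurable]: "f \<in> borel_measurable borel" "g \<in> borel_measurable borel"
  shows "bnorm2 lam (\<lambda>Z. f Z + g Z) \<le> 2 * bnorm2 lam f + 2 * bnorm2 lam g"
proof -
  have "bnorm2 lam (\<lambda>Z. f Z + g Z) \<le> (\<integral>\<^sup>+ Z. 2 * ennreal ((cmod (f Z))\<^sup>2) + 2 * ennreal ((cmod (g Z))\<^sup>2) \<partial>bergman_measure lam)"
    unfolding bnorm2_def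
  proof (rule nn_integral_mono)
    fix Z :: "'n cmatrix"
    have "(cmod (f Z + g Z))\<^sup>2 \<le> (cmod (f Z) + cmod (g Z))\<^sup>2"
      by (intro power_mono norm_triangle_ineq) simp
    also have "\<dots> \<le> 2 * (cmod (f Z))\<^sup>2 + 2 * (cmod (g Z))\<^sup>2"
      using sum_squares_bound[of "cmod (f Z)" "cmod (g Z)"] by (simp add: power2_sum)
    finally have "ennreal ((cmod (f Z + g Z))\<^sup>2) \<le> ennreal (2 * (cmod (f Z))\<^sup>2 + 2 * (cmod (g Z))\<^sup>2)"
      by (rule ennreal_leI)
    then show "ennreal ((cmod (f Z + g Z))\<^sup>2) \<le> 2 * ennreal ((cmod (f Z))\<^sup>2) + 2 * ennreal ((cmod (g Z))\<^sup>2)"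
      by (simp add: ennreal_mult' ennreal_plus)
  qed
  also have "\<dots> = 2 * bnorm2 lam f + 2 * bnorm2 lam g"
    unfolding bnorm2_def by (subst nn_integral_add) (simp_all add: nn_integral_cmult)
  finally show ?thesis .
qed

lemma bnorm2_cmult:
  fixes f :: "'n::finite cmatrix \<Rightarrow> complex"
  assumes [measurable]: "f \<in> borel_measurable borel"
  shows "bnorm2 lam (\<lambda>Z. c * f Z) = ennreal ((cmod c)\<^sup>2) * bnorm2 lam f"
  unfolding bnorm2_def by (subst nn_integral_cmult[symmetric])
    (simp_all add: norm_mult power_mult_distrib ennreal_mult)

lemma bergman_space_add:
  assumes "f \<in> bergman_space lam" "g \<in> bergman_space lam"
  shows "(\<lambda>Z. f Z + g Z) \<in> bergman_space lam"
proof (rule bergman_spaceI)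
  note f = bergman_spaceD[OF assms(1)] and g = bergman_spaceD[OF assms(2)]
  show "holomorphic_mat_on (\<lambda>Z. f Z + g Z) cartan_domain"
    by (intro holomorphic_mat_on_add f g)
  show "f Z + g Z = 0" if "Z \<notin> cartan_domain" for Z using f(2) g(2) that by simp
  have "2 * bnorm2 lam f + 2 * bnorm2 lam g < \<infinity>"
    using f(3) g(3) by (simp add: ennreal_mult_less_top)
  then show "bnorm2 lam (\<lambda>Z. f Z + g Z) < \<infinity>"
    by (rule le_less_trans[OF bnorm2_add_le[OF f(4) g(4)]])
qed

lemma bergman_space_cmult:
  assumes "f \<in> bergman_space lam"
  shows "(\<lambda>Z. c * f Z) \<in> bergman_space lam"
proof (rule bergman_spaceI)
  note f = bergman_spaceD[OF assms]
  show "holomorphic_mat_on (\<lambda>Z. c * f Z) cartan_domain" by (intro holomorphic_mat_on_cmult f)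
  show "c * f Z = 0" if "Z \<notin> cartan_domain" for Z using f(2) that by simp
  show "bnorm2 lam (\<lambda>Z. c * f Z) < \<infinity>"
    using f(3) by (simp add: bnorm2_cmult[OF f(4)] ennreal_mult_less_top)
qed

lemma bergman_space_diff:
  assumes "f \<in> bergman_space lam" "g \<in> bergman_space lam"
  shows "(\<lambda>Z. f Z - g Z) \<in> bergman_space lam"
  using bergman_space_add[OF assms(1) bergman_space_cmult[OF assms(2), of "-1"]] by simp

lemma bergman_space_zero: "(\<lambda>Z. 0) \<in> bergman_space lam"
  by (rule bergman_spaceI)
     (auto simp: bnorm2_def holomorphic_mat_on_def intro!: exI[of _ "\<lambda>_. 0"])

lemma bergman_space_sum:
  assumes "\<And>a. a \<in> A \<Longrightarrow> f a \<in> bergman_space lam"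
  shows "(\<lambda>Z. \<Sum>a\<in>A. f a Z) \<in> bergman_space lam"
  using assms by (induction A rule: infinite_finite_induct) (auto intro: bergman_space_zero bergman_space_add)

lemma bnorm2_translate:
  assumes "f \<in> bergman_space lam" "A \<in> unitary_group" "B \<in> unitary_group"
  shows "bnorm2 lam (\<lambda>Z. f (A ** Z ** B)) = bnorm2 lam f"
proof -
  have [measurable]: "f \<in> borel_measurable borel" by (rule bergman_spaceD(4)[OF assms(1)])
  show ?thesis unfolding bnorm2_def
    by (rule nn_integral_bergman_translate[of "\<lambda>Z. ennreal ((cmod (f Z))\<^sup>2)"]) (use assms in measurable)
qed

lemma bergman_space_translate:
  assumes "f \<in> bergman_space lam" "A \<in> unitary_group" "B \<in> unitary_group"
  shows "(\<lambda>Z. f (A ** Z ** B)) \<in> bergman_space lam"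
  using bergman_spaceD[OF assms(1)] assms
  by (intro bergman_spaceI holomorphic_mat_on_translate)
     (auto simp: bnorm2_translate unitary_translate_in_cartan_domain_iff)

lemma restrict_hpoly_in_bergman_space:
  fixes p :: "'n::finite cmatrix \<Rightarrow> complex"
  assumes lam: "lam > 2 * real CARD('n) - 1" and p: "hpoly k p"
  shows "restrict_domain p \<in> bergman_space lam"
proof (rule bergman_spaceI)
  have hol: "holomorphic_mat_on p D" for D by (rule holomorphic_mat_on_hpoly[OF p])
  then show "holomorphic_mat_on (restrict_domain p) cartan_domain"
    by (rule holomorphic_mat_on_restrict_domain)
  show "restrict_domain p Z = 0" if "Z \<notin> cartan_domain" for Z using that by (simp add: restrict_domain_def)
  have "compact (closure (cartan_domain :: 'n cmatrix set))"
    using bounded_cartan_domain by (simp add: compact_closure)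
  then have "bounded (p ` closure cartan_domain)"
    by (intro compact_imp_bounded compact_continuous_image holomorphic_mat_on_continuous hol)
  then obtain C where C: "\<And>Z. Z \<in> closure cartan_domain \<Longrightarrow> cmod (p Z) \<le> C"
    unfolding bounded_iff by blast
  have "bnorm2 lam (restrict_domain p) \<le> (\<integral>\<^sup>+ (Z :: 'n cmatrix). ennreal (C\<^sup>2) \<partial>bergman_measure lam)"
    unfolding bnorm2_def
  proof (intro nn_integral_mono ennreal_leI)
    fix Z :: "'n cmatrix"
    show "(cmod (restrict_domain p Z))\<^sup>2 \<le> C\<^sup>2"
      using C[of Z] closure_subset[of "cartan_domain :: 'n cmatrix set"]
      by (auto simp: restrict_domain_def intro!: power_mono)
  qed
  also have "\<dots> < \<infinity>"
    using bergman_measure_finite[OF lam] by (simp add: ennreal_mult_less_top)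
  finally show "bnorm2 lam (restrict_domain p) < \<infinity>" .
qed

text \<open>The weight is positive, and a nonempty open set has positive Lebesgue measure.\<close>

lemma bergman_space_eq_zero:
  fixes g :: "'n::finite cmatrix \<Rightarrow> complex"
  assumes lam: "lam > 2 * real CARD('n) - 1" and g: "g \<in> bergman_space lam" and z: "bnorm2 lam g = 0"
  shows "g = (\<lambda>_. 0)"
proof (rule ccontr)
  note [measurable] = bergman_spaceD(4)[OF g]
  assume "g \<noteq> (\<lambda>_. 0)"
  then obtain Z where Z: "g Z \<noteq> 0" by auto
  define U where "U = {Z \<in> cartan_domain. g Z \<noteq> 0}"
  have "open U"
  proof -
    have "U = cartan_domain \<inter> g -` (- {0})" by (auto simp: U_def)
    moreover have "open (cartan_domain \<inter> g -` (- {0}))"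
      using holomorphic_mat_on_continuous[OF bergman_spaceD(1)[OF g]] open_cartan_domain
      by (intro continuous_open_preimage) auto
    ultimately show ?thesis by simp
  qed
  moreover have "Z \<in> U" using Z bergman_spaceD(2)[OF g] by (auto simp: U_def)
  ultimately have "emeasure lborel U \<noteq> 0" by (intro emeasure_lborel_open_nonzero) auto
  let ?h = "\<lambda>Z. ennreal (bergman_const TYPE('n) lam * indicator cartan_domain Z * bergman_weight lam Z) * ennreal ((cmod (g Z))\<^sup>2)"
  have "(\<integral>\<^sup>+ Z. ?h Z \<partial>lborel) = 0"
    using z unfolding bnorm2_def by (subst (asm) nn_integral_bergman_measure) simp_all
  then have "emeasure lborel {Z \<in> space lborel. ?h Z \<noteq> 0} = 0"
    by (subst (asm) nn_integral_0_iff) auto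
  moreover have "{Z \<in> space lborel. ?h Z \<noteq> 0} = U"
    using bergman_const_pos[OF lam] bergman_weight_pos[of _ lam]
    by (auto simp: U_def indicator_def ennreal_eq_0_iff not_le intro!: mult_pos_pos)
  ultimately show False using \<open>emeasure lborel U \<noteq> 0\<close> by simp
qed

lemma scalar_unitary: "cmod c = 1 \<Longrightarrow> (cscale c (mat 1) :: 'n::finite cmatrix) \<in> unitary_group"
proof -
  assume c: "cmod c = 1"
  then have cc: "cnj c * c = 1" by (simp add: mult.commute flip: complex_norm_square)
  have "conj_transpose (cscale c (mat 1) :: 'n cmatrix) = cscale (cnj c) (mat 1)"
    by (simp add: conj_transpose_def vec_eq_iff mat_def)
  then show ?thesis by (simp add: unitary_group_def cc mult.commute[of c])
qed

lemma bnorm2_rotate: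
  assumes "f \<in> bergman_space lam" "cmod c = 1"
  shows "bnorm2 lam (\<lambda>Z. f (cscale c Z)) = bnorm2 lam f"
  using bnorm2_translate[OF assms(1) scalar_unitary[OF assms(2)] unitary_group_mat1] by simp

section \<open>Density of polynomials\<close>

text \<open>Orthogonality of polynomials of different degrees, obtained by averaging over rotations by \<open>N\<close>-th
roots of unity with \<open>N\<close> larger than all degrees involved.\<close>

lemma bnorm2_sum_hpoly:
  fixes p :: "nat \<Rightarrow> 'n::finite cmatrix \<Rightarrow> complex"
  assumes lam: "lam > 2 * real CARD('n) - 1" and p: "\<And>k. hpoly k (p k)" and F: "finite F"
  shows "bnorm2 lam (\<lambda>Z. \<Sum>k\<in>F. restrict_domain (p k) Z) = (\<Sum>k\<in>F. bnorm2 lam (restrict_domain (p k)))"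
proof -
  obtain N where N: "F \<subseteq> {..<N}" "N > 0"
    using F by (metis finite_nat_iff_bounded gr0I lessThan_0 subset_empty zero_less_one lessThan_subset_iff subset_trans le0)
  define s where "s Z = (\<Sum>k\<in>F. restrict_domain (p k) Z)" for Z
  have r: "restrict_domain (p k) \<in> bergman_space lam" for k
    by (rule restrict_hpoly_in_bergman_space[OF lam p])
  note [measurable] = bergman_spaceD(4)[OF r]
  have s: "s \<in> bergman_space lam" unfolding s_def by (intro bergman_space_sum r)
  note [measurable] = bergman_spaceD(4)[OF s]
  define b where "b Z k = (if k \<in> F then restrict_domain (p k) Z else 0)" for Z k
  let ?w = "\<lambda>j. cis (2 * pi * real j / real N)"
  have rot: "restrict_domain (p k) (cscale c Z) = restrict_domain (p k) Z * c ^ k" if "cmod c = 1" for c Z k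
    using unitary_translate_in_cartan_domain_iff[OF scalar_unitary[OF that] unitary_group_mat1, of Z]
    by (simp add: restrict_domain_def hpoly_homogeneous[OF p])
  have "(\<Sum>j<N. (cmod (s (cscale (?w j) Z)))\<^sup>2) = real N * (\<Sum>k\<in>F. (cmod (restrict_domain (p k) Z))\<^sup>2)" for Z
  proof -
    have "s (cscale (?w j) Z) = (\<Sum>k<N. b Z k * ?w j ^ k)" for j
      unfolding s_def b_def using N by (intro sum.mono_neutral_cong_left) (auto simp: rot)
    then have "(\<Sum>j<N. (cmod (s (cscale (?w j) Z)))\<^sup>2) = real N * (\<Sum>k<N. (cmod (b Z k))\<^sup>2)"
      using discrete_Parseval[OF N(2), of "b Z"] by simp
    also have "(\<Sum>k<N. (cmod (b Z k))\<^sup>2) = (\<Sum>k\<in>F. (cmod (restrict_domain (p k) Z))\<^sup>2)"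
      unfolding b_def using N by (intro sum.mono_neutral_cong_right) auto
    finally show ?thesis .
  qed
  then have eq: "(\<Sum>j<N. ennreal ((cmod (s (cscale (?w j) Z)))\<^sup>2))
      = of_nat N * (\<Sum>k\<in>F. ennreal ((cmod (restrict_domain (p k) Z))\<^sup>2))" for Z
    by (simp add: sum_ennreal ennreal_mult ennreal_of_nat_eq_real_of_nat sum_nonneg flip: ennreal_mult)
  have rot_s: "(\<lambda>Z. s (cscale (?w j) Z)) \<in> borel_measurable borel" for j
    using bergman_spaceD(4)[OF bergman_space_translate[OF s scalar_unitary unitary_group_mat1, of "?w j"]] by simp
  note [measurable] = rot_s
  have "of_nat N * bnorm2 lam s = (\<Sum>j<N. bnorm2 lam (\<lambda>Z. s (cscale (?w j) Z)))"
    by (simp add: bnorm2_rotate[OF s])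
  also have "\<dots> = (\<integral>\<^sup>+ Z. (\<Sum>j<N. ennreal ((cmod (s (cscale (?w j) Z)))\<^sup>2)) \<partial>bergman_measure lam)"
    unfolding bnorm2_def by (rule nn_integral_sum[symmetric]) measurable
  also have "\<dots> = of_nat N * (\<Sum>k\<in>F. bnorm2 lam (restrict_domain (p k)))"
    unfolding eq bnorm2_def by (subst nn_integral_cmult) (simp_all add: nn_integral_sum del: sum_ennreal)
  finally have "of_nat N * bnorm2 lam s = of_nat N * (\<Sum>k\<in>F. bnorm2 lam (restrict_domain (p k)))" .
  then show ?thesis using N(2) unfolding s_def[symmetric]
    by (simp add: ennreal_mult_cancel_left ennreal_of_nat_eq_real_of_nat)
qed

text \<open>The pointwise inequality \<open>sum_squares_le_root_averages\<close> is integrated with Fatou's lemma; each average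
has integral \<open>bnorm2 lam f\<close> by rotation invariance.\<close>

lemma Bessel_taylor_parts:
  fixes f :: "'n::finite cmatrix \<Rightarrow> complex"
  assumes lam: "lam > 2 * real CARD('n) - 1" and f: "f \<in> bergman_space lam"
  shows "(\<Sum>k<K. bnorm2 lam (restrict_domain (taylor_part k f))) \<le> 4 * bnorm2 lam f"
proof -
  note hol = bergman_spaceD(1)[OF f]
  have t: "hpoly k (taylor_part k f)" for k
    by (rule hpoly_taylor_part[OF open_cartan_domain zero_in_cartan_domain hol])
  have r: "restrict_domain (taylor_part k f) \<in> bergman_space lam" for k
    by (rule restrict_hpoly_in_bergman_space[OF lam t])
  note [measurable] = bergman_spaceD(4)[OF r]
  let ?w = "\<lambda>N j. cis (2 * pi * real j / real N)"
  have rot_f: "(\<lambda>Z. f (cscale (?w N j) Z)) \<in> borel_measurable borel" for j N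
    using bergman_spaceD(4)[OF bergman_space_translate[OF f scalar_unitary unitary_group_mat1, of "?w N j"]] by simp
  note [measurable] = rot_f
  define A where "A N Z = ennreal (4 / real N) * (\<Sum>j<N. ennreal ((cmod (f (cscale (?w N j) Z)))\<^sup>2))" for N Z
  have A_int: "(\<integral>\<^sup>+ Z. A N Z \<partial>bergman_measure lam) \<le> 4 * bnorm2 lam f" for N
  proof (cases "N = 0")
    case False
    have "(\<integral>\<^sup>+ Z. A N Z \<partial>bergman_measure lam) = ennreal (4 / real N) * (\<Sum>j<N. bnorm2 lam (\<lambda>Z. f (cscale (?w N j) Z)))"
      unfolding A_def bnorm2_def by (subst nn_integral_cmult) (simp_all add: nn_integral_sum del: sum_ennreal)
    also have "\<dots> = ennreal (4 / real N) * (ennreal (real N) * bnorm2 lam f)"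
      by (simp add: bnorm2_rotate[OF f] ennreal_of_nat_eq_real_of_nat)
    also have "\<dots> = 4 * bnorm2 lam f"
      using False by (simp add: mult.assoc[symmetric] flip: ennreal_mult)
    finally show ?thesis by simp
  qed (simp add: A_def)
  have "(\<Sum>k<K. bnorm2 lam (restrict_domain (taylor_part k f)))
      = (\<integral>\<^sup>+ Z. (\<Sum>k<K. ennreal ((cmod (restrict_domain (taylor_part k f) Z))\<^sup>2)) \<partial>bergman_measure lam)"
    unfolding bnorm2_def by (rule nn_integral_sum[symmetric]) measurable
  also have "\<dots> \<le> (\<integral>\<^sup>+ Z. liminf (\<lambda>N. A N Z) \<partial>bergman_measure lam)"
  proof (rule nn_integral_mono_AE, use AE_bergman_measure in eventually_elim)
    fix Z :: "'n cmatrix" assume Z: "Z \<in> cartan_domain"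
    obtain r where r: "r > 1" "\<And>c. cmod c < r \<Longrightarrow> cscale c Z \<in> cartan_domain"
      using cscale_in_cartan_domain_larger[OF Z] by blast
    have "(\<lambda>z. f (cscale z Z)) holomorphic_on ball 0 r"
      unfolding holomorphic_on_open[OF open_ball]
      using holomorphic_on_ray[OF open_cartan_domain r(2) hol] by (metis mem_ball_0)
    then have "summable (\<lambda>k. taylor_part k f Z * of_real ((1 + r) / 2) ^ k)"
      using holomorphic_power_series[of "\<lambda>z. f (cscale z Z)" 0 r "of_real ((1 + r) / 2)"] r(1)
      by (auto simp: taylor_part_def sums_iff simp del: of_real_divide of_real_add)
    from powser_insidea[OF this, of 1] r(1)
    have "summable (\<lambda>k. cmod (taylor_part k f Z))" by (simp del: of_real_divide of_real_add)
    then have "\<forall>\<^sub>F N in sequentially. (\<Sum>k<K. (cmod (taylor_part k f Z))\<^sup>2)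
        \<le> 4 * ((\<Sum>j<N. (cmod (f (cscale (?w N j) Z)))\<^sup>2) / real N)"
      by (rule sum_squares_le_root_averages) (intro taylor_part_sums[OF hol Z], simp)
    then have "\<forall>\<^sub>F N in sequentially. (\<Sum>k<K. ennreal ((cmod (restrict_domain (taylor_part k f) Z))\<^sup>2)) \<le> A N Z"
    proof eventually_elim
      case (elim N)
      then show ?case
        using Z by (simp add: A_def restrict_domain_def sum_ennreal sum_nonneg flip: ennreal_mult)
    qed
    then show "(\<Sum>k<K. ennreal ((cmod (restrict_domain (taylor_part k f) Z))\<^sup>2)) \<le> liminf (\<lambda>N. A N Z)"
      by (rule Liminf_bounded)
  qed
  also have "\<dots> \<le> liminf (\<lambda>N. \<integral>\<^sup>+ Z. A N Z \<partial>bergman_measure lam)"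
    by (rule nn_integral_liminf) (simp add: A_def)
  also have "\<dots> \<le> liminf (\<lambda>N. 4 * bnorm2 lam f)"
    by (intro Liminf_mono always_eventually allI A_int)
  also have "\<dots> = 4 * bnorm2 lam f" by (simp add: Liminf_const)
  finally show ?thesis .
qed

text \<open>On the domain the tail is the pointwise limit of the finite sums over \<open>{K..<N}\<close>. By Fatou's lemma
and orthogonality its squared norm is at most the tail of the series of the squared norms of the components, which converges
by the Bessel inequality.\<close>

lemma taylor_tail_tendsto_0:
  fixes f :: "'n::finite cmatrix \<Rightarrow> complex"
  assumes lam: "lam > 2 * real CARD('n) - 1" and f: "f \<in> bergman_space lam"
  shows "(\<lambda>K. bnorm2 lam (\<lambda>Z. f Z - (\<Sum>k<K. restrict_domain (taylor_part k f) Z))) \<longlonglongrightarrow> 0"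
proof -
  note hol = bergman_spaceD(1)[OF f]
  have t: "hpoly k (taylor_part k f)" for k
    by (rule hpoly_taylor_part[OF open_cartan_domain zero_in_cartan_domain hol])
  have r: "restrict_domain (taylor_part k f) \<in> bergman_space lam" for k
    by (rule restrict_hpoly_in_bergman_space[OF lam t])
  note [measurable] = bergman_spaceD(4)[OF r]
  define a where "a k = enn2real (bnorm2 lam (restrict_domain (taylor_part k f)))" for k
  have a: "bnorm2 lam (restrict_domain (taylor_part k f)) = ennreal (a k)" "a k \<ge> 0" for k
    using bergman_spaceD(3)[OF r] by (simp_all add: a_def)
  have "summable a"
  proof (rule bounded_imp_summable)
    show "0 \<le> a k" for k by (rule a)
    fix K
    have "ennreal (\<Sum>k\<le>K. a k) \<le> 4 * bnorm2 lam f"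
      using Bessel_taylor_parts[OF lam f, of "Suc K"] by (simp add: a sum_ennreal lessThan_Suc_atMost)
    also have "4 * bnorm2 lam f = ennreal (4 * enn2real (bnorm2 lam f))"
      using bergman_spaceD(3)[OF f] by (simp add: ennreal_mult)
    finally show "(\<Sum>k\<le>K. a k) \<le> 4 * enn2real (bnorm2 lam f)" by simp
  qed
  define \<tau> where "\<tau> K = (\<Sum>k. a (k + K))" for K
  have \<tau>: "\<tau> \<longlonglongrightarrow> 0" unfolding \<tau>_def by (rule suminf_exist_split2[OF \<open>summable a\<close>])
  have le: "bnorm2 lam (\<lambda>Z. f Z - (\<Sum>k<K. restrict_domain (taylor_part k f) Z)) \<le> ennreal (\<tau> K)" for K
  proof -
    let ?s = "\<lambda>N Z. \<Sum>k\<in>{K..<N}. restrict_domain (taylor_part k f) Z"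
    have "bnorm2 lam (\<lambda>Z. f Z - (\<Sum>k<K. restrict_domain (taylor_part k f) Z))
        \<le> (\<integral>\<^sup>+ Z. liminf (\<lambda>N. ennreal ((cmod (?s N Z))\<^sup>2)) \<partial>bergman_measure lam)"
      unfolding bnorm2_def
    proof (rule nn_integral_mono_AE, use AE_bergman_measure in eventually_elim)
      fix Z :: "'n cmatrix" assume Z: "Z \<in> cartan_domain"
      have "(\<lambda>N. \<Sum>k<N. taylor_part k f Z) \<longlonglongrightarrow> f Z"
        using taylor_part_sums[OF hol Z, of 1] by (simp add: sums_def)
      then have "(\<lambda>N. (\<Sum>k<N. taylor_part k f Z) - (\<Sum>k<K. taylor_part k f Z)) \<longlonglongrightarrow> f Z - (\<Sum>k<K. taylor_part k f Z)"
        by (intro tendsto_intros)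
      moreover have "\<forall>\<^sub>F N in sequentially. (\<Sum>k<N. taylor_part k f Z) - (\<Sum>k<K. taylor_part k f Z) = ?s N Z"
        using eventually_ge_at_top[of K]
      proof eventually_elim
        case (elim N)
        then show ?case using Z sum_diff_nat_ivl[of 0 K N "\<lambda>k. taylor_part k f Z"]
          by (simp add: restrict_domain_def lessThan_atLeast0)
      qed
      ultimately have "(\<lambda>N. ?s N Z) \<longlonglongrightarrow> f Z - (\<Sum>k<K. taylor_part k f Z)"
        by (rule Lim_transform_eventually)
      then have "(\<lambda>N. ennreal ((cmod (?s N Z))\<^sup>2)) \<longlonglongrightarrow> ennreal ((cmod (f Z - (\<Sum>k<K. taylor_part k f Z)))\<^sup>2)"
        by (intro tendsto_intros)
      from lim_imp_Liminf[OF _ this] show "ennreal ((cmod (f Z - (\<Sum>k<K. restrict_domain (taylor_part k f) Z)))\<^sup>2)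
          \<le> liminf (\<lambda>N. ennreal ((cmod (?s N Z))\<^sup>2))"
        using Z by (simp add: restrict_domain_def)
    qed
    also have "\<dots> \<le> liminf (\<lambda>N. \<integral>\<^sup>+ Z. ennreal ((cmod (?s N Z))\<^sup>2) \<partial>bergman_measure lam)"
      by (rule nn_integral_liminf) measurable
    also have "\<dots> \<le> liminf (\<lambda>N. ennreal (\<tau> K))"
    proof (intro Liminf_mono always_eventually allI)
      fix N
      have "(\<integral>\<^sup>+ Z. ennreal ((cmod (?s N Z))\<^sup>2) \<partial>bergman_measure lam) = ennreal (\<Sum>k\<in>{K..<N}. a k)"
        unfolding bnorm2_def[symmetric] using bnorm2_sum_hpoly[OF lam t, of "{K..<N}"] by (simp add: a)
      also have "(\<Sum>k\<in>{K..<N}. a k) \<le> \<tau> K"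
      proof (cases "K \<le> N")
        case True
        then have "(\<Sum>k\<in>{K..<N}. a k) = (\<Sum>k<N - K. a (k + K))"
          using sum.shift_bounds_nat_ivl[of a 0 K "N - K"] by (simp add: lessThan_atLeast0)
        also have "\<dots> \<le> \<tau> K" unfolding \<tau>_def
          using \<open>summable a\<close> a by (intro sum_le_suminf summable_ignore_initial_segment) auto
        finally show ?thesis .
      next
        case False
        then show ?thesis unfolding \<tau>_def
          using \<open>summable a\<close> a by (simp add: suminf_nonneg summable_ignore_initial_segment)
      qed
      finally show "(\<integral>\<^sup>+ Z. ennreal ((cmod (?s N Z))\<^sup>2) \<partial>bergman_measure lam) \<le> ennreal (\<tau> K)"
        by (simp add: ennreal_leI)
    qed
    also have "\<dots> = ennreal (\<tau> K)" by (simp add: Liminf_const)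
    finally show ?thesis .
  qed
  have "(\<lambda>K. ennreal (\<tau> K)) \<longlonglongrightarrow> 0" using tendsto_ennrealI[OF \<tau>] by simp
  then show ?thesis
    by (rule tendsto_sandwich[where f = "\<lambda>_. 0", rotated 3]) (auto simp: le)
qed

text \<open>Comparing components of degree \<open>m\<close> gives \<open>c ^ m * taylor_part m g Z = c ^ k * taylor_part m g Z\<close> for all \<open>c\<close> of
modulus one, so only the component of degree \<open>k\<close> survives.\<close>

lemma eigenfunction_eq_taylor_part:
  fixes g :: "'n::finite cmatrix \<Rightarrow> complex"
  assumes g: "holomorphic_mat_on g cartan_domain" "\<And>Z. Z \<notin> cartan_domain \<Longrightarrow> g Z = 0"
    and eig: "\<And>c Z. cmod c = 1 \<Longrightarrow> g (cscale c Z) = c ^ k * g Z"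
  shows "g = restrict_domain (taylor_part k g)"
proof
  fix Z
  have t: "hpoly m (taylor_part m g)" for m
    by (rule hpoly_taylor_part[OF open_cartan_domain zero_in_cartan_domain g(1)])
  show "g Z = restrict_domain (taylor_part k g) Z"
  proof (cases "Z \<in> cartan_domain")
    case Z: True
    have zero: "taylor_part m g Z = 0" if "m \<noteq> k" for m
    proof -
      \<comment> \<open>A scalar for which the two characters have opposite values.\<close>
      define d where "d = (if m < k then k - m else m - k)"
      define c where "c = cis (pi / real d)"
      have "c ^ d = -1" using that by (auto simp: c_def Complex.DeMoivre d_def)
      have cm: "c ^ m = - (c ^ k)"
      proof (cases "m < k")
        case True
        then have "c ^ k = c ^ m * c ^ d" by (simp add: d_def flip: power_add)
        then show ?thesis using \<open>c ^ d = -1\<close> by simp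
      next
        case False
        then have "c ^ m = c ^ k * c ^ d" by (simp add: d_def flip: power_add)
        then show ?thesis using \<open>c ^ d = -1\<close> by simp
      qed
      have c: "cmod c = 1" by (simp add: c_def)
      have hol: "(\<lambda>z. g (cscale z Z)) holomorphic_on ball 0 1"
        unfolding holomorphic_on_open[OF open_ball]
        using holomorphic_on_ray[OF open_cartan_domain cscale_in_cartan_domain[OF Z] g(1)]
        by (metis mem_ball_0 less_imp_le)
      have "c ^ m * taylor_part m g Z = taylor_part m g (cscale c Z)"
        by (simp add: hpoly_homogeneous[OF t])
      also have "\<dots> = (deriv ^^ m) (\<lambda>z. c ^ k * g (cscale z Z)) 0 / fact m"
        unfolding taylor_part_def by (simp add: eig[OF c, symmetric] mult.commute)
      also have "\<dots> = c ^ k * taylor_part m g Z"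
        by (simp add: higher_deriv_cmult[OF hol] taylor_part_def)
      finally have "2 * c ^ k * taylor_part m g Z = 0" unfolding cm by (simp add: algebra_simps)
      then show ?thesis by (simp add: c_def)
    qed
    have "(\<lambda>m. taylor_part m g Z) sums (\<Sum>m\<in>{k}. taylor_part m g Z)"
      by (rule sums_finite) (auto simp: zero)
    with taylor_part_sums[OF g(1) Z, of 1] have "g Z = taylor_part k g Z"
      by (simp add: sums_unique2)
    with Z show ?thesis by (simp add: restrict_domain_def)
  qed (simp add: restrict_domain_def g(2))
qed

text \<open>By homogeneity a polynomial is determined by its values near \<open>0\<close>.\<close>

lemma restrict_hpoly_inject:
  fixes p q :: "'n::finite cmatrix \<Rightarrow> complex"
  assumes "hpoly k p" "hpoly k q" "restrict_domain p = restrict_domain q"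
  shows "p = q"
proof
  fix Z :: "'n cmatrix"
  obtain e where e: "e > 0" "ball 0 e \<subseteq> (cartan_domain :: 'n cmatrix set)"
    using open_cartan_domain zero_in_cartan_domain open_contains_ball by blast
  \<comment> \<open>Small enough to move \<open>Z\<close> into the domain.\<close>
  define c where "c = complex_of_real (e / (2 * (norm Z + 1)))"
  define n where "n = norm Z + 1"
  have n: "n > 0" "norm Z < n" by (simp_all add: n_def add_nonneg_pos)
  have c: "c = complex_of_real (e / (2 * n))" by (simp add: c_def n_def)
  have "norm (cscale c Z) = e / (2 * n) * norm Z"
    unfolding norm_cscale c norm_of_real using e n by simp
  also have "\<dots> \<le> e / (2 * n) * n" using e n by (intro mult_left_mono) auto
  also have "\<dots> < e" using e n by simp
  finally have "cscale c Z \<in> cartan_domain" using e by auto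
  then have "p (cscale c Z) = q (cscale c Z)"
    using fun_cong[OF assms(3), of "cscale c Z"] by (simp add: restrict_domain_def)
  moreover have "c \<noteq> 0" using e n by (simp add: c)
  ultimately show "p Z = q Z" by (simp add: hpoly_homogeneous[OF assms(1)] hpoly_homogeneous[OF assms(2)])
qed

section \<open>Intertwining operators\<close>

lemma matrix_inv_unitary: "U \<in> unitary_group \<Longrightarrow> matrix_inv U = conj_transpose U"
proof -
  assume U: "U \<in> unitary_group"
  then have inv: "U ** conj_transpose U = mat 1" "conj_transpose U ** U = mat 1"
    by (simp_all add: unitary_group_def)
  show ?thesis
    unfolding matrix_inv_def
  proof (rule some_equality)
    fix X assume "U ** X = mat 1 \<and> X ** U = mat 1"
    then show "X = conj_transpose U"
      by (metis inv(2) matrix_mul_assoc matrix_mul_lid matrix_mul_rid)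
  qed (simp add: inv)
qed

lemma matrix_inv_mat1 [simp]: "matrix_inv (mat 1 :: 'n::finite cmatrix) = mat 1"
  using matrix_inv_unitary[OF unitary_group_mat1] by simp

lemma intertwiners_left_iff:
  "T \<in> intertwiners lam unitary_left \<longleftrightarrow> T \<in> bounded_ops lam \<and>
    (\<forall>U\<in>unitary_group. \<forall>f\<in>bergman_space lam. T (\<lambda>Z. f (U ** Z)) = (\<lambda>Z. T f (U ** Z)))"
  (is "?L \<longleftrightarrow> ?R")
proof
  assume L: ?L
  have "T (\<lambda>Z. f (U ** Z)) = (\<lambda>Z. T f (U ** Z))" if "U \<in> unitary_group" "f \<in> bergman_space lam" for U f
  proof -
    have "(conj_transpose U, mat 1) \<in> unitary_left" using that conj_transpose_unitary by (simp add: unitary_left_def)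
    with L that have "T (bergman_rep (conj_transpose U, mat 1) f) = bergman_rep (conj_transpose U, mat 1) (T f)"
      by (simp add: intertwiners_def)
    then show ?thesis using that
      by (simp add: bergman_rep_def matrix_inv_unitary conj_transpose_unitary)
  qed
  with L show ?R by (simp add: intertwiners_def)
next
  assume ?R
  then show ?L
    by (auto simp: intertwiners_def unitary_left_def bergman_rep_def matrix_inv_unitary conj_transpose_unitary)
qed

lemma intertwiners_right_iff:
  "T \<in> intertwiners lam unitary_right \<longleftrightarrow> T \<in> bounded_ops lam \<and>
    (\<forall>U\<in>unitary_group. \<forall>f\<in>bergman_space lam. T (\<lambda>Z. f (Z ** U)) = (\<lambda>Z. T f (Z ** U)))"
  by (auto simp: intertwiners_def unitary_right_def bergman_rep_def)

lemma bounded_opsD: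
  assumes "T \<in> bounded_ops lam" "f \<in> bergman_space lam"
  shows "T f \<in> bergman_space lam"
    and "g \<in> bergman_space lam \<Longrightarrow> T (\<lambda>Z. f Z + g Z) = (\<lambda>Z. T f Z + T g Z)"
    and "T (\<lambda>Z. c * f Z) = (\<lambda>Z. c * T f Z)"
  using assms by (auto simp: bounded_ops_def)

lemma bounded_ops_diff:
  assumes "T \<in> bounded_ops lam" "f \<in> bergman_space lam" "g \<in> bergman_space lam"
  shows "T (\<lambda>Z. f Z - g Z) = (\<lambda>Z. T f Z - T g Z)"
  using bounded_opsD(2)[OF assms(1,2) bergman_space_cmult[OF assms(3), of "-1"]]
    bounded_opsD(3)[OF assms(1,3), of "-1"] by simp

lemma bounded_ops_sum:
  fixes f :: "'a \<Rightarrow> 'n::finite cmatrix \<Rightarrow> complex"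
  assumes T: "T \<in> bounded_ops lam" and f: "\<And>a. a \<in> A \<Longrightarrow> f a \<in> bergman_space lam"
  shows "T (\<lambda>Z. \<Sum>a\<in>A. f a Z) = (\<lambda>Z. \<Sum>a\<in>A. T (f a) Z)"
proof -
  have zero: "T (\<lambda>Z. 0) = (\<lambda>Z. 0)"
    using bounded_opsD(3)[OF T bergman_space_zero, of 0] by simp
  show ?thesis using f
  proof (induction A rule: infinite_finite_induct)
    case (insert a A)
    then have "T (\<lambda>Z. f a Z + (\<Sum>a\<in>A. f a Z)) = (\<lambda>Z. T (f a) Z + T (\<lambda>Z. \<Sum>a\<in>A. f a Z) Z)"
      by (intro bounded_opsD(2)[OF T] bergman_space_sum) auto
    with insert show ?case by simp
  qed (simp_all add: zero)
qed

lemma bounded_ops_bnorm2: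
  assumes T: "T \<in> bounded_ops lam"
  obtains C where "C \<ge> 0" "\<And>f. f \<in> bergman_space lam \<Longrightarrow> bnorm2 lam (T f) \<le> ennreal C * bnorm2 lam f"
proof -
  obtain K where K: "\<And>f. f \<in> bergman_space lam \<Longrightarrow> bergman_norm lam (T f) \<le> K * bergman_norm lam f"
    using T unfolding bounded_ops_def by blast
  have nn: "bergman_norm lam f \<ge> 0" for f :: "'a cmatrix \<Rightarrow> complex"
    by (simp add: bergman_norm_def integral_nonneg_AE)
  have "bnorm2 lam (T f) \<le> ennreal (K\<^sup>2) * bnorm2 lam f" if f: "f \<in> bergman_space lam" for f
  proof -
    have "(bergman_norm lam (T f))\<^sup>2 \<le> (K * bergman_norm lam f)\<^sup>2"
      using K[OF f] nn by (intro power_mono) auto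
    then show ?thesis
      unfolding bergman_spaceD(5)[OF f] bergman_spaceD(5)[OF bounded_opsD(1)[OF T f]]
      by (simp add: power_mult_distrib ennreal_leI flip: ennreal_mult)
  qed
  then show ?thesis using that[of "K\<^sup>2"] by simp
qed

definition commutes_with_rotations ::
  "real \<Rightarrow> (('n::finite cmatrix \<Rightarrow> complex) \<Rightarrow> 'n cmatrix \<Rightarrow> complex) \<Rightarrow> bool"
  where "commutes_with_rotations lam T \<longleftrightarrow> (\<forall>c. cmod c = 1 \<longrightarrow>
    (\<forall>f\<in>bergman_space lam. T (\<lambda>Z. f (cscale c Z)) = (\<lambda>Z. T f (cscale c Z))))"

text \<open>The operator that \<open>T\<close> induces on polynomials of degree \<open>k\<close>, with functions on all matrices instead of
functions on the domain, so that evaluation at the identity, a boundary point of the domain, is possible.\<close>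

definition poly_action :: "nat \<Rightarrow> (('n::finite cmatrix \<Rightarrow> complex) \<Rightarrow> 'n cmatrix \<Rightarrow> complex)
    \<Rightarrow> ('n cmatrix \<Rightarrow> complex) \<Rightarrow> 'n cmatrix \<Rightarrow> complex"
  where "poly_action k T p = taylor_part k (T (restrict_domain p))"

lemma restrict_domain_translate:
  assumes "A \<in> unitary_group" "B \<in> unitary_group"
  shows "restrict_domain (\<lambda>Z. p (A ** Z ** B)) = (\<lambda>Z. restrict_domain p (A ** Z ** B))"
  using unitary_translate_in_cartan_domain_iff[OF assms] by (simp add: restrict_domain_def fun_eq_iff)

text \<open>The image of \<open>p\<close> under \<open>T\<close> is again an eigenfunction of the rotations of weight \<open>k\<close>.\<close>

lemma poly_action_represents:
  fixes T :: "('n::finite cmatrix \<Rightarrow> complex) \<Rightarrow> 'n cmatrix \<Rightarrow> complex"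
  assumes lam: "lam > 2 * real CARD('n) - 1" and T: "T \<in> bounded_ops lam"
    and rot: "commutes_with_rotations lam T"
    and p: "hpoly k p"
  shows "hpoly k (poly_action k T p)" "T (restrict_domain p) = restrict_domain (poly_action k T p)"
proof -
  note rp = restrict_hpoly_in_bergman_space[OF lam p]
  note g = bounded_opsD(1)[OF T rp]
  show "hpoly k (poly_action k T p)"
    unfolding poly_action_def
    by (rule hpoly_taylor_part[OF open_cartan_domain zero_in_cartan_domain bergman_spaceD(1)[OF g]])
  show "T (restrict_domain p) = restrict_domain (poly_action k T p)"
    unfolding poly_action_def
  proof (rule eigenfunction_eq_taylor_part[OF bergman_spaceD(1,2)[OF g]])
    fix c :: complex and Z :: "'n cmatrix" assume c: "cmod c = 1"
    have cD: "cscale c Z \<in> cartan_domain \<longleftrightarrow> Z \<in> cartan_domain" for Z :: "'n cmatrix"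
      using unitary_translate_in_cartan_domain_iff[OF scalar_unitary[OF c] unitary_group_mat1, of Z] by simp
    have "(\<lambda>Z. restrict_domain p (cscale c Z)) = (\<lambda>Z. c ^ k * restrict_domain p Z)"
      using cD by (simp add: restrict_domain_def hpoly_homogeneous[OF p] fun_eq_iff)
    moreover have "T (\<lambda>Z. restrict_domain p (cscale c Z)) = (\<lambda>Z. T (restrict_domain p) (cscale c Z))"
      using rot c rp unfolding commutes_with_rotations_def by blast
    ultimately have "(\<lambda>Z. T (restrict_domain p) (cscale c Z)) = (\<lambda>Z. c ^ k * T (restrict_domain p) Z)"
      by (metis bounded_opsD(3)[OF T rp])
    then show "T (restrict_domain p) (cscale c Z) = c ^ k * T (restrict_domain p) Z" by (rule fun_cong)
  qed
qed

lemma linear_on_hpoly_poly_action: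
  fixes T :: "('n::finite cmatrix \<Rightarrow> complex) \<Rightarrow> 'n cmatrix \<Rightarrow> complex"
  assumes lam: "lam > 2 * real CARD('n) - 1" and T: "T \<in> bounded_ops lam"
    and rot: "commutes_with_rotations lam T"
  shows "linear_on_hpoly k (poly_action k T)"
  unfolding linear_on_hpoly_def
proof (intro conjI allI impI)
  note act = poly_action_represents[OF lam T rot]
  note r = restrict_hpoly_in_bergman_space[OF lam]
  fix p q :: "'n cmatrix \<Rightarrow> complex" and c assume p: "hpoly k p"
  show "hpoly k (poly_action k T p)" by (rule act(1)[OF p])
  show "poly_action k T (\<lambda>Z. c * p Z) = (\<lambda>Z. c * poly_action k T p Z)"
  proof (rule restrict_hpoly_inject[where k = k])
    have "restrict_domain (\<lambda>Z. c * p Z) = (\<lambda>Z. c * restrict_domain p Z)"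
      by (simp add: restrict_domain_def fun_eq_iff)
    then have "restrict_domain (poly_action k T (\<lambda>Z. c * p Z)) = (\<lambda>Z. c * restrict_domain (poly_action k T p) Z)"
      using bounded_opsD(3)[OF T r[OF p]] act(2)[OF p] act(2)[OF hpoly_smult[OF p]] by metis
    then show "restrict_domain (poly_action k T (\<lambda>Z. c * p Z)) = restrict_domain (\<lambda>Z. c * poly_action k T p Z)"
      by (simp add: restrict_domain_def fun_eq_iff)
  qed (intro act hpoly_smult p)+
  assume q: "hpoly k q"
  show "poly_action k T (\<lambda>Z. p Z + q Z) = (\<lambda>Z. poly_action k T p Z + poly_action k T q Z)"
  proof (rule restrict_hpoly_inject[where k = k])
    have "restrict_domain (\<lambda>Z. p Z + q Z) = (\<lambda>Z. restrict_domain p Z + restrict_domain q Z)"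
      by (simp add: restrict_domain_def fun_eq_iff)
    then have "restrict_domain (poly_action k T (\<lambda>Z. p Z + q Z))
        = (\<lambda>Z. restrict_domain (poly_action k T p) Z + restrict_domain (poly_action k T q) Z)"
      using bounded_opsD(2)[OF T r[OF p] r[OF q]] act(2)[OF p] act(2)[OF q] act(2)[OF hpoly.add[OF p q]]
      by metis
    then show "restrict_domain (poly_action k T (\<lambda>Z. p Z + q Z))
        = restrict_domain (\<lambda>Z. poly_action k T p Z + poly_action k T q Z)"
      by (simp add: restrict_domain_def fun_eq_iff)
  qed (intro act hpoly.add p q)+
qed

lemma poly_action_translate:
  fixes T :: "('n::finite cmatrix \<Rightarrow> complex) \<Rightarrow> 'n cmatrix \<Rightarrow> complex"
  assumes lam: "lam > 2 * real CARD('n) - 1" and T: "T \<in> bounded_ops lam"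
    and rot: "commutes_with_rotations lam T"
    and AB: "A \<in> unitary_group" "B \<in> unitary_group"
    and inv: "\<And>f. f \<in> bergman_space lam \<Longrightarrow> T (\<lambda>Z. f (A ** Z ** B)) = (\<lambda>Z. T f (A ** Z ** B))"
    and p: "hpoly k p"
  shows "poly_action k T (\<lambda>Z. p (A ** Z ** B)) = (\<lambda>Z. poly_action k T p (A ** Z ** B))"
proof (rule restrict_hpoly_inject[where k = k])
  note act = poly_action_represents[OF lam T rot]
  have "restrict_domain (poly_action k T (\<lambda>Z. p (A ** Z ** B))) = T (restrict_domain (\<lambda>Z. p (A ** Z ** B)))"
    by (rule act(2)[symmetric]) (auto intro: hpoly_translate p)
  also have "\<dots> = (\<lambda>Z. restrict_domain (poly_action k T p) (A ** Z ** B))"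
    unfolding restrict_domain_translate[OF AB] inv[OF restrict_hpoly_in_bergman_space[OF lam p]]
    by (simp add: act(2)[OF p])
  also have "\<dots> = restrict_domain (\<lambda>Z. poly_action k T p (A ** Z ** B))"
    by (rule restrict_domain_translate[OF AB, symmetric])
  finally show "restrict_domain (poly_action k T (\<lambda>Z. p (A ** Z ** B)))
      = restrict_domain (\<lambda>Z. poly_action k T p (A ** Z ** B))" .
  show "hpoly k (poly_action k T (\<lambda>Z. p (A ** Z ** B)))" "hpoly k (\<lambda>Z. poly_action k T p (A ** Z ** B))"
    by (auto intro: act hpoly_translate p)
qed

text \<open>The two products agree on polynomials, both are bounded, and polynomials are dense.\<close>

lemma left_right_intertwiners_commute:
  fixes S T :: "('n::finite cmatrix \<Rightarrow> complex) \<Rightarrow> 'n cmatrix \<Rightarrow> complex"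
  assumes lam: "lam > 2 * real CARD('n) - 1"
    and S: "S \<in> intertwiners lam unitary_left" and T: "T \<in> intertwiners lam unitary_right"
    and f: "f \<in> bergman_space lam"
  shows "S (T f) = T (S f)"
proof -
  have S': "S \<in> bounded_ops lam" and T': "T \<in> bounded_ops lam"
    using S T by (simp_all add: intertwiners_def)
  have S_inv: "S (\<lambda>Z. f (U ** Z)) = (\<lambda>Z. S f (U ** Z))" if "U \<in> unitary_group" "f \<in> bergman_space lam" for U f
    using S that by (simp add: intertwiners_left_iff)
  have T_inv: "T (\<lambda>Z. f (Z ** U)) = (\<lambda>Z. T f (Z ** U))" if "U \<in> unitary_group" "f \<in> bergman_space lam" for U f
    using T that by (simp add: intertwiners_right_iff)
  have S_rot: "commutes_with_rotations lam S" and T_rot: "commutes_with_rotations lam T"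
    using S_inv[OF scalar_unitary] T_inv[OF scalar_unitary] by (simp_all add: commutes_with_rotations_def)
  note S_act = poly_action_represents[OF lam S' S_rot] and T_act = poly_action_represents[OF lam T' T_rot]
  have poly: "S (T (restrict_domain p)) = T (S (restrict_domain p))" if p: "hpoly k p" for k p
  proof -
    have "poly_action k S (poly_action k T p) = poly_action k T (poly_action k S p)"
    proof (rule left_right_commute_on_hpoly[OF _ _ _ _ p])
      show "linear_on_hpoly k (poly_action k S)" by (rule linear_on_hpoly_poly_action[OF lam S' S_rot])
      show "linear_on_hpoly k (poly_action k T)" by (rule linear_on_hpoly_poly_action[OF lam T' T_rot])
      fix U :: "'n cmatrix" and q :: "'n cmatrix \<Rightarrow> complex" assume U: "U \<in> unitary_group" and q: "hpoly k q"
      show "poly_action k S (\<lambda>Z. q (U ** Z)) = (\<lambda>Z. poly_action k S q (U ** Z))"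
        using poly_action_translate[OF lam S' S_rot U unitary_group_mat1 _ q] S_inv[OF U] by simp
      show "poly_action k T (\<lambda>Z. q (Z ** U)) = (\<lambda>Z. poly_action k T q (Z ** U))"
        using poly_action_translate[OF lam T' T_rot unitary_group_mat1 U _ q] T_inv[OF U] by simp
    qed
    then show ?thesis
      by (simp add: S_act(2)[OF p] T_act(2)[OF p] S_act(2)[OF T_act(1)[OF p]]
          T_act(2)[OF S_act(1)[OF p]])
  qed
  obtain C1 where C1: "C1 \<ge> 0" "\<And>f. f \<in> bergman_space lam \<Longrightarrow> bnorm2 lam (S f) \<le> ennreal C1 * bnorm2 lam f"
    using bounded_ops_bnorm2[OF S'] by blast
  obtain C2 where C2: "C2 \<ge> 0" "\<And>f. f \<in> bergman_space lam \<Longrightarrow> bnorm2 lam (T f) \<le> ennreal C2 * bnorm2 lam f"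
    using bounded_ops_bnorm2[OF T'] by blast
  note SH = bounded_opsD(1)[OF S'] and TH = bounded_opsD(1)[OF T']
  define D where "D f Z = S (T f) Z - T (S f) Z" for f Z
  have D_H: "D f \<in> bergman_space lam" if "f \<in> bergman_space lam" for f
    unfolding D_def by (intro bergman_space_diff SH TH that)
  have D_bound: "bnorm2 lam (D f) \<le> ennreal (4 * (C1 * C2)) * bnorm2 lam f" if f: "f \<in> bergman_space lam" for f
  proof -
    have "bnorm2 lam (D f) \<le> 2 * bnorm2 lam (S (T f)) + 2 * bnorm2 lam (\<lambda>Z. - 1 * T (S f) Z)"
      using bnorm2_add_le[OF bergman_spaceD(4)[OF SH[OF TH[OF f]]] bergman_spaceD(4)[OF bergman_space_cmult[OF TH[OF SH[OF f]], of "-1"]]]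
      by (simp add: D_def[abs_def])
    also have "bnorm2 lam (\<lambda>Z. - 1 * T (S f) Z) = bnorm2 lam (T (S f))"
      by (subst bnorm2_cmult[OF bergman_spaceD(4)[OF TH[OF SH[OF f]]]]) simp
    also have "2 * bnorm2 lam (S (T f)) + 2 * bnorm2 lam (T (S f))
        \<le> 2 * (ennreal C1 * (ennreal C2 * bnorm2 lam f)) + 2 * (ennreal C2 * (ennreal C1 * bnorm2 lam f))"
      using C1(2)[OF TH[OF f]] C2(2)[OF f] C2(2)[OF SH[OF f]] C1(2)[OF f]
      by (intro add_mono mult_left_mono order_trans[OF C1(2)[OF TH[OF f]]] order_trans[OF C2(2)[OF SH[OF f]]]) auto
    also have "\<dots> = 4 * (ennreal C1 * (ennreal C2 * bnorm2 lam f))"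
      by (simp add: mult.left_commute[of "ennreal C2"] flip: distrib_right)
    also have "\<dots> = ennreal (4 * (C1 * C2)) * bnorm2 lam f"
      using C1(1) C2(1) by (simp add: ennreal_mult mult_ac)
    finally show ?thesis .
  qed
  have t: "hpoly k (taylor_part k f)" for k
    by (rule hpoly_taylor_part[OF open_cartan_domain zero_in_cartan_domain bergman_spaceD(1)[OF f]])
  have r: "restrict_domain (taylor_part k f) \<in> bergman_space lam" for k
    by (rule restrict_hpoly_in_bergman_space[OF lam t])
  define s where "s K Z = (\<Sum>k<K. restrict_domain (taylor_part k f) Z)" for K Z
  have sH: "s K \<in> bergman_space lam" for K unfolding s_def by (intro bergman_space_sum r)
  have D_s: "D (s K) = (\<lambda>_. 0)" for K
    unfolding D_def s_def
    by (simp add: bounded_ops_sum[OF S'] bounded_ops_sum[OF T'] r SH TH poly[OF t])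
  have D_diff: "D (\<lambda>Z. f Z - s K Z) = D f" for K
    using D_s[of K] unfolding D_def fun_eq_iff
    by (simp add: bounded_ops_diff[OF S'] bounded_ops_diff[OF T'] f sH SH TH)
  have "bnorm2 lam (D f) \<le> ennreal (4 * (C1 * C2)) * bnorm2 lam (\<lambda>Z. f Z - s K Z)" for K
    using D_bound[OF bergman_space_diff[OF f sH[of K]]] unfolding D_diff .
  moreover have "(\<lambda>K. ennreal (4 * (C1 * C2)) * bnorm2 lam (\<lambda>Z. f Z - s K Z)) \<longlonglongrightarrow> ennreal (4 * (C1 * C2)) * 0"
    unfolding s_def by (intro ennreal_tendsto_cmult taylor_tail_tendsto_0[OF lam f]) simp
  ultimately have "bnorm2 lam (D f) \<le> 0"
    by (intro tendsto_lowerbound[of _ _ sequentially]) auto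
  then have "D f = (\<lambda>_. 0)" by (intro bergman_space_eq_zero[OF lam D_H[OF f]]) simp
  then show ?thesis by (simp add: D_def fun_eq_iff)
qed

section \<open>The commutation theorem\<close>

text \<open>The operator \<open>f \<mapsto> f (A ** \<cdot> ** B)\<close>, undefined outside the Bergman space as required of members of \<open>bounded_ops\<close>.\<close>

definition translation :: "real \<Rightarrow> 'n::finite cmatrix \<Rightarrow> 'n cmatrix \<Rightarrow> ('n cmatrix \<Rightarrow> complex) \<Rightarrow> 'n cmatrix \<Rightarrow> complex"
  where "translation lam A B = (\<lambda>f\<in>bergman_space lam. \<lambda>Z. f (A ** Z ** B))"

lemma translation_bounded:
  assumes "A \<in> unitary_group" "B \<in> unitary_group"
  shows "translation lam A B \<in> bounded_ops lam"
proof -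
  have "bergman_norm lam (\<lambda>Z. f (A ** Z ** B)) = bergman_norm lam f" if f: "f \<in> bergman_space lam" for f
  proof -
    have nn: "bergman_norm lam g \<ge> 0" for g :: "'a cmatrix \<Rightarrow> complex"
      by (simp add: bergman_norm_def integral_nonneg_AE)
    have "ennreal ((bergman_norm lam (\<lambda>Z. f (A ** Z ** B)))\<^sup>2) = ennreal ((bergman_norm lam f)\<^sup>2)"
      using bnorm2_translate[OF f assms] bergman_spaceD(5)[OF f]
        bergman_spaceD(5)[OF bergman_space_translate[OF f assms]] by simp
    then show ?thesis using nn by (simp add: power2_eq_iff_nonneg)
  qed
  then show ?thesis
    unfolding bounded_ops_def translation_def using assms
    by (auto simp: bergman_space_translate bergman_space_add bergman_space_cmult intro!: exI[of _ 1])
qed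

lemma translation_apply: "f \<in> bergman_space lam \<Longrightarrow> translation lam A B f = (\<lambda>Z. f (A ** Z ** B))"
  by (simp add: translation_def)

lemma translation_right_in_intertwiners_left:
  assumes B: "B \<in> unitary_group"
  shows "translation lam (mat 1) B \<in> intertwiners lam unitary_left"
proof -
  have "translation lam (mat 1) B (\<lambda>Z. f (U ** Z)) = (\<lambda>Z. translation lam (mat 1) B f (U ** Z))"
    if U: "U \<in> unitary_group" and f: "f \<in> bergman_space lam" for U f
    using bergman_space_translate[OF f U unitary_group_mat1]
    by (simp add: translation_apply f matrix_mul_assoc)
  then show ?thesis
    using translation_bounded[OF unitary_group_mat1 B] by (simp add: intertwiners_left_iff)
qed

lemma translation_left_in_intertwiners_right:
  assumes A: "A \<in> unitary_group"
  shows "translation lam A (mat 1) \<in> intertwiners lam unitary_right"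
proof -
  have "translation lam A (mat 1) (\<lambda>Z. f (Z ** U)) = (\<lambda>Z. translation lam A (mat 1) f (Z ** U))"
    if U: "U \<in> unitary_group" and f: "f \<in> bergman_space lam" for U f
    using bergman_space_translate[OF f unitary_group_mat1 U]
    by (simp add: translation_apply f matrix_mul_assoc)
  then show ?thesis
    using translation_bounded[OF A unitary_group_mat1] by (simp add: intertwiners_right_iff)
qed

theorem corollary4p20:
  fixes lam :: real
  assumes "lam > 2 * real CARD('n::finite) - 1"
  shows "commutant lam (intertwiners lam (unitary_left :: ('n cmatrix \<times> 'n cmatrix) set))
           = intertwiners lam unitary_right
       \<and> commutant lam (intertwiners lam (unitary_right :: ('n cmatrix \<times> 'n cmatrix) set))
           = intertwiners lam unitary_left"
proof (intro conjI set_eqI iffI)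
  fix T :: "('n cmatrix \<Rightarrow> complex) \<Rightarrow> 'n cmatrix \<Rightarrow> complex"
  assume T: "T \<in> commutant lam (intertwiners lam unitary_left)"
  then have T': "T \<in> bounded_ops lam" by (simp add: commutant_def)
  moreover have "T (\<lambda>Z. f (Z ** B)) = (\<lambda>Z. T f (Z ** B))" if "B \<in> unitary_group" "f \<in> bergman_space lam" for B f
  proof -
    have "T (translation lam (mat 1) B f) = translation lam (mat 1) B (T f)"
      using T translation_right_in_intertwiners_left[OF that(1)] that(2) by (simp add: commutant_def)
    then show ?thesis by (simp add: translation_apply that(2) bounded_opsD(1)[OF T'])
  qed
  ultimately show "T \<in> intertwiners lam unitary_right" by (simp add: intertwiners_right_iff)
next
  fix T :: "('n cmatrix \<Rightarrow> complex) \<Rightarrow> 'n cmatrix \<Rightarrow> complex"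
  assume T: "T \<in> intertwiners lam unitary_right"
  then have "T \<in> bounded_ops lam" by (simp add: intertwiners_def)
  then show "T \<in> commutant lam (intertwiners lam unitary_left)"
    using left_right_intertwiners_commute[OF assms _ T] by (simp add: commutant_def)
next
  fix T :: "('n cmatrix \<Rightarrow> complex) \<Rightarrow> 'n cmatrix \<Rightarrow> complex"
  assume T: "T \<in> commutant lam (intertwiners lam unitary_right)"
  then have T': "T \<in> bounded_ops lam" by (simp add: commutant_def)
  moreover have "T (\<lambda>Z. f (A ** Z)) = (\<lambda>Z. T f (A ** Z))" if "A \<in> unitary_group" "f \<in> bergman_space lam" for A f
  proof -
    have "T (translation lam A (mat 1) f) = translation lam A (mat 1) (T f)"
      using T translation_left_in_intertwiners_right[OF that(1)] that(2) by (simp add: commutant_def)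
    then show ?thesis by (simp add: translation_apply that(2) bounded_opsD(1)[OF T'])
  qed
  ultimately show "T \<in> intertwiners lam unitary_left" by (simp add: intertwiners_left_iff)
next
  fix T :: "('n cmatrix \<Rightarrow> complex) \<Rightarrow> 'n cmatrix \<Rightarrow> complex"
  assume T: "T \<in> intertwiners lam unitary_left"
  then have "T \<in> bounded_ops lam" by (simp add: intertwiners_def)
  then show "T \<in> commutant lam (intertwiners lam unitary_right)"
    using left_right_intertwiners_commute[OF assms T] by (simp add: commutant_def)
qed

end
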